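(* Let $n\ge 3$ and let $M_1,M_2\subset\mathbb{R}^n$ be two nonempty closed, path-connected sets with path-connected complements $\mathbb{R}^n\setminus M_i$, $i=1,2$. Suppose there are scales $r_{M_1},r_{M_2}>0$ with $\delta(M_i,r_{M_i})<g_n$ for $i=1,2$, and that the Hausdorff distance satisfies $$\operatorname{dist}_{\mathscr H}(M_1,M_2)<\tfrac14\min\{r_{M_1},r_{M_2}\}.$$ Then there exists a group isomorphism $J:\pi_1(\mathbb{R}^n\setminus M_1)\to\pi_1(\mathbb{R}^n\setminus M_2)$ such that its restriction to the peripheral subgroup $P_{M_1}\subset\pi_1(\mathbb{R}^n\setminus M_1)$ maps $P_{M_1}$ isomorphically onto $P_{M_2}\subset\pi_1(\mathbb{R}^n\setminus M_2)$.
   Context: For a nonempty closed, path-connected set $M\subset\mathbb{R}^n$ and $x,y\in M$, the intrinsic distance $d_M(x,y)$ is the length of the shortest curve in $M$ connecting $x$ and $y$. The local distortion of $M$ at scale $r>0$ is $$\delta(M,r):=\sup_{x,y\in M,\ 0<|x-y|\le 2r}\frac{d_M(x,y)}{|x-y|}.$$ For $n\ge3$ set $g_n:=\sqrt{\frac{2n-2}{n}}\,\arcsin\sqrt{\frac{n}{2n-2}}$. Fundamental group and peripheral subgroup: for $M\subset\mathbb{R}^n$ with path-connected complement, two closed loops $c_1,c_2\in C^0(\mathbb{R}/\mathbb{Z},\mathbb{R}^n\setminus M)$ are equivalent if they are homotopic in $\mathbb{R}^n\setminus M$; $\pi_1(\mathbb{R}^n\setminus M)$ consists of the respective equivalence classes,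 with group structure induced by concatenation of closed loops containing a fixed base point in $\mathbb{R}^n\setminus M$. The peripheral subgroup $P_M\subset\pi_1(\mathbb{R}^n\setminus M)$ consists of all equivalence classes that possess representative loops arbitrarily close to $M$, i.e. for every $\epsilon>0$ a representative loop with image in $\{x:0<\operatorname{dist}(x,M)<\epsilon\}$. *)

theory Defs
  imports "HOL-Analysis.Analysis" "HOL-Algebra.Group"
begin

text \<open>Lengths, distances and distortions take values in \<^typ>\<open>ennreal\<close>, so that
  non-rectifiable curves and unbounded sets need no side conditions.\<close>

definition curve_length :: "(real \<Rightarrow> 'a::metric_space) \<Rightarrow> ennreal" where
  "curve_length p =
     (SUP (k, t) \<in> {(k::nat, t::nat \<Rightarrow> real).
                      (\<forall>i\<le>k. t i \<in> {0..1}) \<and> (\<forall>i<k. t i \<le> t (Suc i))}.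
        \<Sum>i<k. ennreal (dist (p (t i)) (p (t (Suc i)))))"

text \<open>The infimum is infinite if no rectifiable curve in \<open>M\<close> joins \<open>x\<close> and \<open>y\<close>.
  If it is finite and \<open>M\<close> is a closed subset of a Euclidean space, it is attained, so it is
  the length of a shortest curve.\<close>

definition intrinsic_dist :: "'a::metric_space set \<Rightarrow> 'a \<Rightarrow> 'a \<Rightarrow> ennreal" where
  "intrinsic_dist M x y =
     (INF p \<in> {p. path p \<and> path_image p \<subseteq> M \<and> pathstart p = x \<and> pathfinish p = y}. curve_length p)"

definition local_distortion :: "'a::metric_space set \<Rightarrow> real \<Rightarrow> ennreal" where
  "local_distortion M r =
     (SUP (x, y) \<in> {(x, y). x \<in> M \<and> y \<in> M \<and> 0 < dist x y \<and> dist x y \<le> 2 * r}.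
        intrinsic_dist M x y / ennreal (dist x y))"

definition distortion_bound :: "nat \<Rightarrow> real" where
  "distortion_bound n =
     sqrt ((2 * real n - 2) / real n) * arcsin (sqrt (real n / (2 * real n - 2)))"

definition hausdorff_dist :: "'a::metric_space set \<Rightarrow> 'a set \<Rightarrow> ennreal" where
  "hausdorff_dist A B =
     max (SUP x\<in>A. INF y\<in>B. ennreal (dist x y)) (SUP y\<in>B. INF x\<in>A. ennreal (dist x y))"

text \<open>The elements of the fundamental group of \<open>S\<close> at the base point \<open>a\<close> are the classes of
  loops at \<open>a\<close> under homotopy in \<open>S\<close> relative to the base point.\<close>

definition fundamental_group :: "'a::real_normed_vector set \<Rightarrow> 'a \<Rightarrow> (real \<Rightarrow> 'a) set monoid" where
  "fundamental_group S a =
     \<lparr>carrier = {Collect (homotopic_paths S p) | p.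
                   path p \<and> path_image p \<subseteq> S \<and> pathstart p = a \<and> pathfinish p = a},
      mult = (\<lambda>C D. {r. \<exists>p\<in>C. \<exists>q\<in>D. homotopic_paths S (p +++ q) r}),
      one = Collect (homotopic_paths S (linepath a a))\<rparr>"

text \<open>A loop close to \<open>M\<close> does not in general pass through the base point. A
  representative is therefore a loop freely homotopic in the complement of \<open>M\<close> to the loops in the
  class, and the resulting set of classes is invariant under conjugation.\<close>

definition peripheral_subgroup :: "'a::real_normed_vector set \<Rightarrow> 'a \<Rightarrow> (real \<Rightarrow> 'a) set set" where
  "peripheral_subgroup M a =
     {C \<in> carrier (fundamental_group (- M) a).
        \<forall>\<epsilon>>0. \<exists>p\<in>C. \<exists>c. homotopic_loops (- M) p c \<and>
                path_image c \<subseteq> {x. 0 < infdist x M \<and> infdist x M < \<epsilon>}}"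

lemma mult_fundamental_group:
  assumes "pathfinish p = pathstart q"
    and "path p" "path_image p \<subseteq> S" "path q" "path_image q \<subseteq> S"
  shows "Collect (homotopic_paths S p) \<otimes>\<^bsub>fundamental_group S a\<^esub> Collect (homotopic_paths S q) =
    Collect (homotopic_paths S (p +++ q))"
proof (intro equalityI subsetI)
  fix r
  assume "r \<in> Collect (homotopic_paths S p) \<otimes>\<^bsub>fundamental_group S a\<^esub> Collect (homotopic_paths S q)"
  then obtain p' q' where "homotopic_paths S p p'" "homotopic_paths S q q'"
      "homotopic_paths S (p' +++ q') r"
    by (auto simp: fundamental_group_def)
  then show "r \<in> Collect (homotopic_paths S (p +++ q))"
    using homotopic_paths_join[OF _ _ assms(1)] homotopic_paths_trans by blast
next
  fix r
  assume "r \<in> Collect (homotopic_paths S (p +++ q))"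
  moreover have "homotopic_paths S p p" "homotopic_paths S q q"
    using assms by simp_all
  ultimately show "r \<in> Collect (homotopic_paths S p) \<otimes>\<^bsub>fundamental_group S a\<^esub> Collect (homotopic_paths S q)"
    unfolding fundamental_group_def by (simp only: monoid.simps mem_Collect_eq) blast
qed

lemma homotopic_paths_class_eq:
  "homotopic_paths S p q \<Longrightarrow> Collect (homotopic_paths S p) = Collect (homotopic_paths S q)"
  using homotopic_paths_trans[of S p q] homotopic_paths_trans[of S q p]
  by (auto simp: homotopic_paths_sym_eq[of S q p])

lemma carrier_fundamental_group:
  "C \<in> carrier (fundamental_group S a) \<longleftrightarrow>
     (\<exists>p. C = Collect (homotopic_paths S p) \<and>
          path p \<and> path_image p \<subseteq> S \<and> pathstart p = a \<and> pathfinish p = a)"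
  by (auto simp: fundamental_group_def)

lemma group_fundamental_group:
  assumes "a \<in> S"
  shows "group (fundamental_group S a)"
proof (rule groupI)
  let ?G = "fundamental_group S a"
  have one: "\<one>\<^bsub>?G\<^esub> = Collect (homotopic_paths S (linepath a a))"
    by (simp add: fundamental_group_def)
  show "\<one>\<^bsub>?G\<^esub> \<in> carrier ?G"
    unfolding one carrier_fundamental_group
    using assms by (intro exI[of _ "linepath a a"]) auto
  fix C assume "C \<in> carrier ?G"
  then obtain p where C: "C = Collect (homotopic_paths S p)"
    and p: "path p" "path_image p \<subseteq> S" "pathstart p = a" "pathfinish p = a"
    by (auto simp: carrier_fundamental_group)
  have "homotopic_paths S (linepath a a +++ p) p"
    using homotopic_paths_lid[of p S] p by simp
  then show "\<one>\<^bsub>?G\<^esub> \<otimes>\<^bsub>?G\<^esub> C = C"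
    unfolding one C using p assms
    by (simp add: mult_fundamental_group) (rule homotopic_paths_class_eq)
  show "\<exists>D\<in>carrier ?G. D \<otimes>\<^bsub>?G\<^esub> C = \<one>\<^bsub>?G\<^esub>"
  proof
    show "Collect (homotopic_paths S (reversepath p)) \<in> carrier ?G"
      unfolding carrier_fundamental_group
      using p by (intro exI[of _ "reversepath p"]) auto
    have "homotopic_paths S (reversepath p +++ p) (linepath a a)"
      using homotopic_paths_linv[of p S] p by simp
    then show "Collect (homotopic_paths S (reversepath p)) \<otimes>\<^bsub>?G\<^esub> C = \<one>\<^bsub>?G\<^esub>"
      unfolding one C using p
      by (simp add: mult_fundamental_group) (rule homotopic_paths_class_eq)
  qed
  fix D assume "D \<in> carrier ?G"
  then obtain q where D: "D = Collect (homotopic_paths S q)"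
    and q: "path q" "path_image q \<subseteq> S" "pathstart q = a" "pathfinish q = a"
    by (auto simp: carrier_fundamental_group)
  have pq: "path (p +++ q)" "path_image (p +++ q) \<subseteq> S"
    using p q by (auto simp: path_image_join)
  show "C \<otimes>\<^bsub>?G\<^esub> D \<in> carrier ?G"
    unfolding C D carrier_fundamental_group using p q pq
    by (intro exI[of _ "p +++ q"]) (auto simp: mult_fundamental_group)
  fix E assume "E \<in> carrier ?G"
  then obtain r where E: "E = Collect (homotopic_paths S r)"
    and r: "path r" "path_image r \<subseteq> S" "pathstart r = a" "pathfinish r = a"
    by (auto simp: carrier_fundamental_group)
  have qr: "path (q +++ r)" "path_image (q +++ r) \<subseteq> S"
    using q r by (auto simp: path_image_join)
  have "homotopic_paths S ((p +++ q) +++ r) (p +++ (q +++ r))"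
    by (rule homotopic_paths_sym, rule homotopic_paths_assoc) (use p q r in simp_all)
  then show "C \<otimes>\<^bsub>?G\<^esub> D \<otimes>\<^bsub>?G\<^esub> E = C \<otimes>\<^bsub>?G\<^esub> (D \<otimes>\<^bsub>?G\<^esub> E)"
    unfolding C D E using p q r pq qr
    by (simp add: mult_fundamental_group) (rule homotopic_paths_class_eq)
qed

end

theory Submission
  imports Defs "HOL-Algebra.Coset"
begin

text \<open>
  Write \<open>d\<close> for the distance to a closed set \<open>M\<close> in a space of dimension \<open>n\<close>. The complement of
  \<open>M\<close> and the sets \<open>{x. t < d x}\<close> have the same fundamental group as long as \<open>d\<close> has no critical
  point of height at most \<open>t\<close>, because then one can flow away from \<open>M\<close> and, just as well, towards
  \<open>M\<close>. The distortion bound excludes almost all critical points below the scale \<open>r\<close>.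

  A point \<open>x\<close> with \<open>\<rho> = d x\<close> is critical if it lies in the convex hull of its nearest points in
  \<open>M\<close>. If \<open>n\<close> of these suffice for that, then two of them are seen from \<open>x\<close> under an angle
  \<open>\<theta>\<close> with \<open>cos \<theta> \<le> - 1 / (n - 1)\<close>. A curve in \<open>M\<close> joining them avoids the open ball of radius
  \<open>\<rho>\<close> about \<open>x\<close> and has length at least \<open>\<rho> * \<theta>\<close>, while their distance is
  \<open>2 * \<rho> * sin (\<theta> / 2)\<close>; the smallest quotient of the two is \<open>distortion_bound n\<close>. By
  Caratheodory's theorem there may still be critical points that need \<open>n + 1\<close> nearest points, but
  those lie in the interior of the hull, so \<open>d\<close> has a strict local maximum there. All this holds
  with uniform constants and for almost nearest points: every \<open>x\<close> with \<open>s \<le> d x \<le> t < r\<close> is either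
  steep, with a direction leading away from all its almost nearest points, or a peak
  (\<open>steep_or_surrounded\<close>, \<open>steep_or_peak\<close>).

  Uniform steepness replaces a gradient flow: the steep directions are glued by a partition of unity
  to a continuous field, and short steps along it are iterated. A point that meets no peak rises
  above the level \<open>t\<close>; a point that meets a peak is trapped in a small ball around it. A connected
  set is therefore either pushed above \<open>t\<close> as a whole or into one small ball
  (\<open>connected_push_or_trap\<close>). As the complement of \<open>M\<close> is connected, there are two cases.
  If \<open>d\<close> exceeds \<open>t\<close> somewhere, then a path from a peak of height at most \<open>t\<close> to such a place
  would contradict this alternative, so all points of height at most \<open>t\<close> are steep
  (\<open>uniformly_steep\<close>). If \<open>d\<close> is bounded by some \<open>T < r\<close>, then every loop is pushed into a
  small ball, and the fundamental group is trivial (\<open>null_homotopic_if_infdist_bounded\<close>).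

  Now let \<open>h < min r\<^sub>1 r\<^sub>2 / 4\<close> exceed the Hausdorff distance of \<open>M\<^sub>1\<close> and \<open>M\<^sub>2\<close>, so that the
  distance functions \<open>d\<^sub>1\<close> and \<open>d\<^sub>2\<close> differ by at most \<open>h\<close>. If \<open>d\<^sub>1 > 3 * h\<close> and \<open>d\<^sub>2 > 2 * h\<close>
  hold together at some point, consider
  \<open>{d\<^sub>1 > 3 * h} \<subseteq> U \<subseteq> {d\<^sub>1 > h} \<subseteq> - M\<^sub>2\<close> with \<open>U = {d\<^sub>2 > 2 * h}\<close>.
  The inclusions of \<open>{d\<^sub>1 > 3 * h}\<close> and of \<open>{d\<^sub>1 > h}\<close> into \<open>- M\<^sub>1\<close>, and that of \<open>U\<close> into
  \<open>- M\<^sub>2\<close>, induce isomorphisms, hence so does the inclusion of \<open>U\<close> into \<open>- M\<^sub>1\<close>. Loops in \<open>U\<close>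
  thus represent both groups. A peripheral loop of one set can be lifted to a low level and stays
  low for the other set, where it is pushed down again
  (\<open>peripheral_iso_via_common_subset\<close>). If there is no such point, then \<open>d\<^sub>1\<close> and \<open>d\<^sub>2\<close> are
  bounded by \<open>4 * h\<close>, and both groups are trivial.
\<close>

section \<open>Curves outside a ball\<close>

text \<open>The triangle inequality for angles: after subtracting the components along \<open>v\<close>, the
  Cauchy-Schwarz inequality bounds \<open>u \<bullet> w\<close> from below by the cosine of the sum.\<close>

lemma arccos_triangle:
  fixes u v w :: "'a::real_inner"
  assumes "norm u = 1" "norm v = 1" "norm w = 1"
  shows "arccos (u \<bullet> w) \<le> arccos (u \<bullet> v) + arccos (v \<bullet> w)"
proof (cases "arccos (u \<bullet> v) + arccos (v \<bullet> w) \<le> pi")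
  case True
  have b: "\<bar>u \<bullet> v\<bar> \<le> 1" "\<bar>v \<bullet> w\<bar> \<le> 1" "\<bar>u \<bullet> w\<bar> \<le> 1"
    using Cauchy_Schwarz_ineq2[of u v] Cauchy_Schwarz_ineq2[of v w] Cauchy_Schwarz_ineq2[of u w] assms by auto
  define \<alpha> \<beta> where "\<alpha> = arccos (u \<bullet> v)" and "\<beta> = arccos (v \<bullet> w)"
  have cs: "cos \<alpha> = u \<bullet> v" "cos \<beta> = v \<bullet> w" "0 \<le> \<alpha>" "0 \<le> \<beta>" "\<alpha> \<le> pi" "\<beta> \<le> pi"
    using b by (auto simp: \<alpha>_def \<beta>_def cos_arccos_abs arccos_lbound arccos_ubound abs_le_iff)
  have uu: "u \<bullet> u = 1" "v \<bullet> v = 1" "w \<bullet> w = 1"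
    using assms by (auto simp: dot_square_norm)
  have sq: "norm (u - cos \<alpha> *\<^sub>R v) = sin \<alpha>" "norm (w - cos \<beta> *\<^sub>R v) = sin \<beta>"
  proof -
    have "(norm (u - cos \<alpha> *\<^sub>R v))\<^sup>2 = 1 - (cos \<alpha>)\<^sup>2"
      unfolding power2_norm_eq_inner using uu cs
      by (simp add: inner_diff_left inner_diff_right inner_commute power2_eq_square)
    then have "(norm (u - cos \<alpha> *\<^sub>R v))\<^sup>2 = (sin \<alpha>)\<^sup>2" by (simp add: sin_squared_eq)
    then show "norm (u - cos \<alpha> *\<^sub>R v) = sin \<alpha>"
      using sin_ge_zero[OF cs(3,5)] by (simp add: power2_eq_iff_nonneg)
    have "(norm (w - cos \<beta> *\<^sub>R v))\<^sup>2 = 1 - (cos \<beta>)\<^sup>2"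
      unfolding power2_norm_eq_inner using uu cs
      by (simp add: inner_diff_left inner_diff_right inner_commute power2_eq_square)
    then have "(norm (w - cos \<beta> *\<^sub>R v))\<^sup>2 = (sin \<beta>)\<^sup>2" by (simp add: sin_squared_eq)
    then show "norm (w - cos \<beta> *\<^sub>R v) = sin \<beta>"
      using sin_ge_zero[OF cs(4,6)] by (simp add: power2_eq_iff_nonneg)
  qed
  have "(u - cos \<alpha> *\<^sub>R v) \<bullet> (w - cos \<beta> *\<^sub>R v) = u \<bullet> w - cos \<alpha> * cos \<beta>"
    using uu cs by (simp add: inner_diff_left inner_diff_right inner_commute algebra_simps)
  moreover have "\<bar>(u - cos \<alpha> *\<^sub>R v) \<bullet> (w - cos \<beta> *\<^sub>R v)\<bar> \<le> sin \<alpha> * sin \<beta>"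
    using Cauchy_Schwarz_ineq2 sq by metis
  ultimately have "cos (\<alpha> + \<beta>) \<le> u \<bullet> w"
    by (simp add: cos_add abs_le_iff)
  then have "arccos (u \<bullet> w) \<le> arccos (cos (\<alpha> + \<beta>))"
    using b by (intro arccos_le_arccos) (auto simp: abs_le_iff)
  also have "\<dots> = \<alpha> + \<beta>"
    using True cs by (intro arccos_cos) (auto simp: \<alpha>_def \<beta>_def)
  finally show ?thesis by (simp add: \<alpha>_def \<beta>_def)
next
  case False
  have "\<bar>u \<bullet> w\<bar> \<le> 1" using Cauchy_Schwarz_ineq2[of u w] assms by auto
  then have "arccos (u \<bullet> w) \<le> pi" by (auto simp: arccos_ubound abs_le_iff)
  with False show ?thesis by linarith
qed

lemma norm_diff_unit_vectors:
  fixes v w :: "'a::real_inner"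
  assumes "norm v = 1" "norm w = 1"
  shows "norm (v - w) = 2 * sin (arccos (v \<bullet> w) / 2)"
proof -
  have b: "\<bar>v \<bullet> w\<bar> \<le> 1" using Cauchy_Schwarz_ineq2[of v w] assms by auto
  define \<theta> where "\<theta> = arccos (v \<bullet> w)"
  have \<theta>: "0 \<le> \<theta>" "\<theta> \<le> pi" "cos \<theta> = v \<bullet> w"
    using b by (auto simp: \<theta>_def cos_arccos_abs arccos_lbound arccos_ubound abs_le_iff)
  have "(norm (v - w))\<^sup>2 = 2 - 2 * cos \<theta>"
    using assms \<theta>(3) by (simp add: dot_norm_neg)
  also have "\<dots> = (2 * sin (\<theta> / 2))\<^sup>2"
    using cos_double_sin[of "\<theta>/2"] by (simp add: power2_eq_square)
  finally show ?thesis
    using power2_eq_imp_eq[of "norm (v - w)" "2 * sin (\<theta> / 2)"] sin_ge_zero[of "\<theta>/2"] \<theta>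
    by (simp add: \<theta>_def)
qed

text \<open>Radial projection onto a sphere does not increase distances outside the ball.\<close>

lemma norm_radial_projection_diff_le:
  fixes a b :: "'a::real_inner"
  assumes "\<rho> > 0" "\<rho> \<le> norm a" "\<rho> \<le> norm b"
  shows "\<rho> * norm (a /\<^sub>R norm a - b /\<^sub>R norm b) \<le> norm (a - b)"
proof -
  have pos: "norm a > 0" "norm b > 0" using assms by linarith+
  let ?v = "a /\<^sub>R norm a" and ?w = "b /\<^sub>R norm b"
  have n: "norm ?v = 1" "norm ?w = 1" using pos by auto
  have a: "a = norm a *\<^sub>R ?v" and b: "b = norm b *\<^sub>R ?w" using pos by auto
  have "norm (a - b)^2 = (norm a)^2 + (norm b)^2 - 2 * (norm a * norm b) * (?v \<bullet> ?w)"
    using pos by (simp add: power2_norm_eq_inner inner_diff_left inner_diff_right inner_commute field_simps)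
  moreover have "norm (?v - ?w)^2 = 2 - 2 * (?v \<bullet> ?w)"
    using n by (simp only: power2_norm_eq_inner inner_diff_left inner_diff_right)
      (simp add: inner_commute dot_square_norm)
  ultimately have "norm (a - b)^2 = (norm a - norm b)^2 + norm a * norm b * norm (?v - ?w)^2"
    by (simp only: power2_diff) (simp only: algebra_simps)
  moreover have "\<rho>^2 * norm (?v - ?w)^2 \<le> norm a * norm b * norm (?v - ?w)^2"
    unfolding power2_eq_square[of \<rho>] using assms by (intro mult_right_mono mult_mono) auto
  ultimately have "(\<rho> * norm (?v - ?w))^2 \<le> norm (a - b)^2"
    by (simp add: power_mult_distrib add_increasing)
  then show ?thesis by (rule power2_le_imp_le) simp
qed

text \<open>Chords of short arcs are almost as long as the arcs, so that the chords of a fine partition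
  measure the angle swept by a curve.\<close>

lemma angle_le_chord_near_zero:
  assumes "K > 1"
  obtains \<delta> where "\<delta> > 0"
    "\<And>\<theta>. 0 \<le> \<theta> \<Longrightarrow> \<theta> \<le> pi \<Longrightarrow> 2 * sin (\<theta> / 2) < \<delta> \<Longrightarrow> \<theta> \<le> K * (2 * sin (\<theta> / 2))"
proof -
  have "((\<lambda>x::real. sin x / x) \<longlongrightarrow> 1) (at 0)"
    using DERIV_sin[of 0] by (simp add: has_field_derivative_iff)
  moreover have "1 / K < 1" using assms by simp
  ultimately have "\<forall>\<^sub>F x in at (0::real). 1 / K < sin x / x"
    by (rule order_tendstoD)
  then obtain d where d: "d > 0" "\<And>x::real. x \<noteq> 0 \<Longrightarrow> \<bar>x\<bar> < d \<Longrightarrow> 1 / K < sin x / x"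
    by (auto simp: eventually_at dist_real_def)
  define e where "e = min d (pi / 2)"
  have e: "e > 0" "e \<le> pi / 2" "e \<le> d" using d pi_gt_zero by (auto simp: e_def)
  have "sin e > 0" using e by (intro sin_gt_zero) (use pi_gt_zero in linarith)+
  show thesis
  proof (rule that[of "2 * sin e"])
    show "2 * sin e > 0" using \<open>sin e > 0\<close> by simp
    fix \<theta> :: real assume \<theta>: "0 \<le> \<theta>" "\<theta> \<le> pi" "2 * sin (\<theta> / 2) < 2 * sin e"
    have "\<theta> / 2 < e"
    proof (rule ccontr)
      assume "\<not> \<theta> / 2 < e"
      then have "sin e \<le> sin (\<theta> / 2)" using \<theta> e pi_gt_zero by (intro sin_monotone_2pi_le) linarith+
      with \<theta> show False by simp
    qed
    show "\<theta> \<le> K * (2 * sin (\<theta> / 2))"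
    proof (cases "\<theta> = 0")
      case False
      then have "1 / K < sin (\<theta> / 2) / (\<theta> / 2)" using d(2)[of "\<theta> / 2"] \<theta> \<open>\<theta> / 2 < e\<close> e by auto
      then show ?thesis using \<theta> False assms by (simp add: field_simps)
    qed simp
  qed
qed

lemma curve_length_ge_sum:
  assumes "k > 0"
  shows "ennreal (\<Sum>i<k. dist (p (real i / real k)) (p (real (Suc i) / real k))) \<le> curve_length p"
proof -
  let ?t = "\<lambda>i. min 1 (real i / real k)"
  have "(\<Sum>i<k. ennreal (dist (p (?t i)) (p (?t (Suc i))))) \<le> curve_length p"
    unfolding curve_length_def using assms
    by (intro SUP_upper2[of "(k, ?t)"]) (auto simp: divide_right_mono min.coboundedI2 min_le_iff_disj)
  moreover have "(\<Sum>i<k. ennreal (dist (p (?t i)) (p (?t (Suc i))))) =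
      (\<Sum>i<k. ennreal (dist (p (real i / real k)) (p (real (Suc i) / real k))))"
  proof (intro sum.cong refl)
    fix i assume "i \<in> {..<k}"
    then have "real i / real k \<le> 1" "real (Suc i) / real k \<le> 1" by auto
    then show "ennreal (dist (p (?t i)) (p (?t (Suc i)))) =
        ennreal (dist (p (real i / real k)) (p (real (Suc i) / real k)))"
      by (simp only: min_absorb2)
  qed
  moreover have "\<dots> = ennreal (\<Sum>i<k. dist (p (real i / real k)) (p (real (Suc i) / real k)))"
    by (simp add: sum_ennreal)
  ultimately show ?thesis by simp
qed

text \<open>The angle under which the end points are seen from \<open>x\<close> is at most the sum of the angles of a
  fine partition. Each of these is nearly its chord on the sphere, which is no longer than the
  corresponding chord of the curve.\<close>

lemma curve_length_outside_ball:
  fixes p :: "real \<Rightarrow> 'a::real_inner"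
  assumes "path p" and "\<rho> > 0" and out: "\<And>y. y \<in> path_image p \<Longrightarrow> \<rho> \<le> norm (y - x)"
    and L: "curve_length p \<le> ennreal L" "L \<ge> 0"
  shows "\<rho> * arccos (((p 0 - x) /\<^sub>R norm (p 0 - x)) \<bullet> ((p 1 - x) /\<^sub>R norm (p 1 - x))) \<le> L"
proof -
  define v where "v t = (p t - x) /\<^sub>R norm (p t - x)" for t
  have nv: "norm (v t) = 1" if "t \<in> {0..1}" for t
  proof -
    have "norm (p t - x) > 0" using out[of "p t"] that \<open>\<rho> > 0\<close> by (auto simp: path_image_def)
    then show ?thesis by (simp add: v_def)
  qed
  have *: "\<rho> * arccos (v 0 \<bullet> v 1) \<le> K * L" if "K > 1" for K
  proof -
    obtain \<delta> where \<delta>: "\<delta> > 0"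
      "\<And>\<theta>. 0 \<le> \<theta> \<Longrightarrow> \<theta> \<le> pi \<Longrightarrow> 2 * sin (\<theta> / 2) < \<delta> \<Longrightarrow> \<theta> \<le> K * (2 * sin (\<theta> / 2))"
      using angle_le_chord_near_zero[OF \<open>K > 1\<close>] by blast
    have "uniformly_continuous_on {0..1} p"
      using \<open>path p\<close> by (auto simp: path_def intro: compact_uniformly_continuous)
    then obtain d where d: "d > 0" "\<And>s t. s \<in> {0..1} \<Longrightarrow> t \<in> {0..1} \<Longrightarrow> dist s t < d \<Longrightarrow> dist (p s) (p t) < \<rho> * \<delta>"
      using \<open>\<rho> > 0\<close> \<delta>(1) unfolding uniformly_continuous_on_def by (metis mult_pos_pos)
    obtain k :: nat where k: "k > 0" "1 / real k < d"
      using reals_Archimedean[OF d(1)] by (metis inverse_eq_divide zero_less_Suc)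
    let ?t = "\<lambda>i. real i / real k"
    have step: "\<rho> * arccos (v (?t i) \<bullet> v (?t (Suc i))) \<le> K * dist (p (?t i)) (p (?t (Suc i)))" if "i < k" for i
    proof -
      have t: "?t i \<in> {0..1}" "?t (Suc i) \<in> {0..1}" using that by (auto simp: field_simps)
      have "dist (?t i) (?t (Suc i)) = 1 / real k" using k by (simp add: dist_real_def field_simps)
      then have sm: "dist (p (?t i)) (p (?t (Suc i))) < \<rho> * \<delta>" using d(2)[OF t] k by simp
      have pr: "\<rho> * norm (v (?t i) - v (?t (Suc i))) \<le> dist (p (?t i)) (p (?t (Suc i)))"
        using norm_radial_projection_diff_le[OF \<open>\<rho> > 0\<close>, of "p (?t i) - x" "p (?t (Suc i)) - x"] out t
        by (simp add: v_def path_image_def dist_norm)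
      let ?\<theta> = "arccos (v (?t i) \<bullet> v (?t (Suc i)))"
      have b: "\<bar>v (?t i) \<bullet> v (?t (Suc i))\<bar> \<le> 1"
        using Cauchy_Schwarz_ineq2[of "v (?t i)" "v (?t (Suc i))"] nv t by auto
      have "norm (v (?t i) - v (?t (Suc i))) < \<delta>"
        using sm pr \<open>\<rho> > 0\<close> by (smt (verit) mult_less_cancel_left_pos)
      then have "?\<theta> \<le> K * norm (v (?t i) - v (?t (Suc i)))"
        using \<delta>(2)[of ?\<theta>] b norm_diff_unit_vectors[OF nv[OF t(1)] nv[OF t(2)]]
        by (auto simp: arccos_lbound arccos_ubound abs_le_iff)
      then have "\<rho> * ?\<theta> \<le> K * (\<rho> * norm (v (?t i) - v (?t (Suc i))))"
        using \<open>\<rho> > 0\<close> by (metis mult.left_commute mult_le_cancel_left_pos)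
      also have "\<dots> \<le> K * dist (p (?t i)) (p (?t (Suc i)))"
        using pr \<open>K > 1\<close> by simp
      finally show ?thesis .
    qed
    have "j \<le> k \<Longrightarrow> arccos (v 0 \<bullet> v (?t j)) \<le> (\<Sum>i<j. arccos (v (?t i) \<bullet> v (?t (Suc i))))" for j
    proof (induction j)
      case 0
      have "v 0 \<bullet> v 0 = 1" using nv[of 0] by (simp add: dot_square_norm)
      then show ?case by simp
    next
      case (Suc j)
      have "?t j \<in> {0..1}" "?t (Suc j) \<in> {0..1}" using Suc.prems by (auto simp: field_simps)
      then have "arccos (v 0 \<bullet> v (?t (Suc j))) \<le> arccos (v 0 \<bullet> v (?t j)) + arccos (v (?t j) \<bullet> v (?t (Suc j)))"
        by (intro arccos_triangle nv) auto
      with Suc show ?case by simp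
    qed
    from this[of k] have "\<rho> * arccos (v 0 \<bullet> v 1) \<le> \<rho> * (\<Sum>i<k. arccos (v (?t i) \<bullet> v (?t (Suc i))))"
      using \<open>\<rho> > 0\<close> k by simp
    also have "\<dots> \<le> (\<Sum>i<k. K * dist (p (?t i)) (p (?t (Suc i))))"
      unfolding sum_distrib_left using step by (intro sum_mono) auto
    also have "\<dots> = K * (\<Sum>i<k. dist (p (?t i)) (p (?t (Suc i))))" by (simp add: sum_distrib_left)
    also have "\<dots> \<le> K * L"
    proof -
      have "ennreal (\<Sum>i<k. dist (p (?t i)) (p (?t (Suc i)))) \<le> ennreal L"
        using curve_length_ge_sum[OF k(1), of p] L(1) by (rule order_trans)
      then have "(\<Sum>i<k. dist (p (?t i)) (p (?t (Suc i)))) \<le> L"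
        using L by (simp only: ennreal_le_iff)
      then show ?thesis using \<open>K > 1\<close> by simp
    qed
    finally show ?thesis .
  qed
  have "\<rho> * arccos (v 0 \<bullet> v 1) \<le> L"
  proof (rule tendsto_le[OF _ _ tendsto_const])
    show "((\<lambda>K. K * L) \<longlongrightarrow> L) (at_right 1)"
      by (rule tendsto_eq_intros refl | simp)+
    show "\<forall>\<^sub>F K in at_right 1. \<rho> * arccos (v 0 \<bullet> v 1) \<le> K * L"
      using * by (auto simp: eventually_at_right_field intro!: exI[of _ 2])
  qed simp
  then show ?thesis by (simp add: v_def)
qed

text \<open>With \<open>z = arcsin (sqrt (n / (2 * n - 2)))\<close> one has \<open>cos (2 * z) = - 1 / (n - 1)\<close> and
  \<open>distortion_bound n = z / sin z\<close>, and \<open>y / sin y\<close> increases with \<open>y\<close> because \<open>sin\<close> is concave.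
  Compactness of the range of angles gives the uniform margin \<open>\<eta>\<close>, which later absorbs the error
  of working with almost nearest points.\<close>

lemma distortion_bound_gap:
  assumes "n \<ge> 3" and "\<delta> < distortion_bound n"
  obtains \<eta> where "\<eta> > 0"
    "\<And>\<theta>. 0 \<le> \<theta> \<Longrightarrow> \<theta> \<le> pi \<Longrightarrow> cos \<theta> \<le> - 1 / (real n - 1) + \<eta> \<Longrightarrow> \<eta> < \<theta> - 2 * \<delta> * sin (\<theta> / 2)"
proof -
  define w where "w = sqrt (real n / (2 * real n - 2))"
  define z where "z = arcsin w"
  have w: "0 < w" "w \<le> 1" "w^2 = real n / (2 * real n - 2)"
    using assms by (auto simp: w_def)
  have z: "0 < z" "z \<le> pi / 2" "sin z = w"
    using w arcsin_less_mono[of 0 w] arcsin_ubound[of w] by (simp_all add: z_def)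
  have bd: "distortion_bound n = z / w"
    unfolding distortion_bound_def z_def w_def
    by (simp add: real_sqrt_divide field_simps)
  have cz: "cos (2 * z) = - 1 / (real n - 1)"
    using assms(1) z(3) w(3) by (simp only: cos_double_sin) (simp add: field_simps)
  have pos: "\<theta> - 2 * \<delta> * sin (\<theta> / 2) > 0"
    if "0 \<le> \<theta>" "\<theta> \<le> pi" "cos \<theta> \<le> - 1 / (real n - 1)" for \<theta>
  proof -
    have "2 * z \<le> \<theta>"
      using that z cz cos_mono_le_eq[of \<theta> "2 * z"] by auto
    define y where "y = \<theta> / 2"
    have y: "z \<le> y" "y \<le> pi / 2" "y > 0" using that \<open>2 * z \<le> \<theta>\<close> z by (auto simp: y_def)
    have "concave_on {0..pi} sin"
    proof (rule f''_le0_imp_concave)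
      show "convex {0..pi}" by simp
      show "\<And>x. x \<in> {0..pi} \<Longrightarrow> (sin has_real_derivative cos x) (at x)" by (simp add: DERIV_sin)
      show "\<And>x. x \<in> {0..pi} \<Longrightarrow> (cos has_real_derivative - sin x) (at x)" by (simp add: DERIV_cos)
      show "\<And>x. x \<in> {0..pi} \<Longrightarrow> - sin x \<le> 0" by (simp add: sin_ge_zero)
    qed
    then have "(1 - z / y) * sin 0 + (z / y) * sin y \<le> sin ((1 - z / y) *\<^sub>R 0 + (z / y) *\<^sub>R y)"
      using y z by (intro concave_onD) auto
    then have "z / y * sin y \<le> w" using y z by simp
    then have le: "z / w * sin y \<le> y" using y z w by (simp add: field_simps)
    have "sin y > 0" using y pi_gt_zero by (intro sin_gt_zero) linarith+
    then have "\<delta> * sin y < z / w * sin y"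
      using assms(2) unfolding bd by (intro mult_strict_right_mono)
    then have "\<delta> * sin y < y" using le by (rule less_le_trans)
    then show ?thesis by (simp add: y_def)
  qed
  let ?Q = "\<lambda>\<theta>. max (cos \<theta> + 1 / (real n - 1)) (\<theta> - 2 * \<delta> * sin (\<theta> / 2))"
  have "continuous_on {0..pi} ?Q" by (intro continuous_intros) auto
  then obtain m where m: "m \<in> {0..pi}" "\<And>\<theta>. \<theta> \<in> {0..pi} \<Longrightarrow> ?Q m \<le> ?Q \<theta>"
    using continuous_attains_inf[of "{0..pi}" ?Q] pi_ge_zero by auto
  define q where "q = ?Q m"
  have le: "q \<le> cos \<theta> + 1 / (real n - 1) \<or> q \<le> \<theta> - 2 * \<delta> * sin (\<theta> / 2)" if "0 \<le> \<theta>" "\<theta> \<le> pi" for \<theta>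
    using m(2)[of \<theta>] that unfolding q_def by (auto simp only: le_max_iff_disj atLeastAtMost_iff)
  have "q > 0"
    using pos[of m] m(1) unfolding q_def less_max_iff_disj by (cases "cos m \<le> - 1 / (real n - 1)") auto
  show thesis
  proof (rule that[of "q / 2"])
    show "q / 2 > 0" using \<open>q > 0\<close> by simp
    fix \<theta> assume \<theta>: "0 \<le> \<theta>" "\<theta> \<le> pi" "cos \<theta> \<le> - 1 / (real n - 1) + q / 2"
    have "- 1 / (real n - 1) = - (1 / (real n - 1))" by simp
    with le[OF \<theta>(1,2)] \<theta>(3) \<open>q > 0\<close> show "q / 2 < \<theta> - 2 * \<delta> * sin (\<theta> / 2)" by linarith
  qed
qed

section \<open>Finite sets and compact sets of directions\<close>

text \<open>If all inner products were at least \<open>- \<mu>\<close>, then expanding the squared norm of the combination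
  and using that the squares of the weights sum to at least \<open>1 / n\<close> would make it too long. For
  \<open>c = 0\<close> and unit vectors this is the angle of a regular simplex with \<open>n\<close> vertices.\<close>

lemma obtuse_pair_in_small_combination:
  fixes S :: "'a::real_inner set"
  assumes "finite S" "card S \<le> n" "n \<ge> 2" "w \<in> convex hull S" "norm w < c"
    and len: "\<And>v. v \<in> S \<Longrightarrow> \<rho> \<le> norm v" and "\<rho> > 0" "real n * c\<^sup>2 \<le> \<rho>\<^sup>2"
  obtains u v where "u \<in> S" "v \<in> S" "u \<bullet> v < - (\<rho>\<^sup>2 - real n * c\<^sup>2) / (real n - 1)"
proof -
  obtain l where l: "\<And>v. v \<in> S \<Longrightarrow> 0 \<le> l v" "sum l S = 1" "(\<Sum>v\<in>S. l v *\<^sub>R v) = w"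
    using assms(4) unfolding convex_hull_finite[OF assms(1)] by blast
  define \<mu> where "\<mu> = (\<rho>\<^sup>2 - real n * c\<^sup>2) / (real n - 1)"
  have \<mu>: "\<mu> \<ge> 0" "(real n - 1) * \<mu> = \<rho>\<^sup>2 - real n * c\<^sup>2"
    using assms by (auto simp: \<mu>_def)
  have "\<exists>u\<in>S. \<exists>v\<in>S. u \<bullet> v < - \<mu>"
  proof (rule ccontr)
    assume "\<not> ?thesis"
    then have ge: "- \<mu> \<le> u \<bullet> v" if "u \<in> S" "v \<in> S" for u v using that by force
    have "(\<Sum>u\<in>S. \<Sum>v\<in>S. - \<mu> * (l u * l v) + (if u = v then (\<rho>\<^sup>2 + \<mu>) * (l u)\<^sup>2 else 0))
        \<le> (\<Sum>u\<in>S. \<Sum>v\<in>S. (l u * l v) * (u \<bullet> v))"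
    proof (intro sum_mono)
      fix u v assume uv: "u \<in> S" "v \<in> S"
      show "- \<mu> * (l u * l v) + (if u = v then (\<rho>\<^sup>2 + \<mu>) * (l u)\<^sup>2 else 0) \<le> (l u * l v) * (u \<bullet> v)"
      proof (cases "u = v")
        case True
        have "\<rho>\<^sup>2 \<le> u \<bullet> u" using len[OF uv(1)] \<open>\<rho> > 0\<close>
          by (simp add: dot_square_norm power_mono)
        then have "(l u)\<^sup>2 * \<rho>\<^sup>2 \<le> (l u)\<^sup>2 * (u \<bullet> u)" by (intro mult_left_mono) auto
        with True show ?thesis by (simp add: power2_eq_square algebra_simps)
      next
        case False
        have "(l u * l v) * (- \<mu>) \<le> (l u * l v) * (u \<bullet> v)"
          using ge[OF uv] l(1) uv by (intro mult_left_mono) auto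
        with False show ?thesis by (simp add: algebra_simps)
      qed
    qed
    also have "\<dots> = w \<bullet> w"
      unfolding l(3)[symmetric]
      by (simp only: inner_sum_left inner_scaleR_left) (simp add: inner_sum_right sum_distrib_left mult.assoc)
    also have "(\<Sum>u\<in>S. \<Sum>v\<in>S. - \<mu> * (l u * l v) + (if u = v then (\<rho>\<^sup>2 + \<mu>) * (l u)\<^sup>2 else 0)) =
       - \<mu> * (sum l S * sum l S) + (\<rho>\<^sup>2 + \<mu>) * (\<Sum>u\<in>S. (l u)\<^sup>2)"
    proof -
      have "(\<Sum>u\<in>S. \<Sum>v\<in>S. - \<mu> * (l u * l v)) = - \<mu> * (sum l S * sum l S)"
        unfolding sum_product by (simp only: sum_distrib_left)
      moreover have "(\<Sum>u\<in>S. \<Sum>v\<in>S. if u = v then (\<rho>\<^sup>2 + \<mu>) * (l u)\<^sup>2 else 0) = (\<rho>\<^sup>2 + \<mu>) * (\<Sum>u\<in>S. (l u)\<^sup>2)"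
        using assms(1) by (simp add: sum_distrib_left)
      ultimately show ?thesis by (simp only: sum.distrib)
    qed
    also have "\<dots> = - \<mu> + (\<rho>\<^sup>2 + \<mu>) * (\<Sum>u\<in>S. (l u)\<^sup>2)" using l(2) by simp
    finally have 1: "- \<mu> + (\<rho>\<^sup>2 + \<mu>) * (\<Sum>u\<in>S. (l u)\<^sup>2) \<le> (norm w)\<^sup>2"
      by (simp add: dot_square_norm)
    have "(sum l S)\<^sup>2 \<le> real (card S) * (\<Sum>u\<in>S. (l u)\<^sup>2)"
      using Cauchy_Schwarz_ineq_sum[of "\<lambda>_. 1" l S] by simp
    also have "\<dots> \<le> real n * (\<Sum>u\<in>S. (l u)\<^sup>2)"
      using assms(2) by (intro mult_right_mono sum_nonneg) auto
    finally have 2: "1 \<le> real n * (\<Sum>u\<in>S. (l u)\<^sup>2)" using l(2) by simp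
    have "(\<rho>\<^sup>2 + \<mu>) * 1 \<le> (\<rho>\<^sup>2 + \<mu>) * (real n * (\<Sum>u\<in>S. (l u)\<^sup>2))"
      using 2 \<mu>(1) by (intro mult_left_mono) auto
    then have 3: "\<rho>\<^sup>2 + \<mu> \<le> real n * ((\<rho>\<^sup>2 + \<mu>) * (\<Sum>u\<in>S. (l u)\<^sup>2))" by (simp add: algebra_simps)
    have "real n * (- \<mu> + (\<rho>\<^sup>2 + \<mu>) * (\<Sum>u\<in>S. (l u)\<^sup>2)) \<le> real n * (norm w)\<^sup>2"
      using 1 by (intro mult_left_mono) auto
    with 3 have "\<rho>\<^sup>2 - (real n - 1) * \<mu> \<le> real n * (norm w)\<^sup>2" by (simp add: algebra_simps)
    then have "real n * c\<^sup>2 \<le> real n * (norm w)\<^sup>2" using \<mu>(2) by simp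
    then have "c\<^sup>2 \<le> (norm w)\<^sup>2" using assms(3) by simp
    moreover have "(norm w)\<^sup>2 < c\<^sup>2" using assms(5) by (intro power_strict_mono) auto
    ultimately show False by simp
  qed
  then show ?thesis using that by (auto simp only: \<mu>_def minus_divide_left)
qed

text \<open>The three cases: the ball of radius \<open>c\<close> misses the convex hull, lies inside it, or meets its
  boundary. A boundary point lies in a supporting hyperplane, hence in a face of lower dimension,
  and this saves one point in Caratheodory's theorem. The dimension \<open>n\<close> instead of \<open>n + 1\<close> is what
  matches \<open>distortion_bound n\<close>.\<close>

lemma compact_positions_around_origin:
  fixes P :: "'a::euclidean_space set"
  assumes "compact P" "P \<noteq> {}" "c > 0"
  obtains (aside) v where "norm v \<le> 1" "\<And>p. p \<in> P \<Longrightarrow> v \<bullet> p \<le> - c"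
  | (around) "\<And>u. \<exists>p\<in>P. c / 2 * norm u \<le> u \<bullet> p"
  | (facet) S w where "finite S" "S \<subseteq> P" "card S \<le> DIM('a)" "w \<in> convex hull S" "norm w < c"
proof -
  let ?K = "convex hull P"
  have K: "compact ?K" "convex ?K" "closed ?K" "?K \<noteq> {}" "P \<subseteq> ?K"
    using assms by (auto simp: compact_convex_hull compact_imp_closed hull_subset)
  consider "ball 0 c \<inter> ?K = {}" | "ball 0 c \<subseteq> ?K" | "ball 0 c \<inter> frontier ?K \<noteq> {}"
    using connected_Int_frontier[of "ball 0 c" ?K] by blast
  then show thesis
  proof cases
    case 1
    define w where "w = closest_point ?K 0"
    have w: "w \<in> ?K" using K by (simp add: w_def closest_point_in_set)
    have nw: "norm w \<ge> c" using 1 w by (metis disjoint_iff mem_ball_0 not_less)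
    have "((- 1 / norm w) *\<^sub>R w) \<bullet> p \<le> - c" if "p \<in> P" for p
    proof -
      have "(0 - w) \<bullet> (p - w) \<le> 0"
        unfolding w_def using K that by (intro closest_point_dot) auto
      then have "(norm w)\<^sup>2 \<le> w \<bullet> p" by (simp add: inner_diff_right power2_norm_eq_inner)
      then have "norm w \<le> w \<bullet> p / norm w" using nw assms(3) by (subst pos_le_divide_eq) (auto simp: power2_eq_square)
      then show ?thesis using nw by simp
    qed
    then show ?thesis using nw assms(3) by (intro aside[of "(- 1 / norm w) *\<^sub>R w"]) auto
  next
    case 2
    have "\<exists>p\<in>P. c / 2 * norm u \<le> u \<bullet> p" for u
    proof (rule ccontr)
      assume neg: "\<not> ?thesis"
      then have "P \<subseteq> {p. u \<bullet> p < c / 2 * norm u}" by force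
      then have sub: "?K \<subseteq> {p. u \<bullet> p < c / 2 * norm u}"
        by (intro hull_minimal convex_halfspace_lt)
      have "u \<noteq> 0" using neg assms by auto
      then have "(c / 2 / norm u) *\<^sub>R u \<in> ball 0 c" using assms(3) by simp
      then have "u \<bullet> ((c / 2 / norm u) *\<^sub>R u) < c / 2 * norm u" using 2 sub by blast
      then show False using \<open>u \<noteq> 0\<close> by (simp add: dot_square_norm power2_eq_square)
    qed
    then show ?thesis by (rule around)
  next
    case 3
    then obtain w where w: "norm w < c" "w \<in> frontier ?K" by auto
    then have wK: "w \<in> ?K" "w \<notin> interior ?K" using K(3) by (auto simp: frontier_def)
    obtain a where a: "a \<noteq> 0" "\<And>y. y \<in> ?K \<Longrightarrow> a \<bullet> w \<le> a \<bullet> y"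
    proof (cases "w \<in> rel_interior ?K")
      case False
      then show ?thesis using supporting_hyperplane_rel_boundary[OF K(2) wK(1)] that by metis
    next
      case True
      then have "interior ?K = {}" using wK(2) interior_rel_interior_gen[of ?K] by (auto split: if_splits)
      then obtain a b where ab: "a \<noteq> 0" "?K \<subseteq> {x. a \<bullet> x = b}"
        using empty_interior_subset_hyperplane[OF K(2)] by metis
      then have "a \<bullet> w \<le> a \<bullet> y" if "y \<in> ?K" for y
        using subsetD[OF ab(2) that] subsetD[OF ab(2) wK(1)] by simp
      with \<open>a \<noteq> 0\<close> show ?thesis by (rule that)
    qed
    let ?H = "{x. a \<bullet> x = a \<bullet> w}"
    have face: "?K \<inter> ?H face_of ?K"
      using a by (intro face_of_Int_supporting_hyperplane_ge K) auto
    obtain P' where P': "P' \<subseteq> P" "?K \<inter> ?H = convex hull P'"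
      by (rule face_of_convex_hull_subset[OF assms(1) face])
    have "P' \<subseteq> ?H" using hull_subset[of P' convex] P'(2) by blast
    then have "aff_dim P' \<le> int DIM('a) - 1"
      using aff_dim_subset[of P' ?H] a(1) by (simp add: aff_dim_hyperplane)
    moreover have "w \<in> convex hull P'" using wK P'(2) by auto
    ultimately obtain S where "finite S" "S \<subseteq> P'" "int (card S) \<le> int DIM('a)" "w \<in> convex hull S"
      unfolding caratheodory_aff_dim[of P'] mem_Collect_eq by (meson le_diff_eq order_trans)
    then show ?thesis using facet[of S w] w P'(1) by auto
  qed
qed

section \<open>Nearest points of a set of small distortion\<close>

lemma local_distortion_path:
  assumes "local_distortion M r < ennreal \<delta>" "x \<in> M" "y \<in> M" "0 < dist x y" "dist x y \<le> 2 * r"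
  obtains p where "path p" "path_image p \<subseteq> M" "pathstart p = x" "pathfinish p = y"
    "curve_length p \<le> ennreal (\<delta> * dist x y)"
proof -
  have d: "\<delta> > 0" using assms(1) by (metis ennreal_neg leI not_less_zero)
  have "intrinsic_dist M x y / ennreal (dist x y) \<le> local_distortion M r"
    unfolding local_distortion_def using assms by (intro SUP_upper2[of "(x, y)"]) auto
  then have lt: "intrinsic_dist M x y / ennreal (dist x y) < ennreal \<delta>" using assms(1) by order
  have "intrinsic_dist M x y < ennreal (\<delta> * dist x y)"
  proof (rule ccontr)
    assume "\<not> ?thesis"
    then have "ennreal (\<delta> * dist x y) \<le> intrinsic_dist M x y" by simp
    then have "ennreal (\<delta> * dist x y) / ennreal (dist x y) \<le> intrinsic_dist M x y / ennreal (dist x y)"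
      by (rule divide_right_mono_ennreal)
    moreover have "ennreal (\<delta> * dist x y) / ennreal (dist x y) = ennreal \<delta>"
      using assms(4) d by (simp add: divide_ennreal)
    ultimately show False using lt by simp
  qed
  then show thesis using that unfolding intrinsic_dist_def INF_less_iff
    by (auto intro: less_imp_le)
qed

text \<open>Nearest points up to an error \<open>\<epsilon>\<close>. The error makes the notions below stable under small
  displacements of \<open>x\<close>.\<close>

definition near_points :: "'a::metric_space set \<Rightarrow> real \<Rightarrow> 'a \<Rightarrow> 'a set" where
  "near_points M \<epsilon> x = {p \<in> M. dist x p \<le> infdist x M + \<epsilon>}"

text \<open>The quantitative form of being a regular point of the distance function: moving in the
  direction \<open>v\<close> increases the distance to all almost nearest points at a definite rate.\<close>

definition steep :: "'a::real_inner set \<Rightarrow> real \<Rightarrow> real \<Rightarrow> 'a \<Rightarrow> bool" where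
  "steep M c \<epsilon> x \<longleftrightarrow> (\<exists>v. norm v \<le> 1 \<and> (\<forall>p\<in>near_points M \<epsilon> x. v \<bullet> (p - x) \<le> - c))"

text \<open>The convex hull of the almost nearest points contains the ball of radius \<open>c\<close> around \<open>x\<close>,
  expressed by its support function.\<close>

definition surrounded :: "'a::real_inner set \<Rightarrow> real \<Rightarrow> real \<Rightarrow> 'a \<Rightarrow> bool" where
  "surrounded M c \<epsilon> x \<longleftrightarrow> (\<forall>u. \<exists>p\<in>near_points M \<epsilon> x. c * norm u \<le> u \<bullet> (p - x))"

text \<open>A curve joining \<open>p\<close> and \<open>q\<close> in \<open>M\<close> whose length is at most \<open>\<delta>\<close> times their distance stays
  outside the ball of radius \<open>\<rho>\<close> about \<open>x\<close>. If the angle \<open>\<theta>\<close> between them is large, its length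
  \<open>\<rho> * \<theta>\<close> exceeds \<open>\<delta>\<close> times the distance \<open>2 * \<rho> * sin (\<theta> / 2)\<close> by the margin \<open>\<eta> * \<rho>\<close>, which
  outweighs the error \<open>2 * \<delta> * \<epsilon>\<close> caused by the inexact radii.\<close>

lemma no_obtuse_near_points:
  fixes M :: "'a::euclidean_space set"
  assumes M: "local_distortion M r < ennreal \<delta>" and \<delta>: "\<delta> \<ge> 0"
    and gap: "\<And>\<theta>. 0 \<le> \<theta> \<Longrightarrow> \<theta> \<le> pi \<Longrightarrow> cos \<theta> \<le> - \<kappa> \<Longrightarrow> \<eta> < \<theta> - 2 * \<delta> * sin (\<theta> / 2)"
    and \<rho>: "\<rho> > 0" "\<rho> = infdist x M" and \<epsilon>: "\<epsilon> \<ge> 0" "\<rho> + \<epsilon> \<le> r" "2 * \<delta> * \<epsilon> \<le> \<eta> * \<rho>"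
    and pq: "p \<in> near_points M \<epsilon> x" "q \<in> near_points M \<epsilon> x"
    and "\<kappa> \<ge> 0"
  shows "- \<kappa> * (\<rho> + \<epsilon>)\<^sup>2 \<le> (p - x) \<bullet> (q - x)"
proof (rule ccontr)
  assume neg: "\<not> ?thesis"
  define a b where "a = p - x" and "b = q - x"
  have ab: "\<rho> \<le> norm a" "norm a \<le> \<rho> + \<epsilon>" "\<rho> \<le> norm b" "norm b \<le> \<rho> + \<epsilon>"
    using pq infdist_le[of p M x] infdist_le[of q M x] \<rho>
    by (auto simp: near_points_def a_def b_def dist_norm norm_minus_commute)
  have neg: "a \<bullet> b < - \<kappa> * (\<rho> + \<epsilon>)\<^sup>2" using neg by (simp add: a_def b_def)
  define u v where "u = a /\<^sub>R norm a" and "v = b /\<^sub>R norm b"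
  have pos: "norm a > 0" "norm b > 0" using ab \<rho> by linarith+
  have uv: "norm u = 1" "norm v = 1" using pos by (auto simp: u_def v_def)
  have au: "a = norm a *\<^sub>R u" "b = norm b *\<^sub>R v" using pos by (auto simp: u_def v_def)
  define \<theta> where "\<theta> = arccos (u \<bullet> v)"
  have "\<bar>u \<bullet> v\<bar> \<le> 1" using Cauchy_Schwarz_ineq2[of u v] uv by auto
  then have \<theta>: "0 \<le> \<theta>" "\<theta> \<le> pi" "cos \<theta> = u \<bullet> v"
    by (auto simp: \<theta>_def cos_arccos_abs arccos_lbound arccos_ubound abs_le_iff)
  have "u \<bullet> v \<le> - \<kappa>"
  proof -
    have "norm a * norm b \<le> (\<rho> + \<epsilon>)\<^sup>2"
      unfolding power2_eq_square using ab pos \<rho>(1) \<epsilon>(1) by (intro mult_mono) auto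
    then have "\<kappa> * (norm a * norm b) \<le> \<kappa> * (\<rho> + \<epsilon>)\<^sup>2" using \<open>\<kappa> \<ge> 0\<close> by (rule mult_left_mono)
    then have "a \<bullet> b \<le> - \<kappa> * (norm a * norm b)" using neg by simp
    moreover have "a \<bullet> b = (u \<bullet> v) * (norm a * norm b)" using au
      by (metis inner_scaleR_left inner_scaleR_right mult.assoc mult.commute)
    ultimately have "(u \<bullet> v) * (norm a * norm b) \<le> - \<kappa> * (norm a * norm b)" by simp
    then show ?thesis using pos by (rule mult_right_le_imp_le[OF _ mult_pos_pos])
  qed
  then have g: "\<eta> < \<theta> - 2 * \<delta> * sin (\<theta> / 2)" using gap \<theta> by simp
  have chord: "norm (a - b) \<le> 2 * \<rho> * sin (\<theta> / 2) + 2 * \<epsilon>"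
  proof -
    have "a - b = \<rho> *\<^sub>R (u - v) + ((norm a - \<rho>) *\<^sub>R u - (norm b - \<rho>) *\<^sub>R v)"
      using au by (simp add: algebra_simps)
    then have "norm (a - b) \<le> norm (\<rho> *\<^sub>R (u - v)) + (norm ((norm a - \<rho>) *\<^sub>R u) + norm ((norm b - \<rho>) *\<^sub>R v))"
      by (simp only:) (intro norm_triangle_le add_left_mono norm_triangle_ineq4)
    also have "\<dots> \<le> \<rho> * norm (u - v) + (\<epsilon> + \<epsilon>)"
      using uv ab \<rho> by simp
    finally show ?thesis using norm_diff_unit_vectors[OF uv] by (simp add: \<theta>_def)
  qed
  have "dist p q = norm (a - b)" by (simp add: a_def b_def dist_norm)
  have "p \<noteq> q"
  proof
    assume "p = q"
    then have "a \<bullet> b \<ge> 0" by (simp add: a_def b_def)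
    moreover have "\<kappa> * (\<rho> + \<epsilon>)\<^sup>2 \<ge> 0" using \<open>\<kappa> \<ge> 0\<close> by simp
    ultimately show False using neg by linarith
  qed
  moreover have "norm (a - b) \<le> 2 * r" using norm_triangle_ineq4[of a b] ab \<epsilon> by linarith
  ultimately have "0 < dist p q" "dist p q \<le> 2 * r" using \<open>dist p q = norm (a - b)\<close> by auto
  moreover have "p \<in> M" "q \<in> M" using pq by (auto simp: near_points_def)
  ultimately obtain \<gamma> where \<gamma>: "path \<gamma>" "path_image \<gamma> \<subseteq> M" "pathstart \<gamma> = p" "pathfinish \<gamma> = q"
    "curve_length \<gamma> \<le> ennreal (\<delta> * norm (a - b))"
    using local_distortion_path[OF M, of p q] unfolding \<open>dist p q = norm (a - b)\<close> by blast
  have "\<rho> * arccos (((\<gamma> 0 - x) /\<^sub>R norm (\<gamma> 0 - x)) \<bullet> ((\<gamma> 1 - x) /\<^sub>R norm (\<gamma> 1 - x))) \<le> \<delta> * norm (a - b)"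
  proof (rule curve_length_outside_ball[OF \<gamma>(1) \<rho>(1) _ \<gamma>(5)])
    show "\<rho> \<le> norm (y - x)" if "y \<in> path_image \<gamma>" for y
      using infdist_le[of y M x] that \<gamma>(2) \<rho>(2) by (auto simp: dist_norm norm_minus_commute)
  qed (use \<delta> in simp)
  then have "\<rho> * \<theta> \<le> \<delta> * norm (a - b)"
    using \<gamma>(3,4) by (simp add: pathstart_def pathfinish_def \<theta>_def u_def v_def a_def b_def)
  also have "\<dots> \<le> \<delta> * (2 * \<rho> * sin (\<theta> / 2) + 2 * \<epsilon>)" using chord \<delta> by (rule mult_left_mono)
  finally have "\<rho> * (\<theta> - 2 * \<delta> * sin (\<theta> / 2)) \<le> \<eta> * \<rho>" using \<epsilon>(3) by (simp add: algebra_simps)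
  then show False using g \<rho>(1) by (simp add: mult.commute)
qed

lemma compact_near_points:
  fixes M :: "'a::euclidean_space set"
  assumes "closed M"
  shows "compact (near_points M \<epsilon> x)"
proof -
  have "near_points M \<epsilon> x = M \<inter> cball x (infdist x M + \<epsilon>)" by (auto simp: near_points_def)
  then show ?thesis using assms by (simp add: closed_Int_compact)
qed

lemma near_points_nonempty:
  fixes M :: "'a::euclidean_space set"
  assumes "closed M" "M \<noteq> {}" "\<epsilon> \<ge> 0"
  shows "near_points M \<epsilon> x \<noteq> {}"
proof -
  obtain p where "p \<in> M" "infdist x M = dist x p"
    using infdist_attains_inf[OF assms(1,2)] by metis
  then show ?thesis using assms(3) by (auto simp: near_points_def)
qed

text \<open>The third case of \<open>compact_positions_around_origin\<close> yields two almost nearest points seen under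
  an obtuse angle, which the distortion bound forbids. The constant \<open>c\<close> does not depend on \<open>\<epsilon>\<close>, so
  \<open>\<epsilon>\<close> can later be chosen small compared with \<open>c\<close>.\<close>

lemma steep_or_surrounded:
  fixes M :: "'a::euclidean_space set"
  assumes n: "DIM('a) \<ge> 3" and M: "closed M" "M \<noteq> {}"
    and dist: "local_distortion M r < ennreal (distortion_bound DIM('a))"
    and st: "0 < s" "t < r"
  obtains c \<epsilon>\<^sub>0 where "c > 0" "\<epsilon>\<^sub>0 > 0"
    "\<And>\<epsilon> x. 0 < \<epsilon> \<Longrightarrow> \<epsilon> \<le> \<epsilon>\<^sub>0 \<Longrightarrow> s \<le> infdist x M \<Longrightarrow> infdist x M \<le> t \<Longrightarrow>
        steep M c \<epsilon> x \<or> surrounded M c \<epsilon> x"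
proof -
  define n where "n = DIM('a)"
  have n3: "n \<ge> 3" using n by (simp add: n_def)
  obtain \<delta> where \<delta>: "local_distortion M r < ennreal \<delta>" "\<delta> < distortion_bound n" "\<delta> \<ge> 0"
  proof -
    obtain z where z: "local_distortion M r < z" "z < ennreal (distortion_bound n)"
      using dense[OF dist] by (auto simp: n_def)
    then obtain \<delta> where "z = ennreal \<delta>" "\<delta> \<ge> 0" by (metis ennreal_cases order_less_imp_not_less top.extremum_strict not_less top_greatest)
    then show ?thesis using z that[of \<delta>] by (metis ennreal_less_iff)
  qed
  obtain \<eta> where \<eta>: "\<eta> > 0"
    "\<And>\<theta>. 0 \<le> \<theta> \<Longrightarrow> \<theta> \<le> pi \<Longrightarrow> cos \<theta> \<le> - 1 / (real n - 1) + \<eta> \<Longrightarrow> \<eta> < \<theta> - 2 * \<delta> * sin (\<theta> / 2)"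
    using distortion_bound_gap[OF n3 \<delta>(2)] by blast
  define \<eta>' where "\<eta>' = min \<eta> (1 / (real n - 1))"
  have \<eta>': "\<eta>' > 0" "\<eta>' \<le> \<eta>" "\<eta>' \<le> 1 / (real n - 1)" using \<eta> n3 by (auto simp: \<eta>'_def)
  define \<kappa> where "\<kappa> = 1 / (real n - 1) - \<eta>'"
  have \<kappa>: "\<kappa> \<ge> 0" using \<eta>' by (simp add: \<kappa>_def)
  have gap: "\<eta>' < \<theta> - 2 * \<delta> * sin (\<theta> / 2)" if "0 \<le> \<theta>" "\<theta> \<le> pi" "cos \<theta> \<le> - \<kappa>" for \<theta>
    using \<eta>(2)[of \<theta>] that \<eta>' by (simp add: \<kappa>_def)
  \<comment> \<open>small enough that \<open>real n * c'\<^sup>2\<close> is at most the fraction \<open>\<eta>' / 2\<close> of \<open>s\<^sup>2\<close>\<close>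
  define c' where "c' = s * sqrt (min 1 \<eta>' / (2 * real n))"
  have c': "c' > 0" "real n * c'\<^sup>2 = s\<^sup>2 * min 1 \<eta>' / 2"
    using st \<eta>' n3 by (auto simp: c'_def power_mult_distrib)
  define \<epsilon>\<^sub>0 where "\<epsilon>\<^sub>0 = min (r - t) (min (\<eta>' * s / (2 * \<delta> + 1)) (s * \<eta>' / 4))"
  have \<epsilon>\<^sub>0: "\<epsilon>\<^sub>0 > 0" using st \<eta>' \<delta> by (auto simp: \<epsilon>\<^sub>0_def)
  show thesis
  proof (rule that[of "c' / 2" \<epsilon>\<^sub>0])
    show "c' / 2 > 0" "\<epsilon>\<^sub>0 > 0" using c' \<epsilon>\<^sub>0 by auto
    fix \<epsilon> x assume \<epsilon>: "0 < \<epsilon>" "\<epsilon> \<le> \<epsilon>\<^sub>0" and x: "s \<le> infdist x M" "infdist x M \<le> t"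
    define \<rho> where "\<rho> = infdist x M"
    have \<rho>: "\<rho> > 0" "s \<le> \<rho>" using x st by (auto simp: \<rho>_def)
    have e: "\<rho> + \<epsilon> \<le> r" "4 * \<epsilon> \<le> s * \<eta>'" using \<epsilon> x by (auto simp: \<epsilon>\<^sub>0_def \<rho>_def)
    have e2: "2 * \<delta> * \<epsilon> \<le> \<eta>' * \<rho>"
    proof -
      have "\<epsilon> \<le> \<eta>' * s / (2 * \<delta> + 1)" using \<epsilon> by (simp add: \<epsilon>\<^sub>0_def)
      then have "(2 * \<delta> + 1) * \<epsilon> \<le> \<eta>' * s" using \<delta>(3) by (simp add: field_simps)
      also have "\<dots> \<le> \<eta>' * \<rho>" using \<eta>' \<rho> by simp
      finally show ?thesis using \<epsilon>(1) by (simp add: algebra_simps)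
    qed
    let ?P = "(\<lambda>p. p - x) ` near_points M \<epsilon> x"
    have "compact ?P" using compact_near_points[OF M(1)] by (intro compact_continuous_image continuous_intros)
    moreover have "?P \<noteq> {}" using near_points_nonempty[OF M] \<epsilon> by simp
    moreover note c'(1)
    ultimately show "steep M (c' / 2) \<epsilon> x \<or> surrounded M (c' / 2) \<epsilon> x"
    proof (cases rule: compact_positions_around_origin)
      case (aside v)
      then have "steep M (c' / 2) \<epsilon> x" using c' unfolding steep_def by (intro exI[of _ v]) force
      then show ?thesis ..
    next
      case around
      then have "surrounded M (c' / 2) \<epsilon> x" unfolding surrounded_def by simp
      then show ?thesis ..
    next
      case (facet S w)
      have len: "\<rho> \<le> norm v" if "v \<in> S" for v
        using facet(2) that infdist_le[of _ M x] by (force simp: near_points_def \<rho>_def dist_norm norm_minus_commute)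
      have "s\<^sup>2 \<le> \<rho>\<^sup>2" using st \<rho> by simp
      moreover have "s\<^sup>2 * min 1 \<eta>' \<le> s\<^sup>2 * 1" by (intro mult_left_mono) auto
      ultimately have nc: "real n * c'\<^sup>2 \<le> \<rho>\<^sup>2" using c'(2) zero_le_power2[of \<rho>] by linarith
      obtain u v where uv: "u \<in> S" "v \<in> S" "u \<bullet> v < - (\<rho>\<^sup>2 - real n * c'\<^sup>2) / (real n - 1)"
        using obtuse_pair_in_small_combination[OF facet(1) _ _ facet(4,5) len \<rho>(1) nc] facet(3) n3
        unfolding n_def by auto
      have lo: "- \<kappa> * (\<rho> + \<epsilon>)\<^sup>2 \<le> u \<bullet> v"
      proof -
        obtain p q where "u = p - x" "v = q - x" "p \<in> near_points M \<epsilon> x" "q \<in> near_points M \<epsilon> x"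
          using uv(1,2) facet(2) by blast
        then show ?thesis
          using no_obtuse_near_points[OF \<delta>(1,3) gap \<rho>(1) \<rho>_def _ e(1) e2 _ _ \<kappa>, of p q] \<epsilon>(1) by simp
      qed
      \<comment> \<open>\<open>uv\<close> and \<open>lo\<close> squeeze \<open>u \<bullet> v\<close>; with \<open>real n * c'\<^sup>2 \<le> \<rho>\<^sup>2 * \<eta>' / 2\<close> and \<open>4 * \<epsilon> \<le> \<rho> * \<eta>'\<close>
        the two bounds cross.\<close>
      have "(\<rho>\<^sup>2 - real n * c'\<^sup>2) / (real n - 1) < \<kappa> * (\<rho> + \<epsilon>)\<^sup>2" 
        using uv(3) lo minus_divide_left[of "\<rho>\<^sup>2 - real n * c'\<^sup>2" "real n - 1"] by linarith
      then have "\<rho>\<^sup>2 - real n * c'\<^sup>2 < (real n - 1) * \<kappa> * (\<rho> + \<epsilon>)\<^sup>2" using n3 by (simp add: field_simps)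
      moreover have "(real n - 1) * \<kappa> = 1 - (real n - 1) * \<eta>'" using n3 by (simp add: \<kappa>_def right_diff_distrib)
      moreover have "(real n - 1) * \<eta>' \<ge> 1 * \<eta>'" using n3 \<eta>' by (intro mult_right_mono) auto
      moreover have "(1 - (real n - 1) * \<eta>') * (\<rho> + \<epsilon>)\<^sup>2 \<le> (1 - \<eta>') * (\<rho> + \<epsilon>)\<^sup>2"
        using calculation by (intro mult_right_mono) auto
      ultimately have 1: "\<rho>\<^sup>2 - real n * c'\<^sup>2 < (1 - \<eta>') * (\<rho> + \<epsilon>)\<^sup>2" by simp
      have "s\<^sup>2 * min 1 \<eta>' \<le> \<rho>\<^sup>2 * \<eta>'" using \<open>s\<^sup>2 \<le> \<rho>\<^sup>2\<close> \<eta>' by (intro mult_mono) auto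
      then have 2: "real n * c'\<^sup>2 \<le> \<rho>\<^sup>2 * \<eta>' / 2" using c'(2) by simp
      have "1 / (real n - 1) \<le> 1" using n3 by simp
      then have "\<eta>' \<le> 1" using \<eta>'(3) by linarith
      have "s * \<eta>' \<le> \<rho> * \<eta>'" using \<rho>(2) \<eta>'(1) by (intro mult_right_mono) auto
      then have "4 * \<epsilon> \<le> \<rho> * \<eta>'" using e(2) by linarith
      then have 3: "(1 - \<eta>') * (\<rho> + \<epsilon>)\<^sup>2 \<le> (1 - \<eta>') * (\<rho> + \<rho> * \<eta>' / 4)\<^sup>2"
        using \<open>\<eta>' \<le> 1\<close> \<rho>(1) \<epsilon>(1) by (intro mult_left_mono power_mono) auto
      have 4: "(1 - \<eta>') * (\<rho> + \<rho> * \<eta>' / 4)\<^sup>2 = \<rho>\<^sup>2 * ((1 - \<eta>') * (1 + \<eta>' / 4)\<^sup>2)"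
        by (simp add: power2_eq_square algebra_simps)
      have "(1 - \<eta>') * (1 + \<eta>' / 4)\<^sup>2 \<le> 1 - \<eta>' / 2"
      proof -
        have "(1 - \<eta>') * (1 + \<eta>' / 4)\<^sup>2 = 1 - \<eta>' / 2 - 7 / 16 * \<eta>'\<^sup>2 - \<eta>'^3 / 16"
          by (simp add: power2_eq_square power3_eq_cube field_simps)
        moreover have "0 \<le> \<eta>'^3" using \<eta>'(1) by simp
        ultimately show ?thesis using zero_le_power2[of \<eta>'] by linarith
      qed
      then have "\<rho>\<^sup>2 * ((1 - \<eta>') * (1 + \<eta>' / 4)\<^sup>2) \<le> \<rho>\<^sup>2 * (1 - \<eta>' / 2)" by (intro mult_left_mono) auto
      with 1 2 3 4 have "\<rho>\<^sup>2 < \<rho>\<^sup>2" by (simp add: algebra_simps)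
      then show ?thesis by simp
    qed
  qed
qed

text \<open>A displacement of length \<open>l\<close> approaches some almost nearest point at rate \<open>c\<close>; so a point at
  height at least \<open>infdist z M - \<zeta>\<close> cannot be far from \<open>z\<close>.\<close>

lemma surrounded_imp_peak:
  fixes M :: "'a::euclidean_space set"
  assumes "surrounded M c \<epsilon> z" "c > 0" "infdist z M \<le> t" "\<epsilon> \<ge> 0" "\<zeta> \<ge> 0"
    and y: "dist y z \<le> c" "infdist z M - \<zeta> \<le> infdist y M"
  shows "c * dist y z \<le> 2 * t * (\<epsilon> + \<zeta>) + \<epsilon>\<^sup>2"
proof -
  obtain p where p: "p \<in> near_points M \<epsilon> z" "c * norm (y - z) \<le> (y - z) \<bullet> (p - z)"
    using assms(1) unfolding surrounded_def by blast
  define \<rho> l where "\<rho> = infdist z M" and "l = norm (y - z)"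
  have "\<rho> \<ge> 0" "\<rho> \<le> t" using assms by (auto simp: \<rho>_def infdist_nonneg)
  have "infdist y M \<le> norm (y - p)"
    using p infdist_le[of p M y] by (auto simp: near_points_def dist_norm)
  then have "(infdist y M)\<^sup>2 \<le> (norm (y - p))\<^sup>2" by (intro power_mono infdist_nonneg)
  also have "\<dots> = (norm (p - z))\<^sup>2 - 2 * ((y - z) \<bullet> (p - z)) + l\<^sup>2"
    unfolding l_def power2_norm_eq_inner by (simp add: inner_diff_left inner_diff_right inner_commute algebra_simps)
  also have "\<dots> \<le> (\<rho> + \<epsilon>)\<^sup>2 - 2 * (c * l) + c * l"
  proof -
    have "(norm (p - z))\<^sup>2 \<le> (\<rho> + \<epsilon>)\<^sup>2"
      using p(1) by (intro power_mono) (auto simp: near_points_def \<rho>_def dist_norm norm_minus_commute)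
    moreover have "l\<^sup>2 \<le> c * l" using y(1) by (simp add: power2_eq_square l_def dist_norm mult_right_mono)
    ultimately show ?thesis using p(2) by (simp add: l_def)
  qed
  finally have 1: "c * l \<le> (\<rho> + \<epsilon>)\<^sup>2 - (infdist y M)\<^sup>2" by simp
  have 2: "\<rho>\<^sup>2 - 2 * \<rho> * \<zeta> \<le> (infdist y M)\<^sup>2"
  proof (cases "\<zeta> \<le> \<rho>")
    case True
    then have "(\<rho> - \<zeta>)\<^sup>2 \<le> (infdist y M)\<^sup>2" using y(2) by (intro power_mono) (auto simp: \<rho>_def)
    moreover have "(\<rho> - \<zeta>)\<^sup>2 = \<rho>\<^sup>2 - 2 * \<rho> * \<zeta> + \<zeta>\<^sup>2" by (simp add: power2_diff)
    ultimately show ?thesis using zero_le_power2[of \<zeta>] by linarith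
  next
    case False
    then have "\<rho> * \<rho> \<le> \<rho> * \<zeta>" "0 \<le> \<rho> * \<zeta>" using \<open>\<rho> \<ge> 0\<close> \<open>\<zeta> \<ge> 0\<close> by (auto intro: mult_left_mono)
    then have "\<rho>\<^sup>2 - 2 * \<rho> * \<zeta> \<le> 0" by (simp add: power2_eq_square)
    then show ?thesis using zero_le_power2[of "infdist y M"] by linarith
  qed
  have "c * l \<le> 2 * \<rho> * (\<epsilon> + \<zeta>) + \<epsilon>\<^sup>2" using 1 2 by (simp add: power2_eq_square algebra_simps)
  also have "\<dots> \<le> 2 * t * (\<epsilon> + \<zeta>) + \<epsilon>\<^sup>2"
    using \<open>\<rho> \<le> t\<close> assms(4,5) by (intro add_right_mono mult_right_mono) auto
  finally show ?thesis by (simp add: l_def dist_norm)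
qed

text \<open>Within distance \<open>A\<close> of \<open>z\<close>, only points within distance \<open>\<sigma>\<close> reach the height of \<open>z\<close> up to
  \<open>\<epsilon>\<close>. For \<open>\<sigma> < A\<close> this is a moat that nothing moving uphill in small steps can cross.\<close>

definition peak :: "'a::metric_space set \<Rightarrow> real \<Rightarrow> real \<Rightarrow> real \<Rightarrow> 'a \<Rightarrow> bool" where
  "peak M A \<epsilon> \<sigma> z \<longleftrightarrow> (\<forall>y. dist y z \<le> A \<and> infdist z M - \<epsilon> \<le> infdist y M \<longrightarrow> dist y z \<le> \<sigma>)"

lemma steep_or_peak:
  fixes M :: "'a::euclidean_space set"
  assumes n: "DIM('a) \<ge> 3" and M: "closed M" "M \<noteq> {}"
    and dist: "local_distortion M r < ennreal (distortion_bound DIM('a))"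
    and st: "0 < s" "t < r"
  obtains A where "A > 0"
    "\<And>\<sigma>. \<sigma> > 0 \<Longrightarrow> \<exists>\<epsilon>>0. \<forall>x. s \<le> infdist x M \<and> infdist x M \<le> t \<longrightarrow> steep M A \<epsilon> x \<or> peak M A \<epsilon> \<sigma> x"
proof -
  obtain c \<epsilon>\<^sub>0 where c: "c > 0" "\<epsilon>\<^sub>0 > 0"
    "\<And>\<epsilon> x. 0 < \<epsilon> \<Longrightarrow> \<epsilon> \<le> \<epsilon>\<^sub>0 \<Longrightarrow> s \<le> infdist x M \<Longrightarrow> infdist x M \<le> t \<Longrightarrow>
        steep M c \<epsilon> x \<or> surrounded M c \<epsilon> x"
    using steep_or_surrounded[OF n M dist st] by blast
  show thesis
  proof (rule that[OF c(1)])
    fix \<sigma> :: real assume "\<sigma> > 0"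
    define t' where "t' = max t 0"
    define \<epsilon> where "\<epsilon> = min (min 1 \<epsilon>\<^sub>0) (c * \<sigma> / (4 * t' + 1))"
    have t': "t' \<ge> 0" "t \<le> t'" by (auto simp: t'_def)
    have \<epsilon>: "\<epsilon> > 0" using c t' \<open>\<sigma> > 0\<close> unfolding \<epsilon>_def by (simp add: add_nonneg_pos)
    have \<epsilon>': "\<epsilon> \<le> 1" "\<epsilon> \<le> \<epsilon>\<^sub>0" "\<epsilon> \<le> c * \<sigma> / (4 * t' + 1)" unfolding \<epsilon>_def by linarith+
    have small: "2 * t' * (\<epsilon> + \<epsilon>) + \<epsilon>\<^sup>2 \<le> c * \<sigma>"
    proof -
      have "\<epsilon>\<^sup>2 \<le> \<epsilon>" using \<epsilon> \<epsilon>' by (simp add: power2_eq_square mult_left_le)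
      then have "2 * t' * (\<epsilon> + \<epsilon>) + \<epsilon>\<^sup>2 \<le> \<epsilon> * (4 * t' + 1)" by (simp add: algebra_simps)
      also have "\<dots> \<le> c * \<sigma>" using \<epsilon>'(3) t' by (simp add: pos_le_divide_eq add_nonneg_pos)
      finally show ?thesis .
    qed
    have "peak M c \<epsilon> \<sigma> x" if "surrounded M c \<epsilon> x" "infdist x M \<le> t" for x
      unfolding peak_def
    proof (intro allI impI)
      fix y assume y: "dist y x \<le> c \<and> infdist x M - \<epsilon> \<le> infdist y M"
      have "c * dist y x \<le> 2 * t' * (\<epsilon> + \<epsilon>) + \<epsilon>\<^sup>2"
        using that y t' \<epsilon> by (intro surrounded_imp_peak[OF _ c(1)]) auto
      then have "c * dist y x \<le> c * \<sigma>" using small by linarith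
      then show "dist y x \<le> \<sigma>" using c(1) by simp
    qed
    then show "\<exists>\<epsilon>>0. \<forall>x. s \<le> infdist x M \<and> infdist x M \<le> t \<longrightarrow> steep M c \<epsilon> x \<or> peak M c \<epsilon> \<sigma> x"
      using c(3)[OF \<epsilon> \<epsilon>'(2)] \<epsilon> by blast
  qed
qed

section \<open>Deformations along a direction field\<close>

text \<open>A partition of unity subordinate to balls of radius \<open>\<eta>\<close> averages \<open>g\<close>, which need not be
  continuous, over nearby points.\<close>

lemma continuous_local_convex_selection:
  fixes g :: "'a::euclidean_space \<Rightarrow> 'b::euclidean_space"
  assumes "\<eta> > 0"
  obtains V where "continuous_on UNIV V" "\<And>y. V y \<in> convex hull (g ` ball y \<eta>)"
proof -
  have cov: "(UNIV :: 'a set) \<subseteq> \<Union>(range (\<lambda>x. ball x \<eta>))"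
  proof
    fix y :: 'a
    have "y \<in> ball y \<eta>" using assms by simp
    then show "y \<in> \<Union>(range (\<lambda>x. ball x \<eta>))" by blast
  qed
  obtain C :: "'a set set" where C: "UNIV \<subseteq> \<Union>C"
      "\<And>U. U \<in> C \<Longrightarrow> open U \<and> (\<exists>T. T \<in> range (\<lambda>x. ball x \<eta>) \<and> U \<subseteq> T)"
      "\<And>x. x \<in> UNIV \<Longrightarrow> \<exists>V. open V \<and> x \<in> V \<and> finite {U. U \<in> C \<and> U \<inter> V \<noteq> {}}"
    by (rule paracompact[OF cov]) (auto simp: image_iff)
  have "\<forall>U\<in>C. \<exists>x. U \<subseteq> ball x \<eta>" using C(2) by blast
  then obtain a where a: "\<And>U. U \<in> C \<Longrightarrow> U \<subseteq> ball (a U) \<eta>" by metis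
  obtain H :: "['a set, 'a] \<Rightarrow> real"
    where H: "\<And>U. U \<in> C \<Longrightarrow> continuous_on UNIV (H U) \<and> (\<forall>x \<in> UNIV. 0 \<le> H U x)"
      and H0: "\<And>x U. \<lbrakk>U \<in> C; x \<in> UNIV; x \<notin> U\<rbrakk> \<Longrightarrow> H U x = 0"
      and H1: "\<And>x. x \<in> UNIV \<Longrightarrow> supp_sum (\<lambda>W. H W x) C = 1"
      and Hf: "\<And>x. x \<in> UNIV \<Longrightarrow> \<exists>V. open V \<and> x \<in> V \<and> finite {U \<in> C. \<exists>x\<in>V. H U x \<noteq> 0}"
    by (rule subordinate_partition_of_unity[OF C(1)]) (use C(2,3) in auto)
  define V where "V y = (\<Sum>U | U \<in> C \<and> H U y \<noteq> 0. H U y *\<^sub>R g (a U))" for y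
  have "continuous (at y) V" for y
  proof -
    obtain W where W: "open W" "y \<in> W" "finite {U \<in> C. \<exists>x\<in>W. H U x \<noteq> 0}" using Hf by auto
    let ?J = "{U \<in> C. \<exists>x\<in>W. H U x \<noteq> 0}"
    have "continuous_on W (\<lambda>x. \<Sum>U\<in>?J. H U x *\<^sub>R g (a U))"
      using H by (intro continuous_intros) (auto intro: continuous_on_subset)
    moreover have "(\<Sum>U\<in>?J. H U x *\<^sub>R g (a U)) = V x" if "x \<in> W" for x
      unfolding V_def using that W(3) by (intro sum.mono_neutral_right) auto
    ultimately have "continuous_on W V" using continuous_on_eq by blast
    then show ?thesis using W by (simp add: continuous_on_eq_continuous_at)
  qed
  then have "continuous_on UNIV V" by (simp add: continuous_on_eq_continuous_at)
  moreover have "V y \<in> convex hull (g ` ball y \<eta>)" for y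
  proof -
    let ?I = "{U \<in> C. H U y \<noteq> 0}"
    obtain W where "y \<in> W" "finite {U \<in> C. \<exists>x\<in>W. H U x \<noteq> 0}" using Hf by auto
    then have fin: "finite ?I" by (rule_tac finite_subset) auto
    have "(\<Sum>U\<in>?I. H U y) = 1"
      using H1[of y] by (simp add: supp_sum_def support_on_def)
    moreover have "g (a U) \<in> convex hull (g ` ball y \<eta>)" if "U \<in> ?I" for U
    proof -
      have "y \<in> U" using H0[of U y] that by auto
      then have "a U \<in> ball y \<eta>" using a[of U] that by (auto simp: dist_commute)
      then show ?thesis by (intro hull_inc) auto
    qed
    ultimately show ?thesis
      unfolding V_def using H fin by (intro convex_sum) auto
  qed
  ultimately show ?thesis by (rule that)
qed

lemma near_points_mono_ball:
  assumes "p \<in> near_points M \<epsilon> y" "dist x y \<le> \<eta>"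
  shows "p \<in> near_points M (\<epsilon> + 2 * \<eta>) x"
proof -
  have "dist x p \<le> dist x y + dist y p" by (rule dist_triangle)
  moreover have "infdist y M \<le> infdist x M + dist y x" by (rule infdist_triangle)
  ultimately show ?thesis using assms by (auto simp: near_points_def dist_commute)
qed

text \<open>The condition \<open>v \<bullet> (p - y) \<le> - (c / 2) * norm v\<close> defines a convex cone, so it survives averaging
  with zero vectors. It makes the field useful also at the rim of the region \<open>Q\<close>, where it fades
  out.\<close>

lemma steep_direction_field:
  fixes M :: "'a::euclidean_space set"
  assumes "c > 0" "\<eta> > 0" "\<eta> \<le> \<epsilon> / 4" "\<eta> \<le> c / 2"
  obtains V where "continuous_on UNIV V" "\<And>y. norm (V y) \<le> 1"
    "\<And>y p. p \<in> near_points M (\<epsilon> / 2) y \<Longrightarrow> V y \<bullet> (p - y) \<le> - (c / 2) * norm (V y)"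
    "\<And>y p. (\<forall>x. dist x y < \<eta> \<longrightarrow> x \<in> Q \<and> steep M c \<epsilon> x) \<Longrightarrow> p \<in> near_points M (\<epsilon> / 2) y
       \<Longrightarrow> V y \<bullet> (p - y) \<le> - (c / 2)"
    "\<And>y. (\<forall>x. dist x y < \<eta> \<longrightarrow> x \<notin> Q) \<Longrightarrow> V y = 0"
proof -
  define g where "g x = (if x \<in> Q \<and> steep M c \<epsilon> x
      then SOME v. norm v \<le> 1 \<and> (\<forall>p\<in>near_points M \<epsilon> x. v \<bullet> (p - x) \<le> - c) else 0)" for x
  have g: "norm (g x) \<le> 1 \<and> (\<forall>p\<in>near_points M \<epsilon> x. g x \<bullet> (p - x) \<le> - c)"
    if "x \<in> Q" "steep M c \<epsilon> x" for x
    using someI_ex[OF that(2)[unfolded steep_def]] that by (simp add: g_def)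
  obtain V where V: "continuous_on UNIV V" "\<And>y. V y \<in> convex hull (g ` ball y \<eta>)"
    using continuous_local_convex_selection[OF assms(2)] by blast
  have hull: "V y \<in> B" if "convex B" "\<And>x. dist x y < \<eta> \<Longrightarrow> g x \<in> B" for B y
  proof -
    have "convex hull (g ` ball y \<eta>) \<subseteq> B"
      using that by (intro hull_minimal) (auto simp: dist_commute)
    then show ?thesis using V(2) by blast
  qed
  have drop: "g x \<bullet> (p - y) \<le> - (c / 2)"
    if "x \<in> Q" "steep M c \<epsilon> x" "dist x y < \<eta>" "p \<in> near_points M (\<epsilon> / 2) y" for x y p
  proof -
    have "p \<in> near_points M (\<epsilon> / 2 + 2 * \<eta>) x" using that by (intro near_points_mono_ball[of _ _ _ y]) auto
    then have "p \<in> near_points M \<epsilon> x" using assms(3) by (auto simp: near_points_def)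
    then have "g x \<bullet> (p - x) \<le> - c" using g that by blast
    moreover have "g x \<bullet> (x - y) \<le> 1 * \<eta>"
      using that g[OF that(1,2)] assms(2)
      by (intro order_trans[OF norm_cauchy_schwarz] mult_mono) (auto simp: dist_norm)
    moreover have "g x \<bullet> (p - y) = g x \<bullet> (p - x) + g x \<bullet> (x - y)" by (simp add: inner_diff_right)
    ultimately show ?thesis using assms(4) by linarith
  qed
  show thesis
  proof (rule that[of V, OF V(1)])
    show "norm (V y) \<le> 1" for y
    proof -
      have "V y \<in> cball 0 1" using g by (intro hull) (auto simp: g_def)
      then show ?thesis by simp
    qed
    show "V y \<bullet> (p - y) \<le> - (c / 2) * norm (V y)" if p: "p \<in> near_points M (\<epsilon> / 2) y" for y p
    proof -
      let ?B = "{v. v \<bullet> (p - y) \<le> - (c / 2) * norm v}"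
      have "convex ?B"
      proof (rule convexI)
        fix v w :: 'a and \<alpha> \<beta> :: real
        assume vw: "v \<in> ?B" "w \<in> ?B" "0 \<le> \<alpha>" "0 \<le> \<beta>" "\<alpha> + \<beta> = 1"
        have "(\<alpha> *\<^sub>R v + \<beta> *\<^sub>R w) \<bullet> (p - y) \<le> \<alpha> * (- (c / 2) * norm v) + \<beta> * (- (c / 2) * norm w)"
          unfolding inner_add_left inner_scaleR_left using vw by (intro add_mono mult_left_mono) auto
        also have "\<dots> = - (c / 2) * (\<alpha> * norm v + \<beta> * norm w)" by (simp add: algebra_simps)
        also have "\<dots> \<le> - (c / 2) * norm (\<alpha> *\<^sub>R v + \<beta> *\<^sub>R w)"
          using norm_triangle_ineq[of "\<alpha> *\<^sub>R v" "\<beta> *\<^sub>R w"] vw assms(1) by simp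
        finally show "\<alpha> *\<^sub>R v + \<beta> *\<^sub>R w \<in> ?B" by simp
      qed
      moreover have "g x \<in> ?B" if "dist x y < \<eta>" for x
      proof (cases "x \<in> Q \<and> steep M c \<epsilon> x")
        case True
        have "g x \<bullet> (p - y) \<le> - (c / 2) * 1" using drop True that p by simp
        also have "\<dots> \<le> - (c / 2) * norm (g x)" using g[of x] True assms(1) by (simp add: mult_left_le)
        finally show ?thesis by simp
      qed (auto simp: g_def)
      ultimately show ?thesis using hull[of ?B y] by blast
    qed
    show "V y \<bullet> (p - y) \<le> - (c / 2)"
      if "\<forall>x. dist x y < \<eta> \<longrightarrow> x \<in> Q \<and> steep M c \<epsilon> x" "p \<in> near_points M (\<epsilon> / 2) y" for y p
    proof -
      have "convex {v. (p - y) \<bullet> v \<le> - (c / 2)}" by (rule convex_halfspace_le)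
      then have "V y \<in> {v. (p - y) \<bullet> v \<le> - (c / 2)}"
        using drop that by (intro hull) (auto simp: inner_commute)
      then show ?thesis by (simp add: inner_commute)
    qed
    show "V y = 0" if "\<forall>x. dist x y < \<eta> \<longrightarrow> x \<notin> Q" for y
    proof -
      have "V y \<in> {0}" using that by (intro hull) (auto simp: g_def)
      then show ?thesis by simp
    qed
  qed
qed

text \<open>Points of \<open>M\<close> that are not almost nearest are too far away to matter after a short step, which
  gives the first alternative.\<close>

lemma infdist_after_ascent:
  fixes M :: "'a::euclidean_space set"
  assumes M: "closed M" "M \<noteq> {}" and "0 \<le> \<tau>" "\<tau> \<le> \<epsilon> / 4" "norm v \<le> 1" "k \<ge> 0"
    and v: "\<And>p. p \<in> near_points M (\<epsilon> / 2) y \<Longrightarrow> v \<bullet> (p - y) \<le> - k"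
  shows "infdist y M + \<epsilon> / 4 \<le> infdist (y + \<tau> *\<^sub>R v) M \<or>
         (infdist y M)\<^sup>2 + 2 * \<tau> * k \<le> (infdist (y + \<tau> *\<^sub>R v) M)\<^sup>2"
proof -
  obtain p where p: "p \<in> M" "infdist (y + \<tau> *\<^sub>R v) M = dist (y + \<tau> *\<^sub>R v) p"
    using infdist_attains_inf[OF M] by metis
  show ?thesis
  proof (cases "p \<in> near_points M (\<epsilon> / 2) y")
    case True
    have "(infdist y M)\<^sup>2 \<le> (dist y p)\<^sup>2"
      using infdist_le[OF p(1)] infdist_nonneg by (intro power_mono)
    moreover have "(dist (y + \<tau> *\<^sub>R v) p)\<^sup>2 = (dist y p)\<^sup>2 - 2 * \<tau> * (v \<bullet> (p - y)) + (\<tau> * norm v)\<^sup>2"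
      unfolding dist_norm power_mult_distrib power2_norm_eq_inner
      by (simp add: inner_diff_left inner_diff_right inner_add_left inner_add_right inner_commute power2_eq_square algebra_simps)
    moreover have "2 * \<tau> * (v \<bullet> (p - y)) \<le> 2 * \<tau> * (- k)"
      using v[OF True] assms(3) by (intro mult_left_mono) auto
    ultimately show ?thesis unfolding p(2) using zero_le_power2[of "\<tau> * norm v"] by (intro disjI2) linarith
  next
    case False
    then have "infdist y M + \<epsilon> / 2 < dist y p" using p by (auto simp: near_points_def)
    moreover have "dist y p \<le> dist y (y + \<tau> *\<^sub>R v) + dist (y + \<tau> *\<^sub>R v) p" by (rule dist_triangle)
    moreover have "dist y (y + \<tau> *\<^sub>R v) \<le> \<epsilon> / 4 * 1"
    proof -
      have "dist y (y + \<tau> *\<^sub>R v) = \<tau> * norm v" using assms by (simp add: dist_norm)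
      also have "\<dots> \<le> \<epsilon> / 4 * 1" using assms by (intro mult_mono) auto
      finally show ?thesis .
    qed
    ultimately show ?thesis using p(2) by (intro disjI1) simp
  qed
qed

text \<open>One step of the discrete upward flow. It never decreases the distance to \<open>M\<close>, gains at least
  \<open>\<kappa>\<close> in steep surroundings, and stops at the height \<open>t + e\<close>.\<close>

lemma ascending_step:
  fixes M :: "'a::euclidean_space set"
  assumes M: "closed M" "M \<noteq> {}" and "c > 0" "\<epsilon> > 0" "e > 0" "t > 0"
  obtains f \<kappa> where "\<kappa> > 0" "continuous_on UNIV f" "\<And>x. dist (f x) x \<le> e"
    "\<And>x \<tau>. \<tau> \<in> {0..1} \<Longrightarrow> infdist x M \<le> infdist (x + \<tau> *\<^sub>R (f x - x)) M"
    "\<And>x. infdist x M \<le> t \<Longrightarrow> \<forall>y. dist y x < e \<longrightarrow> steep M c \<epsilon> y \<Longrightarrow> infdist x M + \<kappa> \<le> infdist (f x) M"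
    "\<And>x. infdist (f x) M \<le> max (infdist x M) (t + e)"
proof -
  define \<eta> where "\<eta> = min (e / 4) (min (\<epsilon> / 4) (c / 2))"
  have \<eta>: "\<eta> > 0" "\<eta> \<le> e / 4" "\<eta> \<le> \<epsilon> / 4" "\<eta> \<le> c / 2" using assms by (auto simp: \<eta>_def)
  define Q where "Q = {x. infdist x M \<le> t + e / 2}"
  obtain V where V: "continuous_on UNIV V" "\<And>y. norm (V y) \<le> 1"
    "\<And>y p. p \<in> near_points M (\<epsilon> / 2) y \<Longrightarrow> V y \<bullet> (p - y) \<le> - (c / 2) * norm (V y)"
    "\<And>y p. (\<forall>x. dist x y < \<eta> \<longrightarrow> x \<in> Q \<and> steep M c \<epsilon> x) \<Longrightarrow> p \<in> near_points M (\<epsilon> / 2) y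
       \<Longrightarrow> V y \<bullet> (p - y) \<le> - (c / 2)"
    "\<And>y. (\<forall>x. dist x y < \<eta> \<longrightarrow> x \<notin> Q) \<Longrightarrow> V y = 0"
    by (rule steep_direction_field[where Q = Q and M = M, OF assms(3) \<eta>(1,3,4) that])
  \<comment> \<open>squared distances grow by \<open>\<eta> * c\<close>, and this is the gain it implies at heights up to \<open>t\<close>\<close>
  define \<kappa> where "\<kappa> = min (\<epsilon> / 4) (min 1 (\<eta> * c / (2 * t + 1)))"
  have \<kappa>: "\<kappa> > 0" "\<kappa> \<le> \<epsilon> / 4" "\<kappa> * (2 * t + \<kappa>) \<le> \<eta> * c"
  proof -
    show "\<kappa> > 0" using assms \<eta> by (auto simp: \<kappa>_def)
    show "\<kappa> \<le> \<epsilon> / 4" unfolding \<kappa>_def by (rule min.cobounded1)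
    have "\<kappa> \<le> \<eta> * c / (2 * t + 1)" "\<kappa> \<le> 1" unfolding \<kappa>_def by linarith+
    then have "\<kappa> * (2 * t + 1) \<le> \<eta> * c" using assms by (simp add: field_simps)
    moreover have "\<kappa> * (2 * t + \<kappa>) \<le> \<kappa> * (2 * t + 1)" using \<open>\<kappa> \<le> 1\<close> \<open>\<kappa> > 0\<close> by simp
    ultimately show "\<kappa> * (2 * t + \<kappa>) \<le> \<eta> * c" by linarith
  qed
  let ?f = "\<lambda>x. x + \<eta> *\<^sub>R V x"
  show thesis
  proof (rule that[of \<kappa> ?f])
    show "\<kappa> > 0" by fact
    show "continuous_on UNIV ?f" by (intro continuous_intros V)
    have step: "dist (?f x) x \<le> \<eta>" for x
      using V(2)[of x] \<eta>(1) by (simp add: dist_norm mult_left_le)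
    show "dist (?f x) x \<le> e" for x using step[of x] \<eta>(2) assms(5) by linarith
    show "infdist x M \<le> infdist (x + \<tau> *\<^sub>R (?f x - x)) M" if "\<tau> \<in> {0..1}" for x \<tau>
    proof -
      have "\<tau> * \<eta> \<le> 1 * \<eta>" using that \<eta> by (intro mult_right_mono) auto
      moreover have "0 \<le> \<tau> * \<eta>" using that \<eta> by simp
      ultimately have "\<tau> * \<eta> \<le> \<epsilon> / 4" "0 \<le> \<tau> * \<eta>" using \<eta>(3) by linarith+
      moreover have "V x \<bullet> (p - x) \<le> - 0" if "p \<in> near_points M (\<epsilon> / 2) x" for p
      proof -
        have "0 \<le> (c / 2) * norm (V x)" using assms(3) by simp
        then show ?thesis using V(3)[OF that] by linarith
      qed
      ultimately have "infdist x M + \<epsilon> / 4 \<le> infdist (x + (\<tau> * \<eta>) *\<^sub>R V x) M \<or>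
         (infdist x M)\<^sup>2 + 2 * (\<tau> * \<eta>) * 0 \<le> (infdist (x + (\<tau> * \<eta>) *\<^sub>R V x) M)\<^sup>2"
        using V(2) by (intro infdist_after_ascent[OF M]) auto
      then show ?thesis using assms(4) power2_le_imp_le[OF _ infdist_nonneg] by auto
    qed
    show "infdist x M + \<kappa> \<le> infdist (?f x) M"
      if x: "infdist x M \<le> t" "\<forall>y. dist y x < e \<longrightarrow> steep M c \<epsilon> y" for x
    proof -
      have Q: "y \<in> Q \<and> steep M c \<epsilon> y" if "dist y x < \<eta>" for y
        using x that \<eta> infdist_triangle[of y M x] by (auto simp: Q_def)
      have "infdist x M + \<epsilon> / 4 \<le> infdist (?f x) M \<or>
         (infdist x M)\<^sup>2 + 2 * \<eta> * (c / 2) \<le> (infdist (?f x) M)\<^sup>2"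
        using V(2) V(4)[rule_format, OF Q] \<eta> assms(3) by (intro infdist_after_ascent[OF M]) auto
      moreover have "infdist x M + \<kappa> \<le> infdist (?f x) M"
        if "(infdist x M)\<^sup>2 + 2 * \<eta> * (c / 2) \<le> (infdist (?f x) M)\<^sup>2"
      proof (rule power2_le_imp_le[OF _ infdist_nonneg])
        have "\<kappa> * (2 * infdist x M + \<kappa>) \<le> \<kappa> * (2 * t + \<kappa>)" using x(1) \<kappa>(1) by simp
        then have "\<kappa> * (2 * infdist x M + \<kappa>) \<le> \<eta> * c" using \<kappa>(3) by linarith
        then show "(infdist x M + \<kappa>)\<^sup>2 \<le> (infdist (?f x) M)\<^sup>2"
          using that by (simp add: power2_eq_square algebra_simps)
      qed
      ultimately show ?thesis using \<kappa>(2) by linarith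
    qed
    show "infdist (?f x) M \<le> max (infdist x M) (t + e)" for x
    proof (cases "infdist x M \<le> t + 3 * e / 4")
      case True
      then show ?thesis using infdist_triangle[of "?f x" M x] step[of x] \<eta> by linarith
    next
      case False
      have "y \<notin> Q" if "dist y x < \<eta>" for y
        using False that \<eta> infdist_triangle[of x M y] by (auto simp: Q_def dist_commute)
      then have "V x = 0" by (intro V(5)) auto
      then show ?thesis by simp
    qed
  qed
qed

text \<open>One step of the discrete downward flow, opposite to the upward field. A single nearest point
  suffices to bound the new distance from above. The step is short compared with \<open>s\<close>, so \<open>M\<close> is
  not reached.\<close>

lemma descending_step:
  fixes M :: "'a::euclidean_space set"
  assumes M: "closed M" "M \<noteq> {}" and "c > 0" "\<epsilon> > 0" "e > 0" "0 < s" "s < t"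
    and steep: "\<And>x. s \<le> infdist x M \<Longrightarrow> infdist x M \<le> t \<Longrightarrow> steep M c \<epsilon> x"
  obtains f \<kappa> where "\<kappa> > 0" "continuous_on UNIV f"
    "\<And>x \<tau>. \<tau> \<in> {0..1} \<Longrightarrow> 0 < infdist x M \<Longrightarrow> 0 < infdist (x + \<tau> *\<^sub>R (f x - x)) M"
    "\<And>x. infdist (f x) M \<le> infdist x M"
    "\<And>x. s + e \<le> infdist x M \<Longrightarrow> infdist x M \<le> t - e \<Longrightarrow> infdist (f x) M \<le> infdist x M - \<kappa>"
proof -
  define \<eta> where "\<eta> = min (min e (s / 4)) (min (\<epsilon> / 4) (c / 2))"
  have \<eta>: "\<eta> > 0" "\<eta> \<le> e" "\<eta> \<le> s / 4" "\<eta> \<le> \<epsilon> / 4" "\<eta> \<le> c / 2" using assms by (auto simp: \<eta>_def)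
  define Q where "Q = {x. s \<le> infdist x M \<and> infdist x M \<le> t}"
  obtain V where V: "continuous_on UNIV V" "\<And>y. norm (V y) \<le> 1"
    "\<And>y p. p \<in> near_points M (\<epsilon> / 2) y \<Longrightarrow> V y \<bullet> (p - y) \<le> - (c / 2) * norm (V y)"
    "\<And>y p. (\<forall>x. dist x y < \<eta> \<longrightarrow> x \<in> Q \<and> steep M c \<epsilon> x) \<Longrightarrow> p \<in> near_points M (\<epsilon> / 2) y
       \<Longrightarrow> V y \<bullet> (p - y) \<le> - (c / 2)"
    "\<And>y. (\<forall>x. dist x y < \<eta> \<longrightarrow> x \<notin> Q) \<Longrightarrow> V y = 0"
    by (rule steep_direction_field[where Q = Q and M = M, OF assms(3) \<eta>(1,4,5) that])
  define \<kappa> where "\<kappa> = min s (\<eta> * c / (4 * t))"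
  have \<kappa>: "\<kappa> > 0" "\<kappa> \<le> s" "4 * t * \<kappa> \<le> \<eta> * c"
  proof -
    show "\<kappa> > 0" using assms \<eta> by (auto simp: \<kappa>_def)
    show "\<kappa> \<le> s" unfolding \<kappa>_def by (rule min.cobounded1)
    have "\<kappa> \<le> \<eta> * c / (4 * t)" unfolding \<kappa>_def by (rule min.cobounded2)
    then show "4 * t * \<kappa> \<le> \<eta> * c" using assms by (simp add: field_simps)
  qed
  let ?f = "\<lambda>x. x - \<eta> *\<^sub>R V x"
  have desc: "\<exists>p\<in>near_points M (\<epsilon> / 2) x. (infdist (?f x) M)\<^sup>2 \<le> (infdist x M)\<^sup>2 + 2 * \<eta> * (V x \<bullet> (p - x)) + (\<eta> * norm (V x))\<^sup>2" for x
  proof -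
    obtain p where p: "p \<in> M" "infdist x M = dist x p"
      using infdist_attains_inf[OF M] by metis
    have "(infdist (?f x) M)\<^sup>2 \<le> (dist (?f x) p)\<^sup>2"
      using infdist_le[OF p(1)] infdist_nonneg by (intro power_mono)
    also have "\<dots> = (dist x p)\<^sup>2 + 2 * \<eta> * (V x \<bullet> (p - x)) + (\<eta> * norm (V x))\<^sup>2"
      unfolding dist_norm power_mult_distrib power2_norm_eq_inner
      by (simp add: inner_diff_left inner_diff_right inner_add_left inner_add_right inner_commute power2_eq_square algebra_simps)
    finally show ?thesis using p assms(4) by (intro bexI[of _ p]) (auto simp: near_points_def)
  qed
  have sq: "(\<eta> * norm (V x))\<^sup>2 \<le> \<eta> * (c / 2) * norm (V x)" for x
  proof -
    have "norm (V x) * norm (V x) \<le> 1 * norm (V x)" using V(2) by (intro mult_right_mono) auto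
    then have "(\<eta> * \<eta>) * (norm (V x) * norm (V x)) \<le> (\<eta> * (c / 2)) * norm (V x)"
      using \<eta> by (intro mult_mono) auto
    then show ?thesis by (simp add: power2_eq_square algebra_simps)
  qed
  show thesis
  proof (rule that[of \<kappa> ?f])
    show "\<kappa> > 0" by fact
    show "continuous_on UNIV ?f" by (intro continuous_intros V)
    show "0 < infdist (x + \<tau> *\<^sub>R (?f x - x)) M" if "\<tau> \<in> {0..1}" "0 < infdist x M" for x \<tau>
    proof (cases "\<exists>y. dist y x < \<eta> \<and> y \<in> Q")
      case True
      then obtain y where y: "dist y x < \<eta>" "s \<le> infdist y M" by (auto simp: Q_def)
      have "dist (x + \<tau> *\<^sub>R (?f x - x)) x = \<tau> * (\<eta> * norm (V x))"
        using that \<eta> by (simp add: dist_norm)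
      also have "\<dots> \<le> 1 * (\<eta> * 1)" using that \<eta> V(2) by (intro mult_mono) auto
      finally show ?thesis
        using infdist_triangle[of y M x] infdist_triangle[of x M "x + \<tau> *\<^sub>R (?f x - x)"] y \<eta> assms(6)
        by (simp add: dist_commute)
    next
      case False
      then have "V x = 0" by (intro V(5)) auto
      then show ?thesis using that by simp
    qed
    show "infdist (?f x) M \<le> infdist x M" for x
    proof (rule power2_le_imp_le[OF _ infdist_nonneg])
      obtain p where p: "p \<in> near_points M (\<epsilon> / 2) x"
        "(infdist (?f x) M)\<^sup>2 \<le> (infdist x M)\<^sup>2 + 2 * \<eta> * (V x \<bullet> (p - x)) + (\<eta> * norm (V x))\<^sup>2"
        using desc by blast
      have "2 * \<eta> * (V x \<bullet> (p - x)) \<le> 2 * \<eta> * (- (c / 2) * norm (V x))"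
        using V(3)[OF p(1)] \<eta> by (intro mult_left_mono) auto
      moreover have "0 \<le> \<eta> * (c / 2) * norm (V x)" using \<eta> assms by simp
      ultimately show "(infdist (?f x) M)\<^sup>2 \<le> (infdist x M)\<^sup>2"
        using p(2) sq[of x] by (simp add: algebra_simps)
    qed
    show "infdist (?f x) M \<le> infdist x M - \<kappa>" if x: "s + e \<le> infdist x M" "infdist x M \<le> t - e" for x
    proof (rule power2_le_imp_le)
      show "0 \<le> infdist x M - \<kappa>" using x \<kappa> assms by linarith
      have Q: "y \<in> Q \<and> steep M c \<epsilon> y" if "dist y x < \<eta>" for y
      proof -
        have "y \<in> Q" using x that \<eta> infdist_triangle[of y M x] infdist_triangle[of x M y]
          by (auto simp: Q_def dist_commute)
        then show ?thesis using steep by (auto simp: Q_def)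
      qed
      obtain p where p: "p \<in> near_points M (\<epsilon> / 2) x"
        "(infdist (?f x) M)\<^sup>2 \<le> (infdist x M)\<^sup>2 + 2 * \<eta> * (V x \<bullet> (p - x)) + (\<eta> * norm (V x))\<^sup>2"
        using desc by blast
      have "2 * \<eta> * (V x \<bullet> (p - x)) \<le> 2 * \<eta> * (- (c / 2))"
        using V(4)[rule_format, OF Q p(1)] \<eta> by (intro mult_left_mono) auto
      moreover have "\<eta> * (c / 2) * norm (V x) \<le> \<eta> * (c / 2) * 1"
        using V(2) \<eta> assms by (intro mult_left_mono) auto
      ultimately have "(infdist (?f x) M)\<^sup>2 \<le> (infdist x M)\<^sup>2 - \<eta> * c / 2"
        using p(2) sq[of x] by (simp add: algebra_simps)
      also have "\<dots> \<le> (infdist x M)\<^sup>2 - 2 * \<kappa> * t" using \<kappa>(3) by (simp add: mult_ac)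
      also have "\<dots> \<le> (infdist x M)\<^sup>2 - 2 * \<kappa> * infdist x M"
      proof -
        have "\<kappa> * infdist x M \<le> \<kappa> * t" using x assms(5) \<kappa>(1) by (intro mult_left_mono) auto
        then show ?thesis by simp
      qed
      also have "\<dots> \<le> (infdist x M - \<kappa>)\<^sup>2" by (simp add: power2_diff)
      finally show "(infdist (?f x) M)\<^sup>2 \<le> (infdist x M - \<kappa>)\<^sup>2" .
    qed
  qed
qed

text \<open>The relation \<open>R\<close> carries the information about heights, such as monotonicity, from a single step
  through all intermediate maps of the deformation.\<close>

lemma homotopic_id_iterate:
  fixes f :: "'a::euclidean_space \<Rightarrow> 'a"
  assumes f: "continuous_on UNIV f"
    and R: "\<And>x \<tau>. \<tau> \<in> {0..1} \<Longrightarrow> R x (x + \<tau> *\<^sub>R (f x - x))" "\<And>x y z. R x y \<Longrightarrow> R y z \<Longrightarrow> R x z"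
  shows "homotopic_with_canon (\<lambda>g. \<forall>x. R x (g x)) UNIV UNIV id (f ^^ k)"
proof (induction k)
  have refl: "R x x" for x using R(1)[of 0 x] by simp
  case 0
  show ?case using refl by (simp add: id_def)
next
  case (Suc k)
  have "homotopic_with_canon (\<lambda>g. \<forall>x. R x (g x)) UNIV UNIV id f"
  proof -
    let ?h = "\<lambda>z. snd z + fst z *\<^sub>R (f (snd z) - snd z)"
    have "continuous_on ({0..1} \<times> UNIV) ?h"
      by (intro continuous_intros continuous_on_compose2[OF f]) auto
    then have "continuous_map (prod_topology (top_of_set {0..1}) (top_of_set UNIV)) (top_of_set UNIV) ?h"
      unfolding prod_topology_subtopology_eu by simp
    then show ?thesis unfolding homotopic_with_def using R(1) by (intro exI[of _ ?h]) auto
  qed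
  moreover have "continuous_map (top_of_set UNIV) (top_of_set UNIV) (f ^^ k)"
    using homotopic_with_imp_continuous_maps[OF Suc] by simp
  moreover have "\<forall>x. R x ((g \<circ> (f ^^ k)) x)" if "\<forall>x. R x (g x)" for g
    using that homotopic_with_imp_property[OF Suc] R(2) by (metis comp_apply)
  ultimately have "homotopic_with_canon (\<lambda>g. \<forall>x. R x (g x)) UNIV UNIV (id \<circ> (f ^^ k)) (f \<circ> (f ^^ k))"
    by (rule homotopic_with_compose_continuous_map_right)
  then have "homotopic_with_canon (\<lambda>g. \<forall>x. R x (g x)) UNIV UNIV (f ^^ k) (f ^^ Suc k)" by simp
  then show ?case by (rule homotopic_with_trans[OF Suc])
qed

lemma homotopic_id_imp_homotopy:
  fixes F :: "'a::topological_space \<Rightarrow> 'a"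
  assumes "homotopic_with_canon P UNIV UNIV id F"
  shows "\<exists>h. continuous_on ({0..1} \<times> UNIV) h \<and> (\<forall>x. h (0, x) = x) \<and> (\<forall>x. h (1, x) = F x) \<and>
    (\<forall>\<tau>\<in>{0..1::real}. P (\<lambda>x. h (\<tau>, x)))"
proof -
  obtain h where h: "continuous_map (prod_topology (top_of_set {0..1}) (top_of_set UNIV)) (top_of_set UNIV) h"
    "\<forall>x. h (0, x) = id x" "\<forall>x. h (1, x) = F x" "\<forall>\<tau>\<in>{0..1::real}. P (\<lambda>x. h (\<tau>, x))"
    using assms unfolding homotopic_with_def by blast
  have "continuous_on ({0..1} \<times> UNIV) h" using h(1) unfolding prod_topology_subtopology_eu by simp
  then show ?thesis using h(2-4) unfolding id_apply by blast
qed

section \<open>Pushing connected sets away from the set\<close>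

lemma homotopic_loops_along_homotopy:
  fixes F :: "'a::topological_space \<Rightarrow> 'a"
  assumes F: "homotopic_with_canon P UNIV UNIV id F"
    and p: "path p" "pathfinish p = pathstart p"
    and S: "\<And>g x. P g \<Longrightarrow> x \<in> path_image p \<Longrightarrow> g x \<in> S"
  shows "homotopic_loops S p (F \<circ> p)"
proof -
  obtain h where h: "continuous_on ({0..1} \<times> UNIV) h" "\<forall>x. h (0, x) = x" "\<forall>x. h (1, x) = F x"
    "\<forall>\<tau>\<in>{0..1::real}. P (\<lambda>x. h (\<tau>, x))"
    using homotopic_id_imp_homotopy[OF F] by blast
  have "continuous_on ({0..1} \<times> {0..1}) (\<lambda>z::real \<times> real. p (snd z))"
    by (rule continuous_on_compose2[OF p(1)[unfolded path_def]]) (auto intro!: continuous_intros)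
  then have "continuous_on ({0..1} \<times> {0..1}) (\<lambda>z::real \<times> real. (fst z, p (snd z)))"
    by (intro continuous_on_Pair continuous_on_fst continuous_on_id)
  then have "continuous_on ({0..1} \<times> {0..1}) (\<lambda>z. h (fst z, p (snd z)))"
    by (rule continuous_on_compose2[OF h(1)]) auto
  moreover have "h (\<tau>, p u) \<in> S" if "\<tau> \<in> {0..1}" "u \<in> {0..1}" for \<tau> u
    using S[OF h(4)[rule_format, OF that(1)], of "p u"] that(2) by (auto simp: path_image_def)
  ultimately show ?thesis
    unfolding homotopic_loops using h(2,3) p(2)
    by (intro exI[of _ "\<lambda>z. h (fst z, p (snd z))"]) (auto simp: pathfinish_def pathstart_def)
qed

lemma funpow_infdist_mono:
  assumes "\<And>x. infdist x M \<le> infdist (f x) M"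
  shows "infdist x M \<le> infdist ((f ^^ k) x) M"
  by (induction k) (use assms order_trans in auto)

text \<open>The upward step is iterated until every point has either risen above \<open>t\<close> or met a peak. In the
  latter case it stays within \<open>\<sigma>\<close> of that peak, since it never descends and moves by less than the
  width of the moat. Two peaks closer than \<open>A\<close> are within \<open>\<sigma>\<close> of each other, because the lower one
  sees the higher one. So the image of a connected set cannot have points both near a peak and away
  from it.\<close>

lemma connected_push_or_trap:
  fixes M :: "'a::euclidean_space set"
  assumes n: "DIM('a) \<ge> 3" and M: "closed M" "M \<noteq> {}"
    and dist: "local_distortion M r < ennreal (distortion_bound DIM('a))"
    and st: "0 < s" "s < t" "t < r" and "e > 0"
  obtains F where
    "homotopic_with_canon (\<lambda>g. \<forall>x. infdist x M \<le> infdist (g x) M) UNIV UNIV id F"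
    "\<And>K. connected K \<Longrightarrow> \<forall>x\<in>K. s \<le> infdist x M \<Longrightarrow>
       (\<forall>x\<in>K. t < infdist (F x) M) \<or>
       (\<exists>z. s / 2 \<le> infdist z M \<and> infdist z M \<le> t + e \<and> F ` K \<subseteq> cball z e)"
proof -
  define e' where "e' = min e (min ((r - t) / 2) (s / 4))"
  have e'0: "e' \<le> (r - t) / 2" unfolding e'_def by (meson min.cobounded1 min.cobounded2 order_trans)
  have e'1: "e' > 0" "e' \<le> e" "e' \<le> s / 4" using st \<open>e > 0\<close> by (auto simp: e'_def)
  have e': "e' > 0" "e' \<le> e" "t + e' < r" "e' \<le> s / 4" using e'0 e'1 st by (auto simp: field_simps)
  have s2: "0 < s / 2" using st by simp
  obtain A where A: "A > 0"
    "\<And>\<sigma>. \<sigma> > 0 \<Longrightarrow> \<exists>\<epsilon>>0. \<forall>x. s / 2 \<le> infdist x M \<and> infdist x M \<le> t + e' \<longrightarrow> steep M A \<epsilon> x \<or> peak M A \<epsilon> \<sigma> x"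
    using steep_or_peak[OF n M dist s2 e'(3)] by blast
  define \<sigma> where "\<sigma> = min (e' / 2) (A / 10)"
  have \<sigma>: "\<sigma> > 0" "2 * \<sigma> \<le> e'" "10 * \<sigma> \<le> A" using e' A(1) by (auto simp: \<sigma>_def)
  obtain \<epsilon> where \<epsilon>: "\<epsilon> > 0" and sp:
    "\<And>x. s / 2 \<le> infdist x M \<Longrightarrow> infdist x M \<le> t + e' \<Longrightarrow> steep M A \<epsilon> x \<or> peak M A \<epsilon> \<sigma> x"
    using A(2)[OF \<sigma>(1)] by blast
  define \<eta> where "\<eta> = min \<epsilon> (min (A / 10) e')"
  have \<eta>: "\<eta> > 0" "\<eta> \<le> \<epsilon>" "\<eta> \<le> A / 10" "\<eta> \<le> e'" using \<epsilon> A(1) e' by (auto simp: \<eta>_def)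
  have "t > 0" using st by simp
  obtain f \<kappa> where f: "\<kappa> > 0" "continuous_on UNIV f" "\<And>x. dist (f x) x \<le> \<eta>"
    "\<And>x \<tau>. \<tau> \<in> {0..1} \<Longrightarrow> infdist x M \<le> infdist (x + \<tau> *\<^sub>R (f x - x)) M"
    "\<And>x. infdist x M \<le> t \<Longrightarrow> \<forall>y. dist y x < \<eta> \<longrightarrow> steep M A \<epsilon> y \<Longrightarrow> infdist x M + \<kappa> \<le> infdist (f x) M"
    "\<And>x. infdist (f x) M \<le> max (infdist x M) (t + \<eta>)"
    by (rule ascending_step[OF M A(1) \<epsilon> \<eta>(1) \<open>t > 0\<close> that])
  have mono: "infdist x M \<le> infdist (f x) M" for x using f(4)[of 1 x] by simp
  \<comment> \<open>the peaks that a trajectory below \<open>t\<close> can meet within one step\<close>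
  define Z where "Z = {z. s / 2 \<le> infdist z M \<and> infdist z M \<le> t + \<eta> \<and> peak M A \<epsilon> \<sigma> z}"
  define trapped where "trapped y \<longleftrightarrow> (\<exists>z\<in>Z. dist y z \<le> \<sigma> \<and> infdist z M - \<epsilon> \<le> infdist y M)" for y
  have Zp: "dist y z \<le> \<sigma>" if "z \<in> Z" "dist y z \<le> A" "infdist z M - \<epsilon> \<le> infdist y M" for y z
    using that by (auto simp: Z_def peak_def)
  have orbit: "t < infdist ((f ^^ k) x) M \<or> trapped ((f ^^ k) x) \<or> real k * \<kappa> \<le> infdist ((f ^^ k) x) M"
    if x: "s \<le> infdist x M" for x k
  proof (induction k)
    case 0
    then show ?case by (simp add: infdist_nonneg)
  next
    case (Suc k)
    let ?y = "(f ^^ k) x"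
    have sy: "s \<le> infdist ?y M" using funpow_infdist_mono[of M f, OF mono, of x k] x by linarith
    consider "t < infdist ?y M" | "trapped ?y" | "infdist ?y M \<le> t" "real k * \<kappa> \<le> infdist ?y M"
      using Suc by fastforce
    then show ?case
    proof cases
      case 1
      then show ?thesis using mono[of ?y] by auto
    next
      case 2
      then obtain z where z: "z \<in> Z" "dist ?y z \<le> \<sigma>" "infdist z M - \<epsilon> \<le> infdist ?y M"
        by (auto simp: trapped_def)
      have "dist (f ?y) z \<le> A" using dist_triangle[of "f ?y" z ?y] f(3)[of ?y] z \<eta> \<sigma> A(1) by linarith
      moreover have "infdist z M - \<epsilon> \<le> infdist (f ?y) M" using mono[of ?y] z by linarith
      ultimately have "trapped (f ?y)" using Zp[OF z(1)] z(1) by (auto simp: trapped_def)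
      then show ?thesis by simp
    next
      case 3
      show ?thesis
      proof (cases "\<forall>y. dist y ?y < \<eta> \<longrightarrow> steep M A \<epsilon> y")
        case True
        then have "infdist ?y M + \<kappa> \<le> infdist (f ?y) M" using f(5)[OF 3(1)] by blast
        then show ?thesis using 3 by (simp add: algebra_simps)
      next
        case False
        then obtain z where z: "dist z ?y < \<eta>" "\<not> steep M A \<epsilon> z" by blast
        have dz: "infdist ?y M - \<eta> \<le> infdist z M" "infdist z M \<le> infdist ?y M + \<eta>"
          using infdist_triangle[of z M ?y] infdist_triangle[of ?y M z] z by (auto simp: dist_commute)
        have "z \<in> Z" using sp[of z] z dz sy 3 \<eta> e' by (auto simp: Z_def)
        moreover have "dist (f ?y) z \<le> A"
          using dist_triangle[of "f ?y" z ?y] f(3)[of ?y] z \<eta> A(1) by (simp add: dist_commute)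
        moreover have "infdist z M - \<epsilon> \<le> infdist (f ?y) M" using mono[of ?y] dz \<eta> by linarith
        ultimately have "trapped (f ?y)" using Zp by (auto simp: trapped_def)
        then show ?thesis by simp
      qed
    qed
  qed
  obtain N :: nat where N: "t / \<kappa> < real N" using reals_Archimedean2 by blast
  then have N: "t < real N * \<kappa>" using f(1) by (simp add: field_simps)
  let ?F = "f ^^ N"
  have reach: "t < infdist (?F x) M \<or> trapped (?F x)" if "s \<le> infdist x M" for x
    using orbit[OF that, of N] N by linarith
  show thesis
  proof (rule that[of ?F])
    show hom: "homotopic_with_canon (\<lambda>g. \<forall>x. infdist x M \<le> infdist (g x) M) UNIV UNIV id ?F"
      using f(4) by (intro homotopic_id_iterate[OF f(2)]) auto
    fix K assume K: "connected K" "\<forall>x\<in>K. s \<le> infdist x M"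
    have contF: "continuous_on UNIV ?F" using homotopic_with_imp_continuous[OF hom] by blast
    then have conn: "connected (?F ` K)"
      using K(1) continuous_on_subset connected_continuous_image by blast
    show "(\<forall>x\<in>K. t < infdist (?F x) M) \<or>
       (\<exists>z. s / 2 \<le> infdist z M \<and> infdist z M \<le> t + e \<and> ?F ` K \<subseteq> cball z e)"
    proof (cases "\<forall>x\<in>K. t < infdist (?F x) M")
      case False
      then obtain x where x: "x \<in> K" "\<not> t < infdist (?F x) M" by blast
      then have "trapped (?F x)" using reach K(2) by blast
      then obtain z where z: "z \<in> Z" "dist (?F x) z \<le> \<sigma>" by (auto simp: trapped_def)
      have gap: "dist y z \<le> 2 * \<sigma> \<or> 4 * \<sigma> < dist y z" if y: "y \<in> ?F ` K" for y
      proof -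
        consider "t < infdist y M" | "trapped y" using reach K(2) y by blast
        then show ?thesis
        proof cases
          case 1
          then have "infdist z M - \<epsilon> \<le> infdist y M" using z(1) \<eta> by (auto simp: Z_def)
          then show ?thesis using Zp[OF z(1), of y] \<sigma> by fastforce
        next
          case 2
          then obtain z' where z': "z' \<in> Z" "dist y z' \<le> \<sigma>" by (auto simp: trapped_def)
          show ?thesis
          proof (cases "dist z z' \<le> A")
            case True
            have "dist z z' \<le> \<sigma>"
            proof (cases "infdist z' M \<le> infdist z M")
              case True
              then show ?thesis using Zp[OF z'(1), of z] \<open>dist z z' \<le> A\<close> \<epsilon> by simp
            next
              case False
              then show ?thesis using Zp[OF z(1), of z'] \<open>dist z z' \<le> A\<close> \<epsilon> by (simp add: dist_commute)
            qed
            then show ?thesis using dist_triangle[of y z z'] z'(2) by (simp add: dist_commute)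
          next
            case False
            then show ?thesis using dist_triangle[of z z' y] z'(2) \<sigma> by (simp add: dist_commute)
          qed
        qed
      qed
      have "dist y z \<le> 2 * \<sigma>" if y: "y \<in> ?F ` K" for y
      proof (rule ccontr)
        assume far: "\<not> dist y z \<le> 2 * \<sigma>"
        have "connected ((\<lambda>y. dist y z) ` ?F ` K)"
          by (intro connected_continuous_image[OF _ conn] continuous_intros)
        then have "is_interval ((\<lambda>y. dist y z) ` ?F ` K)" by (simp add: is_interval_connected_1)
        moreover have "dist (?F x) z \<in> (\<lambda>y. dist y z) ` ?F ` K" "dist y z \<in> (\<lambda>y. dist y z) ` ?F ` K"
          using x y by auto
        moreover have "dist (?F x) z \<le> 3 * \<sigma>" "3 * \<sigma> \<le> dist y z"
          using z(2) \<sigma>(1) gap[OF y] far by linarith+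
        ultimately have "3 * \<sigma> \<in> (\<lambda>y. dist y z) ` ?F ` K" unfolding is_interval_1 by blast
        then obtain w where "w \<in> ?F ` K" "dist w z = 3 * \<sigma>" by (metis imageE)
        then show False using gap[of w] \<sigma>(1) by linarith
      qed
      then have "?F ` K \<subseteq> cball z e" using \<sigma>(2) e'(2) by (fastforce simp: dist_commute)
      then show ?thesis using z(1) \<eta> e' by (intro disjI2 exI[of _ z]) (auto simp: Z_def)
    qed simp
  qed
qed

lemma compact_infdist_lower_bound:
  fixes M :: "'a::euclidean_space set"
  assumes "closed M" "M \<noteq> {}" "compact K" "K \<subseteq> - M"
  obtains s where "s > 0" "\<And>x. x \<in> K \<Longrightarrow> s \<le> infdist x M"
proof (cases "K = {}")
  case False
  obtain y where y: "y \<in> K" "\<And>x. x \<in> K \<Longrightarrow> infdist y M \<le> infdist x M"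
    using continuous_attains_inf[OF assms(3) False continuous_on_infdist[OF continuous_on_id]] by blast
  have "infdist y M > 0"
    using y(1) assms in_closed_iff_infdist_zero[of M y] infdist_nonneg[of y M] by force
  then show ?thesis using y that by blast
qed (use that[of 1] in simp)

text \<open>Push a path from a peak \<open>x\<close> of height at most \<open>t\<close> to the high point \<open>b\<close> by a flow that is
  adapted to a larger range of heights. Its end \<open>b\<close> is too high to be caught near a peak of that
  flow, so all of it rises above \<open>T\<close>; but \<open>x\<close> never leaves its own moat and stays below \<open>T\<close>. Note
  that the constants of the two flows are unrelated, which is why the trajectory of \<open>x\<close> itself,
  rather than the discrete steps, is used.\<close>

lemma uniformly_steep:
  fixes M :: "'a::euclidean_space set"
  assumes n: "DIM('a) \<ge> 3" and M: "closed M" "M \<noteq> {}" "path_connected (- M)"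
    and dist: "local_distortion M r < ennreal (distortion_bound DIM('a))"
    and st: "0 < s" "s \<le> t" "t < r" and b: "t < infdist b M"
  obtains c \<epsilon> where "c > 0" "\<epsilon> > 0" "\<And>x. s \<le> infdist x M \<Longrightarrow> infdist x M \<le> t \<Longrightarrow> steep M c \<epsilon> x"
proof -
  obtain T where T: "t < T" "T < r" "T < infdist b M"
    using dense[of t "min r (infdist b M)"] st b by auto
  obtain A where A: "A > 0"
    "\<And>\<sigma>. \<sigma> > 0 \<Longrightarrow> \<exists>\<epsilon>>0. \<forall>x. s \<le> infdist x M \<and> infdist x M \<le> t \<longrightarrow> steep M A \<epsilon> x \<or> peak M A \<epsilon> \<sigma> x"
    using steep_or_peak[OF n M(1,2) dist st(1,3)] by blast
  define \<sigma> where "\<sigma> = min (A / 2) ((T - t) / 2)"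
  have \<sigma>0: "\<sigma> \<le> (T - t) / 2" "\<sigma> \<le> A / 2" "\<sigma> > 0"
    using A(1) T unfolding \<sigma>_def by (meson min.cobounded2, meson min.cobounded1, simp)
  then have \<sigma>: "\<sigma> > 0" "2 * \<sigma> \<le> A" "t + \<sigma> < T" using T(1) by (auto simp: field_simps)
  obtain \<epsilon> where \<epsilon>: "\<epsilon> > 0" and sp:
    "\<And>x. s \<le> infdist x M \<Longrightarrow> infdist x M \<le> t \<Longrightarrow> steep M A \<epsilon> x \<or> peak M A \<epsilon> \<sigma> x"
    using A(2)[OF \<sigma>(1)] by blast
  have "\<not> peak M A \<epsilon> \<sigma> x" if x: "s \<le> infdist x M" "infdist x M \<le> t" for x
  proof
    assume pk: "peak M A \<epsilon> \<sigma> x"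
    have "x \<in> - M" "b \<in> - M" using x b st by auto
    then obtain \<gamma> where \<gamma>: "path \<gamma>" "path_image \<gamma> \<subseteq> - M" "pathstart \<gamma> = x" "pathfinish \<gamma> = b"
      using M(3) unfolding path_connected_def by blast
    let ?K = "path_image \<gamma>"
    have xb: "x \<in> ?K" "b \<in> ?K" using \<gamma> by auto
    obtain s' where s': "s' > 0" "\<And>y. y \<in> ?K \<Longrightarrow> s' \<le> infdist y M"
      using compact_infdist_lower_bound[OF M(1,2) compact_path_image[OF \<gamma>(1)] \<gamma>(2)] by blast
    have "s' < T" using s'(2)[OF xb(1)] x T by linarith
    define e where "e = (infdist b M - T) / 4"
    have e: "e > 0" "T + 2 * e < infdist b M" using T by (auto simp: e_def field_simps)
    obtain F where F:
      "homotopic_with_canon (\<lambda>g. \<forall>x. infdist x M \<le> infdist (g x) M) UNIV UNIV id F"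
      "\<And>K. connected K \<Longrightarrow> \<forall>x\<in>K. s' \<le> infdist x M \<Longrightarrow>
         (\<forall>x\<in>K. T < infdist (F x) M) \<or>
         (\<exists>z. s' / 2 \<le> infdist z M \<and> infdist z M \<le> T + e \<and> F ` K \<subseteq> cball z e)"
      by (rule connected_push_or_trap[OF n M(1,2) dist s'(1) \<open>s' < T\<close> T(2) e(1) that])
    have "(\<forall>x\<in>?K. T < infdist (F x) M)"
    proof (rule ccontr)
      assume "\<not> ?thesis"
      then obtain z where z: "infdist z M \<le> T + e" "F ` ?K \<subseteq> cball z e"
        using F(2)[OF connected_path_image[OF \<gamma>(1)]] s'(2) by blast
      have "dist z (F b) \<le> e" using z(2) xb by auto
      then have "infdist (F b) M \<le> T + 2 * e"
        using infdist_triangle[of "F b" M z] z(1) by (simp add: dist_commute)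
      moreover have "infdist b M \<le> infdist (F b) M" using homotopic_with_imp_property[OF F(1)] by blast
      ultimately show False using e by linarith
    qed
    then have up: "T < infdist (F x) M" using xb by blast
    obtain h :: "real \<times> 'a \<Rightarrow> 'a" where h: "continuous_on ({0..1} \<times> UNIV) h" "\<forall>x. h (0, x) = x" "\<forall>x. h (1, x) = F x"
      "\<forall>\<tau>\<in>{0..1}. \<forall>x. infdist x M \<le> infdist (h (\<tau>, x)) M"
      using homotopic_id_imp_homotopy[OF F(1)] by blast
    let ?D = "(\<lambda>\<tau>. dist (h (\<tau>, x)) x) ` {0..1}"
    have "continuous_on {0..1} (\<lambda>\<tau>. h (\<tau>, x))"
      by (rule continuous_on_compose2[OF h(1)]) (auto intro!: continuous_intros)
    then have "connected ?D"
      by (intro connected_continuous_image continuous_on_dist continuous_on_const) auto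
    then have "is_interval ?D" by (simp add: is_interval_connected_1)
    moreover have "0 \<in> ?D" using h(2) by (intro image_eqI[of _ _ 0]) auto
    moreover have "dist (F x) x \<in> ?D" using h(3) by (intro image_eqI[of _ _ 1]) auto
    moreover have "\<sigma> < dist (F x) x"
      using up x \<sigma> infdist_triangle[of "F x" M x] by linarith
    ultimately have mid: "min A (dist (F x) x) \<in> ?D"
    proof -
      have "0 \<le> min A (dist (F x) x)" "min A (dist (F x) x) \<le> dist (F x) x" using A(1) by auto
      then show ?thesis using \<open>is_interval ?D\<close> \<open>0 \<in> ?D\<close> \<open>dist (F x) x \<in> ?D\<close> unfolding is_interval_1 by blast
    qed
    then obtain \<tau> where \<tau>: "\<tau> \<in> {0..1}" "dist (h (\<tau>, x)) x = min A (dist (F x) x)" by auto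
    have "infdist x M - \<epsilon> \<le> infdist (h (\<tau>, x)) M"
      using h(4)[rule_format, OF \<tau>(1), of x] \<epsilon> by linarith
    moreover have "dist (h (\<tau>, x)) x \<le> A" using \<tau>(2) by simp
    ultimately have "dist (h (\<tau>, x)) x \<le> \<sigma>" using pk unfolding peak_def by blast
    then show False using \<tau>(2) \<open>\<sigma> < dist (F x) x\<close> \<sigma> by (auto simp: min_def split: if_splits)
  qed
  then show thesis using that[OF A(1) \<epsilon>] sp by blast
qed

text \<open>There is no room above the bound \<open>T\<close>, so every loop ends in a ball around some peak, and this
  ball does not meet \<open>M\<close>.\<close>

lemma null_homotopic_if_infdist_bounded:
  fixes M :: "'a::euclidean_space set"
  assumes n: "DIM('a) \<ge> 3" and M: "closed M" "M \<noteq> {}"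
    and dist: "local_distortion M r < ennreal (distortion_bound DIM('a))"
    and T: "T < r" "\<And>x. infdist x M \<le> T"
    and p: "path p" "path_image p \<subseteq> - M" "pathfinish p = pathstart p"
  shows "\<exists>z. homotopic_loops (- M) p (linepath z z)"
proof -
  let ?K = "path_image p"
  obtain s where s: "s > 0" "\<And>y. y \<in> ?K \<Longrightarrow> s \<le> infdist y M"
    using compact_infdist_lower_bound[OF M compact_path_image[OF p(1)] p(2)] by blast
  have "s \<le> T" using s(2)[of "pathstart p"] T(2)[of "pathstart p"] by force
  obtain t where t: "T < t" "t < r" using dense T(1) by blast
  have st: "s < t" "s / 4 > 0" using \<open>s \<le> T\<close> t s by auto
  obtain F where F:
      "homotopic_with_canon (\<lambda>g. \<forall>x. infdist x M \<le> infdist (g x) M) UNIV UNIV id F"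
      "\<And>K. connected K \<Longrightarrow> \<forall>x\<in>K. s \<le> infdist x M \<Longrightarrow>
         (\<forall>x\<in>K. t < infdist (F x) M) \<or>
         (\<exists>z. s / 2 \<le> infdist z M \<and> infdist z M \<le> t + s / 4 \<and> F ` K \<subseteq> cball z (s / 4))"
    by (rule connected_push_or_trap[OF n M dist s(1) st(1) t(2) st(2) that])
  have "\<not> (\<forall>x\<in>?K. t < infdist (F x) M)"
    using T(2)[of "F (pathstart p)"] t(1) pathstart_in_path_image[of p] by force
  then obtain z where z: "s / 2 \<le> infdist z M" "F ` ?K \<subseteq> cball z (s / 4)"
    using F(2)[OF connected_path_image[OF p(1)]] s(2) by blast
  have contF: "continuous_on UNIV F" using homotopic_with_imp_continuous[OF F(1)] by blast
  have ball: "cball z (s / 4) \<subseteq> - M"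
  proof
    fix y assume "y \<in> cball z (s / 4)"
    then have "infdist y M > 0" using infdist_triangle[of z M y] z(1) s(1) by (auto simp: dist_commute)
    then show "y \<in> - M" by auto
  qed
  have pF: "path (F \<circ> p)" "pathfinish (F \<circ> p) = pathstart (F \<circ> p)" "path_image (F \<circ> p) \<subseteq> cball z (s / 4)"
    using p z(2) contF
    by (auto simp: path_continuous_image continuous_on_subset pathfinish_compose pathstart_compose path_image_compose)
  have "homotopic_loops (- M) p (F \<circ> p)"
  proof (rule homotopic_loops_along_homotopy[OF F(1) p(1,3)])
    fix g x assume "\<forall>x. infdist x M \<le> infdist (g x) M" "x \<in> ?K"
    then have "0 < infdist (g x) M" using s by (meson less_le_trans)
    then show "g x \<in> - M" by auto
  qed
  moreover have "homotopic_loops (- M) (F \<circ> p) (linepath z z)"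
  proof (rule homotopic_loops_linear)
    fix \<tau> :: real assume "\<tau> \<in> {0..1}"
    then have "(F \<circ> p) \<tau> \<in> path_image (F \<circ> p)" unfolding path_image_def by blast
    then have "(F \<circ> p) \<tau> \<in> cball z (s / 4)" using pF(3) by blast
    then have "closed_segment ((F \<circ> p) \<tau>) z \<subseteq> cball z (s / 4)"
      using s(1) by (intro closed_segment_subset convex_cball) auto
    then show "closed_segment ((F \<circ> p) \<tau>) (linepath z z \<tau>) \<subseteq> - M" using ball by (auto simp: linepath_refl)
  qed (use pF in auto)
  ultimately show ?thesis using homotopic_loops_trans by blast
qed

section \<open>Pushing up and down when no peak is in the way\<close>

text \<open>In the absence of peaks, the iterated upward step lifts everything above \<open>t\<close>, but not much
  higher: the last bound keeps a peripheral loop close to \<open>M\<close>.\<close>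

lemma push_up:
  fixes M :: "'a::euclidean_space set"
  assumes n: "DIM('a) \<ge> 3" and M: "closed M" "M \<noteq> {}" "path_connected (- M)"
    and dist: "local_distortion M r < ennreal (distortion_bound DIM('a))"
    and st: "0 < s" "t < r" and b: "t < infdist b M" and "e > 0" "t > 0"
  obtains F where
    "homotopic_with_canon (\<lambda>g. \<forall>x. infdist x M \<le> infdist (g x) M) UNIV UNIV id F"
    "\<And>x. s \<le> infdist x M \<Longrightarrow> t < infdist (F x) M"
    "\<And>x. infdist (F x) M \<le> max (infdist x M) (t + e)"
proof -
  obtain T where T: "t < T" "T < r" "T < infdist b M"
    using dense[of t "min r (infdist b M)"] st b by auto
  define s' where "s' = min (s / 2) t"
  have s': "0 < s'" "s' \<le> T" "s' \<le> s / 2" using st \<open>t > 0\<close> T unfolding s'_def by linarith+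
  obtain c \<epsilon> where c: "c > 0" "\<epsilon> > 0"
    "\<And>x. s' \<le> infdist x M \<Longrightarrow> infdist x M \<le> T \<Longrightarrow> steep M c \<epsilon> x"
    using uniformly_steep[OF n M dist s'(1,2) T(2,3)] by blast
  define \<eta> where "\<eta> = min e (min (s / 2) (T - t))"
  have \<eta>: "\<eta> > 0" "\<eta> \<le> e" "\<eta> \<le> s / 2" "\<eta> \<le> T - t" using st \<open>e > 0\<close> T unfolding \<eta>_def by linarith+
  obtain f \<kappa> where f: "\<kappa> > 0" "continuous_on UNIV f"
    "\<And>x \<tau>. \<tau> \<in> {0..1} \<Longrightarrow> infdist x M \<le> infdist (x + \<tau> *\<^sub>R (f x - x)) M"
    "\<And>x. infdist x M \<le> t \<Longrightarrow> \<forall>y. dist y x < \<eta> \<longrightarrow> steep M c \<epsilon> y \<Longrightarrow> infdist x M + \<kappa> \<le> infdist (f x) M"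
    "\<And>x. infdist (f x) M \<le> max (infdist x M) (t + \<eta>)"
    by (rule ascending_step[OF M(1,2) c(1,2) \<eta>(1) \<open>t > 0\<close> that])
  have mono: "infdist x M \<le> infdist (f x) M" for x using f(3)[of 1 x] by simp
  have rise: "infdist x M + \<kappa> \<le> infdist (f x) M" if x: "s \<le> infdist x M" "infdist x M \<le> t" for x
  proof (rule f(4)[OF x(2)], intro allI impI)
    fix y assume "dist y x < \<eta>"
    then show "steep M c \<epsilon> y"
      using infdist_triangle[of y M x] infdist_triangle[of x M y] x \<eta> s' st
      by (intro c(3)) (auto simp: dist_commute)
  qed
  have orbit: "t < infdist ((f ^^ k) x) M \<or> real k * \<kappa> \<le> infdist ((f ^^ k) x) M" if "s \<le> infdist x M" for x k
  proof (induction k)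
    case (Suc k)
    have "s \<le> infdist ((f ^^ k) x) M" using funpow_infdist_mono[of M f, OF mono, of x k] that by linarith
    then show ?case
      using Suc mono[of "(f ^^ k) x"] rise[of "(f ^^ k) x"]
      by (cases "t < infdist ((f ^^ k) x) M") (auto simp: algebra_simps)
  qed (simp add: infdist_nonneg)
  obtain N :: nat where "t / \<kappa> < real N" using reals_Archimedean2 by blast
  then have N: "t < real N * \<kappa>" using f(1) by (simp add: field_simps)
  show thesis
  proof (rule that[of "f ^^ N"])
    show "homotopic_with_canon (\<lambda>g. \<forall>x. infdist x M \<le> infdist (g x) M) UNIV UNIV id (f ^^ N)"
      using f(3) by (intro homotopic_id_iterate[OF f(2)]) auto
    show "t < infdist ((f ^^ N) x) M" if "s \<le> infdist x M" for x using orbit[OF that, of N] N by linarith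
    have "infdist ((f ^^ k) x) M \<le> max (infdist x M) (t + \<eta>)" for x k
    proof (induction k)
      case (Suc k)
      then show ?case using f(5)[of "(f ^^ k) x"] by simp
    qed simp
    then show "infdist ((f ^^ N) x) M \<le> max (infdist x M) (t + e)" for x
      using \<eta>(2) by (meson add_left_mono max.mono order_refl order_trans)
  qed
qed

lemma push_down:
  fixes M :: "'a::euclidean_space set"
  assumes n: "DIM('a) \<ge> 3" and M: "closed M" "M \<noteq> {}" "path_connected (- M)"
    and dist: "local_distortion M r < ennreal (distortion_bound DIM('a))"
    and st: "0 < s" "t < r" and b: "t < infdist b M" and "t > 0"
  obtains G where
    "homotopic_with_canon (\<lambda>g. \<forall>x. 0 < infdist x M \<longrightarrow> 0 < infdist (g x) M) UNIV UNIV id G"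
    "\<And>x. infdist x M \<le> t \<Longrightarrow> infdist (G x) M < s"
proof -
  obtain T where T: "t < T" "T < r" "T < infdist b M"
    using dense[of t "min r (infdist b M)"] st b by auto
  define s' where "s' = min (s / 3) (t / 2)"
  have s': "0 < s'" "s' \<le> T" "s' < T" "s' \<le> s / 3" using st \<open>t > 0\<close> T unfolding s'_def by linarith+
  obtain c \<epsilon> where c: "c > 0" "\<epsilon> > 0"
    "\<And>x. s' \<le> infdist x M \<Longrightarrow> infdist x M \<le> T \<Longrightarrow> steep M c \<epsilon> x"
    using uniformly_steep[OF n M dist s'(1,2) T(2,3)] by blast
  define e where "e = min (s / 3) (T - t)"
  have e: "e > 0" "e \<le> s / 3" "e \<le> T - t" using st T unfolding e_def by linarith+
  obtain f \<kappa> where f: "\<kappa> > 0" "continuous_on UNIV f"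
    "\<And>x \<tau>. \<tau> \<in> {0..1} \<Longrightarrow> 0 < infdist x M \<Longrightarrow> 0 < infdist (x + \<tau> *\<^sub>R (f x - x)) M"
    "\<And>x. infdist (f x) M \<le> infdist x M"
    "\<And>x. s' + e \<le> infdist x M \<Longrightarrow> infdist x M \<le> T - e \<Longrightarrow> infdist (f x) M \<le> infdist x M - \<kappa>"
    by (rule descending_step[OF M(1,2) c(1,2) e(1) s'(1,3) c(3) that])
  have orbit: "infdist ((f ^^ k) x) M \<le> t \<and> (infdist ((f ^^ k) x) M < s \<or> infdist ((f ^^ k) x) M \<le> t - real k * \<kappa>)"
    if "infdist x M \<le> t" for x k
  proof (induction k)
    case 0
    then show ?case using that by simp
  next
    case (Suc k)
    let ?y = "(f ^^ k) x"
    show ?case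
    proof (cases "infdist ?y M < s")
      case True
      then show ?thesis using Suc f(4)[of ?y] by auto
    next
      case False
      then have "infdist (f ?y) M \<le> infdist ?y M - \<kappa>" using Suc e s' by (intro f(5)) auto
      then show ?thesis using Suc f(4)[of ?y] False by (auto simp: algebra_simps)
    qed
  qed
  obtain N :: nat where "t / \<kappa> < real N" using reals_Archimedean2 by blast
  then have N: "t < real N * \<kappa>" using f(1) by (simp add: field_simps)
  show thesis
  proof (rule that[of "f ^^ N"])
    show "homotopic_with_canon (\<lambda>g. \<forall>x. 0 < infdist x M \<longrightarrow> 0 < infdist (g x) M) UNIV UNIV id (f ^^ N)"
      using f(3) by (intro homotopic_id_iterate[OF f(2)]) auto
    show "infdist ((f ^^ N) x) M < s" if "infdist x M \<le> t" for x
      using orbit[OF that, of N] N infdist_nonneg[of "(f ^^ N) x" M] by linarith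
  qed
qed

section \<open>Loops and isomorphisms of fundamental groups\<close>

definition loop_at :: "'a::topological_space set \<Rightarrow> 'a \<Rightarrow> (real \<Rightarrow> 'a) \<Rightarrow> bool" where
  "loop_at S a p \<longleftrightarrow> path p \<and> path_image p \<subseteq> S \<and> pathstart p = a \<and> pathfinish p = a"

lemma loop_at_join: "loop_at S a p \<Longrightarrow> loop_at S a q \<Longrightarrow> loop_at S a (p +++ q)"
  by (auto simp: loop_at_def path_image_join)

lemma carrier_fundamental_group_loop_at:
  "carrier (fundamental_group S a) = {Collect (homotopic_paths S p) | p. loop_at S a p}"
  by (auto simp: fundamental_group_def loop_at_def)

lemma mult_fundamental_group_loop_at:
  assumes "loop_at S a p" "loop_at S a q"
  shows "Collect (homotopic_paths S p) \<otimes>\<^bsub>fundamental_group S a\<^esub> Collect (homotopic_paths S q) =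
    Collect (homotopic_paths S (p +++ q))"
  using assms by (intro mult_fundamental_group) (auto simp: loop_at_def)

lemma homotopic_paths_class_eq_iff:
  assumes "loop_at S a p" "loop_at S a q"
  shows "Collect (homotopic_paths S p) = Collect (homotopic_paths S q) \<longleftrightarrow> homotopic_paths S p q"
proof
  assume eq: "Collect (homotopic_paths S p) = Collect (homotopic_paths S q)"
  have "q \<in> Collect (homotopic_paths S q)" using assms(2) by (simp add: loop_at_def)
  then show "homotopic_paths S p q" unfolding eq[symmetric] by simp
qed (rule homotopic_paths_class_eq)

lemma null_homotopic_loop_iff:
  assumes "loop_at S a p"
  shows "homotopic_paths S p (linepath a a) \<longleftrightarrow> (\<exists>z. homotopic_loops S p (linepath z z))"
proof
  assume "homotopic_paths S p (linepath a a)"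
  then have "homotopic_loops S p (linepath a a)"
    using assms by (intro homotopic_paths_imp_homotopic_loops) (auto simp: loop_at_def)
  then show "\<exists>z. homotopic_loops S p (linepath z z)" ..
next
  assume "\<exists>z. homotopic_loops S p (linepath z z)"
  then show "homotopic_paths S p (linepath a a)"
    using assms homotopic_loops_imp_homotopic_paths_null by (auto simp: loop_at_def)
qed

text \<open>Both inclusions of subsets and changes of the base point are described by a map \<open>\<Phi>\<close> on loops;
  this turns the conditions on \<open>\<Phi>\<close> into an isomorphism that acts on classes by \<open>\<Phi>\<close>.\<close>

lemma iso_induced_by_loop_map:
  fixes S :: "'a::real_normed_vector set" and T :: "'b::real_normed_vector set"
  assumes ab: "a \<in> S" "b \<in> T"
    and loop: "\<And>p. loop_at S a p \<Longrightarrow> loop_at T b (\<Phi> p)"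
    and htpy: "\<And>p q. loop_at S a p \<Longrightarrow> homotopic_paths S p q \<Longrightarrow> homotopic_paths T (\<Phi> p) (\<Phi> q)"
    and mult: "\<And>p q. loop_at S a p \<Longrightarrow> loop_at S a q \<Longrightarrow> homotopic_paths T (\<Phi> (p +++ q)) (\<Phi> p +++ \<Phi> q)"
    and surj: "\<And>q. loop_at T b q \<Longrightarrow> \<exists>p. loop_at S a p \<and> homotopic_paths T (\<Phi> p) q"
    and inj: "\<And>p. loop_at S a p \<Longrightarrow> homotopic_paths T (\<Phi> p) (linepath b b) \<Longrightarrow> homotopic_paths S p (linepath a a)"
  shows "\<exists>j \<in> iso (fundamental_group S a) (fundamental_group T b).
    \<forall>p. loop_at S a p \<longrightarrow> j (Collect (homotopic_paths S p)) = Collect (homotopic_paths T (\<Phi> p))"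
proof -
  let ?G = "fundamental_group S a" and ?H = "fundamental_group T b"
  define j where "j C = Collect (homotopic_paths T (\<Phi> (SOME p. loop_at S a p \<and> C = Collect (homotopic_paths S p))))" for C
  have j: "j (Collect (homotopic_paths S p)) = Collect (homotopic_paths T (\<Phi> p))" if p: "loop_at S a p" for p
  proof -
    define q where "q = (SOME q. loop_at S a q \<and> Collect (homotopic_paths S p) = Collect (homotopic_paths S q))"
    have "\<exists>q. loop_at S a q \<and> Collect (homotopic_paths S p) = Collect (homotopic_paths S q)" using p by blast
    then have q: "loop_at S a q" "Collect (homotopic_paths S p) = Collect (homotopic_paths S q)"
      using someI_ex[of "\<lambda>q. loop_at S a q \<and> Collect (homotopic_paths S p) = Collect (homotopic_paths S q)"]
      unfolding q_def by blast+
    have "homotopic_paths S p q" using q homotopic_paths_class_eq_iff[OF p q(1)] by blast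
    then have "homotopic_paths T (\<Phi> p) (\<Phi> q)" by (rule htpy[OF p])
    then show ?thesis unfolding j_def q_def[symmetric] by (metis homotopic_paths_class_eq)
  qed
  have one: "\<one>\<^bsub>?G\<^esub> = Collect (homotopic_paths S (linepath a a))" "\<one>\<^bsub>?H\<^esub> = Collect (homotopic_paths T (linepath b b))"
    by (simp_all add: fundamental_group_def)
  have triv: "loop_at S a (linepath a a)" "loop_at T b (linepath b b)" using ab by (auto simp: loop_at_def)
  interpret G: group ?G by (rule group_fundamental_group) fact
  interpret H: group ?H by (rule group_fundamental_group) fact
  have hom: "j \<in> hom ?G ?H"
  proof (rule homI)
    show "j C \<in> carrier ?H" if "C \<in> carrier ?G" for C
      using that loop j unfolding carrier_fundamental_group_loop_at by fastforce
    fix C D assume "C \<in> carrier ?G" "D \<in> carrier ?G"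
    then obtain p q where p: "loop_at S a p" "C = Collect (homotopic_paths S p)"
      and q: "loop_at S a q" "D = Collect (homotopic_paths S q)"
      unfolding carrier_fundamental_group_loop_at by blast
    show "j (C \<otimes>\<^bsub>?G\<^esub> D) = j C \<otimes>\<^bsub>?H\<^esub> j D"
      unfolding p(2) q(2) mult_fundamental_group_loop_at[OF p(1) q(1)] j[OF p(1)] j[OF q(1)]
        j[OF loop_at_join[OF p(1) q(1)]] mult_fundamental_group_loop_at[OF loop[OF p(1)] loop[OF q(1)]]
      by (rule homotopic_paths_class_eq[OF mult[OF p(1) q(1)]])
  qed
  interpret J: group_hom ?G ?H j by unfold_locales (rule hom)
  have "inj_on j (carrier ?G)"
  proof (rule J.trivial_ker_imp_inj)
    have "C = \<one>\<^bsub>?G\<^esub>" if "C \<in> carrier ?G" "j C = \<one>\<^bsub>?H\<^esub>" for C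
    proof -
      obtain p where p: "loop_at S a p" "C = Collect (homotopic_paths S p)"
        using \<open>C \<in> carrier ?G\<close> unfolding carrier_fundamental_group_loop_at by blast
      have "homotopic_paths T (\<Phi> p) (linepath b b)"
        using that(2) homotopic_paths_class_eq_iff[OF loop[OF p(1)] triv(2)] unfolding p(2) j[OF p(1)] one by blast
      then show ?thesis unfolding p(2) one by (rule homotopic_paths_class_eq[OF inj[OF p(1)]])
    qed
    then show "kernel ?G ?H j = {\<one>\<^bsub>?G\<^esub>}" by (auto simp: kernel_def)
  qed
  moreover have "j ` carrier ?G = carrier ?H"
  proof
    show "j ` carrier ?G \<subseteq> carrier ?H" using hom by (auto simp: hom_def)
    show "carrier ?H \<subseteq> j ` carrier ?G"
    proof
      fix D assume "D \<in> carrier ?H"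
      then obtain q where q: "loop_at T b q" "D = Collect (homotopic_paths T q)"
        unfolding carrier_fundamental_group_loop_at by blast
      obtain p where p: "loop_at S a p" "homotopic_paths T (\<Phi> p) q" using surj[OF q(1)] by blast
      have "D = j (Collect (homotopic_paths S p))"
        unfolding q(2) j[OF p(1)] by (rule homotopic_paths_class_eq[OF p(2), symmetric])
      then show "D \<in> j ` carrier ?G" using p(1) unfolding carrier_fundamental_group_loop_at by blast
    qed
  qed
  ultimately have "j \<in> iso ?G ?H" using hom by (simp add: iso_def bij_betw_def)
  then show ?thesis using j by blast
qed

lemma iso_inclusion:
  fixes S U :: "'a::real_normed_vector set"
  assumes "U \<subseteq> S" "b \<in> U"
    and surj: "\<And>q. loop_at S b q \<Longrightarrow> \<exists>p. loop_at U b p \<and> homotopic_paths S p q"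
    and inj: "\<And>p. loop_at U b p \<Longrightarrow> homotopic_paths S p (linepath b b) \<Longrightarrow> homotopic_paths U p (linepath b b)"
  shows "\<exists>j \<in> iso (fundamental_group U b) (fundamental_group S b).
    \<forall>p. loop_at U b p \<longrightarrow> j (Collect (homotopic_paths U p)) = Collect (homotopic_paths S p)"
proof -
  have sub: "loop_at S b p" if "loop_at U b p" for p using that assms(1) by (auto simp: loop_at_def)
  show ?thesis
  proof (rule iso_induced_by_loop_map[of b U b S "\<lambda>p. p"])
    show "homotopic_paths S (p +++ q) (p +++ q)" if "loop_at U b p" "loop_at U b q" for p q
      using sub[OF loop_at_join[OF that]] by (simp add: loop_at_def)
  qed (use assms sub homotopic_paths_subset in auto)
qed

lemma homotopic_paths_cancel_left:
  fixes \<sigma> x :: "real \<Rightarrow> 'a::real_normed_vector"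
  assumes "path \<sigma>" "path_image \<sigma> \<subseteq> S" "path x" "path_image x \<subseteq> S" "pathstart x = pathstart \<sigma>"
  shows "homotopic_paths S (\<sigma> +++ (reversepath \<sigma> +++ x)) x"
proof -
  have "homotopic_paths S (\<sigma> +++ (reversepath \<sigma> +++ x)) ((\<sigma> +++ reversepath \<sigma>) +++ x)"
    using assms by (intro homotopic_paths_assoc) auto
  also have "homotopic_paths S \<dots> (linepath (pathstart \<sigma>) (pathstart \<sigma>) +++ x)"
    using assms by (intro homotopic_paths_join homotopic_paths_rinv) auto
  also have "homotopic_paths S \<dots> x"
    using assms by (intro homotopic_paths_lid') auto
  finally show ?thesis .
qed

lemma iso_change_of_base_point:
  fixes S :: "'a::real_normed_vector set"
  assumes \<sigma>: "path \<sigma>" "path_image \<sigma> \<subseteq> S" "pathstart \<sigma> = a" "pathfinish \<sigma> = b"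
  shows "\<exists>j \<in> iso (fundamental_group S a) (fundamental_group S b).
    \<forall>p. loop_at S a p \<longrightarrow>
      j (Collect (homotopic_paths S p)) = Collect (homotopic_paths S (reversepath \<sigma> +++ (p +++ \<sigma>)))"
proof (rule iso_induced_by_loop_map)
  let ?\<Phi> = "\<lambda>p. reversepath \<sigma> +++ (p +++ \<sigma>)"
  show "a \<in> S" "b \<in> S" using \<sigma> by auto
  show loop: "loop_at S b (?\<Phi> p)" if "loop_at S a p" for p
    using that \<sigma> by (auto simp: loop_at_def path_image_join)
  show "homotopic_paths S (?\<Phi> p) (?\<Phi> q)" if "loop_at S a p" "homotopic_paths S p q" for p q
    using that \<sigma> by (intro homotopic_paths_join) (auto simp: loop_at_def)
  show "homotopic_paths S (?\<Phi> (p +++ q)) (?\<Phi> p +++ ?\<Phi> q)" if p: "loop_at S a p" and q: "loop_at S a q" for p q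
  proof -
    note simps = loop_at_def path_image_join
    have "homotopic_paths S (reversepath \<sigma> +++ ((p +++ q) +++ \<sigma>)) (reversepath \<sigma> +++ (p +++ (q +++ \<sigma>)))"
      using p q \<sigma> by (intro homotopic_paths_join homotopic_paths_sym[OF homotopic_paths_assoc])
        (auto simp: simps)
    also have "homotopic_paths S \<dots> (reversepath \<sigma> +++ (p +++ (\<sigma> +++ (reversepath \<sigma> +++ (q +++ \<sigma>)))))"
      using p q \<sigma> by (intro homotopic_paths_join homotopic_paths_sym[OF homotopic_paths_cancel_left])
        (auto simp: simps)
    also have "homotopic_paths S \<dots> (reversepath \<sigma> +++ ((p +++ \<sigma>) +++ (reversepath \<sigma> +++ (q +++ \<sigma>))))"
      using p q \<sigma> by (intro homotopic_paths_join homotopic_paths_assoc) (auto simp: simps)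
    also have "homotopic_paths S \<dots> (?\<Phi> p +++ ?\<Phi> q)"
      using p q \<sigma> by (intro homotopic_paths_assoc) (auto simp: simps)
    finally show ?thesis .
  qed
  show "\<exists>p. loop_at S a p \<and> homotopic_paths S (?\<Phi> p) q" if q: "loop_at S b q" for q
  proof (intro exI conjI)
    note simps = loop_at_def path_image_join
    let ?p = "\<sigma> +++ (q +++ reversepath \<sigma>)"
    show p: "loop_at S a ?p" using q \<sigma> by (auto simp: simps)
    have "homotopic_paths S (?\<Phi> ?p) (reversepath \<sigma> +++ (\<sigma> +++ ((q +++ reversepath \<sigma>) +++ \<sigma>)))"
      using q \<sigma> by (intro homotopic_paths_join homotopic_paths_sym[OF homotopic_paths_assoc]) (auto simp: simps)
    also have "homotopic_paths S \<dots> ((q +++ reversepath \<sigma>) +++ \<sigma>)"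
      using q \<sigma> homotopic_paths_cancel_left[of "reversepath \<sigma>" S "(q +++ reversepath \<sigma>) +++ \<sigma>"] by (auto simp: simps)
    also have "homotopic_paths S \<dots> (q +++ (reversepath \<sigma> +++ \<sigma>))"
      using q \<sigma> by (intro homotopic_paths_sym[OF homotopic_paths_assoc]) (auto simp: simps)
    also have "homotopic_paths S \<dots> (q +++ linepath b b)"
      using q \<sigma> homotopic_paths_linv[of \<sigma> S] by (intro homotopic_paths_join) (auto simp: simps)
    also have "homotopic_paths S \<dots> q"
      using q by (intro homotopic_paths_rid') (auto simp: simps)
    finally show "homotopic_paths S (?\<Phi> ?p) q" .
  qed
  show "homotopic_paths S p (linepath a a)" if p: "loop_at S a p" and null: "homotopic_paths S (?\<Phi> p) (linepath b b)" for p
  proof -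
    obtain z where "homotopic_loops S (?\<Phi> p) (linepath z z)"
      using null null_homotopic_loop_iff[OF loop[OF p]] by blast
    moreover have "homotopic_loops S (?\<Phi> p) p"
      using homotopic_loops_conjugate[of "reversepath \<sigma>" p S] p \<sigma> by (simp add: loop_at_def)
    ultimately show ?thesis
      using null_homotopic_loop_iff[OF p] homotopic_loops_trans homotopic_loops_sym by blast
  qed
qed

text \<open>In the unit square, the left edge is homotopic to the other three edges together. The homotopy
  maps the former to \<open>p\<close> and the latter to the conjugate of its final loop by the track of the base
  point.\<close>

lemma homotopic_paths_conjugate_along_homotopy:
  fixes h :: "real \<times> 'a::topological_space \<Rightarrow> 'a"
  assumes h: "continuous_on ({0..1} \<times> UNIV) h" "\<And>x. h (0, x) = x"
    and p: "path p" "pathstart p = b" "pathfinish p = b"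
    and S: "\<And>\<tau> x. \<tau> \<in> {0..1} \<Longrightarrow> x \<in> path_image p \<Longrightarrow> h (\<tau>, x) \<in> S"
  shows "homotopic_paths S p ((\<lambda>\<tau>. h (\<tau>, b)) +++ ((\<lambda>x. h (1, x)) \<circ> p) +++ reversepath (\<lambda>\<tau>. h (\<tau>, b)))"
proof -
  let ?Q = "{0..1::real} \<times> {0..1::real}"
  define k where "k z = h (fst z, p (snd z))" for z :: "real \<times> real"
  have "continuous_on ?Q (\<lambda>z. p (snd z))"
    by (rule continuous_on_compose2[OF p(1)[unfolded path_def]]) (auto intro!: continuous_intros)
  then have "continuous_on ?Q (\<lambda>z. (fst z, p (snd z)))"
    by (intro continuous_on_Pair continuous_on_fst continuous_on_id)
  then have k: "continuous_on ?Q k"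
    unfolding k_def by (rule continuous_on_compose2[OF h(1)]) auto
  have kS: "k \<in> ?Q \<rightarrow> S" using S by (auto simp: k_def path_image_def)
  let ?l = "linepath (0::real, 0::real) (0, 1)"
  let ?m = "linepath (0::real, 0::real) (1, 0) +++ linepath (1, 0) (1, 1) +++ linepath (1, 1) (0, 1)"
  have cv: "convex ?Q" by (intro convex_Times) auto
  have seg: "closed_segment u v \<subseteq> ?Q" if "u \<in> ?Q" "v \<in> ?Q" for u v
    using that cv by (rule closed_segment_subset)
  have "path_image ?l \<subseteq> ?Q" unfolding path_image_linepath by (intro seg) auto
  moreover have "path_image ?m = closed_segment (0, 0) (1, 0) \<union> (closed_segment (1, 0) (1, 1) \<union> closed_segment (1, 1) (0, 1))"
    by (simp only: path_image_join path_image_linepath pathstart_join pathstart_linepath pathfinish_linepath)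
  moreover have "\<dots> \<subseteq> ?Q" by (intro Un_least seg) auto
  ultimately have img: "path_image ?l \<subseteq> ?Q" "path_image ?m \<subseteq> ?Q" by simp_all
  have "homotopic_paths ?Q ?l ?m"
  proof (rule homotopic_paths_linear)
    fix t :: real assume "t \<in> {0..1}"
    then have "?l t \<in> ?Q" "?m t \<in> ?Q" using img unfolding path_image_def by blast+
    then show "closed_segment (?l t) (?m t) \<subseteq> ?Q" using cv by (rule closed_segment_subset)
  qed auto
  then have "homotopic_paths S (k \<circ> ?l) (k \<circ> ?m)"
    using k kS by (rule homotopic_paths_continuous_image)
  moreover have "k \<circ> ?l = p" by (auto simp: k_def linepath_def h(2))
  moreover have "k \<circ> ?m = (k \<circ> linepath (0, 0) (1, 0)) +++ (k \<circ> linepath (1, 0) (1, 1)) +++ (k \<circ> linepath (1, 1) (0, 1))"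
    by (simp add: path_compose_join)
  moreover have "k \<circ> linepath (0, 0) (1, 0) = (\<lambda>\<tau>. h (\<tau>, b))"
    using p(2) by (auto simp: k_def linepath_def pathstart_def)
  moreover have "k \<circ> linepath (1, 0) (1, 1) = (\<lambda>x. h (1, x)) \<circ> p"
    by (auto simp: k_def linepath_def)
  moreover have "k \<circ> linepath (1, 1) (0, 1) = reversepath (\<lambda>\<tau>. h (\<tau>, b))"
    using p(3) by (auto simp: k_def linepath_def pathfinish_def reversepath_def)
  ultimately show ?thesis by simp
qed

text \<open>A homotopy takes place in a compact set, which has positive distance from \<open>M\<close>. This is why
  deformations defined only at heights above some \<open>s > 0\<close> suffice.\<close>

lemma homotopic_loops_compact_support:
  fixes p q :: "real \<Rightarrow> 'a::t2_space"
  assumes "homotopic_loops S p q"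
  obtains K where "compact K" "K \<subseteq> S" "homotopic_loops K p q"
proof -
  let ?Q = "{0..1::real} \<times> {0..1::real}"
  obtain h where h: "continuous_on ?Q h" "h \<in> ?Q \<rightarrow> S" "\<forall>x\<in>{0..1}. h (0, x) = p x"
    "\<forall>x\<in>{0..1}. h (1, x) = q x" "\<forall>t\<in>{0..1}. pathfinish (h \<circ> Pair t) = pathstart (h \<circ> Pair t)"
    using assms unfolding homotopic_loops by blast
  have "compact (h ` ?Q)" by (intro compact_continuous_image h compact_Times) auto
  moreover have "h ` ?Q \<subseteq> S" using h(2) by auto
  moreover have "homotopic_loops (h ` ?Q) p q"
    unfolding homotopic_loops using h by (intro exI[of _ h]) auto
  ultimately show ?thesis by (rule that)
qed

text \<open>This depends on the free homotopy class only, so it passes between base points and to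
  homotopic loops.\<close>

definition freely_peripheral :: "'a::metric_space set \<Rightarrow> (real \<Rightarrow> 'a) \<Rightarrow> bool" where
  "freely_peripheral M p \<longleftrightarrow> (\<forall>\<epsilon>>0. \<exists>c. homotopic_loops (- M) p c \<and>
      path_image c \<subseteq> {x. 0 < infdist x M \<and> infdist x M < \<epsilon>})"

lemma freely_peripheral_homotopic_loops:
  "homotopic_loops (- M) p q \<Longrightarrow> freely_peripheral M p \<longleftrightarrow> freely_peripheral M q"
  unfolding freely_peripheral_def by (meson homotopic_loops_sym homotopic_loops_trans)

lemma peripheral_subgroup_iff:
  assumes "loop_at (- M) a p"
  shows "Collect (homotopic_paths (- M) p) \<in> peripheral_subgroup M a \<longleftrightarrow> freely_peripheral M p"
proof -
  have free: "homotopic_loops (- M) p q" if "homotopic_paths (- M) p q" for q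
    using that assms homotopic_paths_imp_pathfinish[OF that]
    by (intro homotopic_paths_imp_homotopic_loops) (auto simp: loop_at_def)
  have "p \<in> Collect (homotopic_paths (- M) p)" using assms by (simp add: loop_at_def)
  moreover have "Collect (homotopic_paths (- M) p) \<in> carrier (fundamental_group (- M) a)"
    using assms unfolding carrier_fundamental_group_loop_at by blast
  ultimately show ?thesis
    unfolding peripheral_subgroup_def freely_peripheral_def using free homotopic_loops_trans by blast
qed

section \<open>Loops in the complement of a set of small distortion\<close>

locale small_distortion_complement =
  fixes M :: "'a::euclidean_space set" and r :: real
  assumes dim: "DIM('a) \<ge> 3" and closed: "closed M" and nonempty: "M \<noteq> {}"
    and connected_complement: "path_connected (- M)"
    and distortion: "local_distortion M r < ennreal (distortion_bound DIM('a))"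
begin

definition above :: "real \<Rightarrow> 'a set" where
  "above t = {x. t < infdist x M}"

lemma above_subset: "0 \<le> t \<Longrightarrow> above t \<subseteq> - M"
  by (auto simp: above_def)

lemma compl_iff: "x \<in> - M \<longleftrightarrow> 0 < infdist x M"
  using closed nonempty in_closed_iff_infdist_zero[of M x] infdist_nonneg[of x M] by force

text \<open>The base point is already above the level \<open>t\<close> and only moves up. So its track stays there, and
  the deformed loop conjugated by the track is a loop at the original base point.\<close>

lemma loop_deforms_into_above:
  assumes t: "0 < t" "t < r" "t < infdist b M" and p: "loop_at (- M) b p"
  shows "\<exists>q. loop_at (above t) b q \<and> homotopic_paths (- M) q p"
proof -
  have pp: "path p" "path_image p \<subseteq> - M" "pathstart p = b" "pathfinish p = b"
    using p by (auto simp: loop_at_def)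
  obtain s where s: "s > 0" "\<And>x. x \<in> path_image p \<Longrightarrow> s \<le> infdist x M"
    using compact_infdist_lower_bound[OF closed nonempty compact_path_image[OF pp(1)] pp(2)] by blast
  obtain F where F: "homotopic_with_canon (\<lambda>g. \<forall>x. infdist x M \<le> infdist (g x) M) UNIV UNIV id F"
    "\<And>x. s \<le> infdist x M \<Longrightarrow> t < infdist (F x) M"
    "\<And>x. infdist (F x) M \<le> max (infdist x M) (t + 1)"
    by (rule push_up[OF dim closed nonempty connected_complement distortion s(1) t(2,3) zero_less_one t(1) that])
  obtain h :: "real \<times> 'a \<Rightarrow> 'a" where h: "continuous_on ({0..1} \<times> UNIV) h" "\<forall>x. h (0, x) = x" "\<forall>x. h (1, x) = F x"
    "\<forall>\<tau>\<in>{0..1}. \<forall>x. infdist x M \<le> infdist (h (\<tau>, x)) M"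
    using homotopic_id_imp_homotopy[OF F(1)] by blast
  let ?\<sigma> = "\<lambda>\<tau>. h (\<tau>, b)"
  let ?q = "?\<sigma> +++ (F \<circ> p) +++ reversepath ?\<sigma>"
  have Fh: "(\<lambda>x. h (1, x)) = F" using h(3) by auto
  have hom: "homotopic_paths (- M) p ?q"
    unfolding Fh[symmetric]
  proof (rule homotopic_paths_conjugate_along_homotopy[OF h(1) _ pp(1,3,4)])
    show "h (0, x) = x" for x using h(2) by simp
    show "h (\<tau>, x) \<in> - M" if "\<tau> \<in> {0..1}" "x \<in> path_image p" for \<tau> x
      using h(4) that s unfolding compl_iff by (meson less_le_trans)
  qed
  have \<sigma>: "path ?\<sigma>" unfolding path_def
    by (rule continuous_on_compose2[OF h(1)]) (auto intro!: continuous_intros)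
  have \<sigma>': "pathstart ?\<sigma> = b" "pathfinish ?\<sigma> = F b" using h(2,3) by (auto simp: pathstart_def pathfinish_def)
  have "path_image ?\<sigma> \<subseteq> above t"
    using h(4) t(3) by (auto simp: path_image_def above_def intro: less_le_trans)
  moreover have "path_image (F \<circ> p) \<subseteq> above t"
    using F(2) s(2) by (auto simp: path_image_compose above_def)
  ultimately have "path_image ?q \<subseteq> above t"
    using \<sigma>' pp by (simp add: path_image_join pathstart_compose pathfinish_compose)
  moreover have "path ?q" "pathstart ?q = b" "pathfinish ?q = b"
    using homotopic_paths_imp_path[OF hom] \<sigma>' by auto
  ultimately show ?thesis using homotopic_paths_sym[OF hom] by (auto simp: loop_at_def)
qed

text \<open>Deforming a whole free homotopy upwards moves it above \<open>t\<close>, and the loop \<open>p\<close>, which was there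
  before, is homotopic to its image without descending.\<close>

lemma free_homotopy_deforms_into_above:
  assumes t: "0 < t" "t < r" "t < infdist b M" and "e > 0"
    and p: "path_image p \<subseteq> above t" and c: "homotopic_loops (- M) p c"
  obtains F where "homotopic_loops (above t) p (F \<circ> c)"
    "\<And>x. infdist (F x) M \<le> max (infdist x M) (t + e)"
proof -
  obtain K where K: "compact K" "K \<subseteq> - M" "homotopic_loops K p c"
    using homotopic_loops_compact_support[OF c] by metis
  obtain s where s: "s > 0" "\<And>x. x \<in> K \<Longrightarrow> s \<le> infdist x M"
    using compact_infdist_lower_bound[OF closed nonempty K(1,2)] by blast
  obtain F where F: "homotopic_with_canon (\<lambda>g. \<forall>x. infdist x M \<le> infdist (g x) M) UNIV UNIV id F"
    "\<And>x. s \<le> infdist x M \<Longrightarrow> t < infdist (F x) M"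
    "\<And>x. infdist (F x) M \<le> max (infdist x M) (t + e)"
    by (rule push_up[OF dim closed nonempty connected_complement distortion s(1) t(2,3) \<open>e > 0\<close> t(1) that])
  have "homotopic_loops (above t) p (F \<circ> p)"
  proof (rule homotopic_loops_along_homotopy[OF F(1)])
    show "path p" "pathfinish p = pathstart p"
      using homotopic_loops_imp_path[OF c] homotopic_loops_imp_loop[OF c] by auto
    show "g x \<in> above t" if "\<forall>x. infdist x M \<le> infdist (g x) M" "x \<in> path_image p" for g x
      using that p by (auto simp: above_def intro: less_le_trans)
  qed
  moreover have "homotopic_loops (above t) (F \<circ> p) (F \<circ> c)"
  proof (rule homotopic_loops_continuous_image[OF K(3)])
    show "continuous_on K F" using homotopic_with_imp_continuous[OF F(1)] continuous_on_subset by blast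
    show "F \<in> K \<rightarrow> above t" using F(2) s(2) by (auto simp: above_def)
  qed
  ultimately show ?thesis using that F(3) homotopic_loops_trans by blast
qed

lemma null_homotopic_in_above:
  assumes t: "0 < t" "t < r" "t < infdist b M"
    and p: "path_image p \<subseteq> above t" and null: "\<exists>z. homotopic_loops (- M) p (linepath z z)"
  shows "\<exists>z. homotopic_loops (above t) p (linepath z z)"
proof -
  obtain z where z: "homotopic_loops (- M) p (linepath z z)" using null by blast
  obtain F where "homotopic_loops (above t) p (F \<circ> linepath z z)"
    using free_homotopy_deforms_into_above[OF t zero_less_one p z] by blast
  moreover have "F \<circ> linepath z z = linepath (F z) (F z)" by (auto simp: linepath_refl)
  ultimately show ?thesis by metis
qed

lemma freely_peripheral_if_near:
  assumes t: "0 < t" "t < r" "t < infdist b M"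
    and c: "path c" "pathfinish c = pathstart c" "path_image c \<subseteq> above 0" "\<And>x. x \<in> path_image c \<Longrightarrow> infdist x M \<le> t"
  shows "freely_peripheral M c"
  unfolding freely_peripheral_def
proof (intro allI impI)
  fix \<epsilon> :: real assume "\<epsilon> > 0"
  obtain G where G: "homotopic_with_canon (\<lambda>g. \<forall>x. 0 < infdist x M \<longrightarrow> 0 < infdist (g x) M) UNIV UNIV id G"
    "\<And>x. infdist x M \<le> t \<Longrightarrow> infdist (G x) M < \<epsilon>"
    by (rule push_down[OF dim closed nonempty connected_complement distortion \<open>\<epsilon> > 0\<close> t(2,3,1) that])
  have "homotopic_loops (- M) c (G \<circ> c)"
    by (rule homotopic_loops_along_homotopy[OF G(1) c(1,2)]) (use c(3) compl_iff in \<open>auto simp: above_def\<close>)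
  moreover have "path_image (G \<circ> c) \<subseteq> {x. 0 < infdist x M \<and> infdist x M < \<epsilon>}"
    using G(2) c(4) homotopic_loops_imp_subset[OF calculation] unfolding compl_iff
    by (force simp: path_image_compose subset_iff compl_iff[symmetric])
  ultimately show "\<exists>c'. homotopic_loops (- M) c c' \<and> path_image c' \<subseteq> {x. 0 < infdist x M \<and> infdist x M < \<epsilon>}" by blast
qed

text \<open>A representative below the level \<open>t\<close> is lifted to just above \<open>t\<close>, together with the homotopy to
  \<open>p\<close>.\<close>

lemma freely_peripheral_representative:
  assumes t: "0 < t" "t < r" "t < infdist b M" and "e > 0"
    and p: "path_image p \<subseteq> above t" "freely_peripheral M p"
  obtains c where "homotopic_loops (above t) p c" "\<And>x. x \<in> path_image c \<Longrightarrow> infdist x M \<le> t + e"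
proof -
  obtain c where c: "homotopic_loops (- M) p c" "path_image c \<subseteq> {x. 0 < infdist x M \<and> infdist x M < t}"
    using p(2) t(1) unfolding freely_peripheral_def by blast
  obtain F where F: "homotopic_loops (above t) p (F \<circ> c)" "\<And>x. infdist (F x) M \<le> max (infdist x M) (t + e)"
    by (rule free_homotopy_deforms_into_above[OF t \<open>e > 0\<close> p(1) c(1) that])
  have "infdist (F x) M \<le> t + e" if "x \<in> path_image c" for x
    using F(2)[of x] c(2) that \<open>e > 0\<close> by fastforce
  then show ?thesis using F(1) by (intro that[of "F \<circ> c"]) (auto simp: path_image_compose)
qed

lemma constant_loop_freely_peripheral:
  assumes "a \<in> - M"
  shows "freely_peripheral M (linepath a a)"
  unfolding freely_peripheral_def
proof (intro allI impI)
  fix \<epsilon> :: real assume "\<epsilon> > 0"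
  obtain m where "m \<in> M" using nonempty by blast
  define d where "d = min (\<epsilon> / 2) (infdist a M)"
  have d: "0 < d" "d < \<epsilon>" "d \<le> infdist a M" using \<open>\<epsilon> > 0\<close> assms compl_iff unfolding d_def by (auto simp: min_def)
  have "connected ((\<lambda>x. infdist x M) ` closed_segment a m)"
    by (intro connected_continuous_image continuous_intros) auto
  then have iv: "is_interval ((\<lambda>x. infdist x M) ` closed_segment a m)" by (simp add: is_interval_connected_1)
  have "infdist m M = 0" using \<open>m \<in> M\<close> by simp
  then have "d \<in> (\<lambda>x. infdist x M) ` closed_segment a m"
    using iv[unfolded is_interval_1] d by (metis ends_in_segment image_eqI less_imp_le)
  then obtain y where y: "infdist y M = d" by auto
  then have "y \<in> - M" using d compl_iff by simp
  then have "homotopic_loops (- M) (linepath a a) (linepath y y)"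
    using connected_complement assms unfolding path_connected_eq_homotopic_points by blast
  then show "\<exists>c. homotopic_loops (- M) (linepath a a) c \<and> path_image c \<subseteq> {x. 0 < infdist x M \<and> infdist x M < \<epsilon>}"
    using y d by (intro exI[of _ "linepath y y"]) auto
qed

lemma peripheral_iso_change_of_base_point:
  assumes "a \<in> - M" "b \<in> - M"
  shows "\<exists>j \<in> iso (fundamental_group (- M) a) (fundamental_group (- M) b).
    \<forall>C \<in> carrier (fundamental_group (- M) a). j C \<in> peripheral_subgroup M b \<longleftrightarrow> C \<in> peripheral_subgroup M a"
proof -
  obtain \<sigma> where \<sigma>: "path \<sigma>" "path_image \<sigma> \<subseteq> - M" "pathstart \<sigma> = a" "pathfinish \<sigma> = b"
    using connected_complement assms unfolding path_connected_def by blast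
  obtain j where j: "j \<in> iso (fundamental_group (- M) a) (fundamental_group (- M) b)"
    "\<And>p. loop_at (- M) a p \<Longrightarrow> j (Collect (homotopic_paths (- M) p)) =
       Collect (homotopic_paths (- M) (reversepath \<sigma> +++ (p +++ \<sigma>)))"
    using iso_change_of_base_point[OF \<sigma>] by blast
  have "j C \<in> peripheral_subgroup M b \<longleftrightarrow> C \<in> peripheral_subgroup M a"
    if C: "C \<in> carrier (fundamental_group (- M) a)" for C
  proof -
    obtain p where p: "loop_at (- M) a p" "C = Collect (homotopic_paths (- M) p)"
      using C unfolding carrier_fundamental_group_loop_at by blast
    have "loop_at (- M) b (reversepath \<sigma> +++ (p +++ \<sigma>))"
      using p(1) \<sigma> by (auto simp: loop_at_def path_image_join)
    moreover have "homotopic_loops (- M) (reversepath \<sigma> +++ (p +++ \<sigma>)) p"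
      using homotopic_loops_conjugate[of "reversepath \<sigma>" p "- M"] p \<sigma> by (simp add: loop_at_def)
    ultimately show ?thesis
      unfolding p(2) j(2)[OF p(1)] using p(1) freely_peripheral_homotopic_loops peripheral_subgroup_iff by blast
  qed
  then show ?thesis using j(1) by blast
qed

lemma trivial_if_infdist_bounded:
  assumes "T < r" "\<And>x. infdist x M \<le> T" "a \<in> - M"
  shows "carrier (fundamental_group (- M) a) = {\<one>\<^bsub>fundamental_group (- M) a\<^esub>}"
    "peripheral_subgroup M a = carrier (fundamental_group (- M) a)"
proof -
  let ?G = "fundamental_group (- M) a"
  have one: "\<one>\<^bsub>?G\<^esub> = Collect (homotopic_paths (- M) (linepath a a))" by (simp add: fundamental_group_def)
  have la: "loop_at (- M) a (linepath a a)" using assms by (auto simp: loop_at_def)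
  have "C = \<one>\<^bsub>?G\<^esub>" if C: "C \<in> carrier ?G" for C
  proof -
    obtain p where p: "loop_at (- M) a p" "C = Collect (homotopic_paths (- M) p)"
      using C unfolding carrier_fundamental_group_loop_at by blast
    have "\<exists>z. homotopic_loops (- M) p (linepath z z)"
      using p(1) null_homotopic_if_infdist_bounded[OF dim closed nonempty distortion assms(1,2)]
      by (auto simp: loop_at_def)
    then have "homotopic_paths (- M) p (linepath a a)" using null_homotopic_loop_iff[OF p(1)] by blast
    then show ?thesis unfolding p(2) one by (rule homotopic_paths_class_eq)
  qed
  moreover have "\<one>\<^bsub>?G\<^esub> \<in> carrier ?G" using la unfolding one carrier_fundamental_group_loop_at by blast
  ultimately show carr: "carrier ?G = {\<one>\<^bsub>?G\<^esub>}" by blast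
  have "\<one>\<^bsub>?G\<^esub> \<in> peripheral_subgroup M a"
    unfolding one peripheral_subgroup_iff[OF la] using constant_loop_freely_peripheral[OF assms(3)] .
  then show "peripheral_subgroup M a = carrier ?G" unfolding carr using carr by (auto simp: peripheral_subgroup_def)
qed

end

section \<open>Comparison of two sets at small Hausdorff distance\<close>

lemma hausdorff_dist_less_imp_infdist_close:
  fixes A B :: "'a::euclidean_space set"
  assumes "hausdorff_dist A B < ennreal h" "h \<ge> 0"
    and A: "closed A" "A \<noteq> {}"
  shows "infdist x B \<le> infdist x A + h"
proof -
  obtain a where a: "a \<in> A" "infdist x A = dist x a" using infdist_attains_inf[OF A] by metis
  have "(INF y\<in>B. ennreal (dist a y)) \<le> hausdorff_dist A B"
    unfolding hausdorff_dist_def using a(1) by (intro max.coboundedI1 SUP_upper)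
  then have "(INF y\<in>B. ennreal (dist a y)) < ennreal h" using assms(1) by (rule le_less_trans)
  then obtain y where y: "y \<in> B" "ennreal (dist a y) < ennreal h" unfolding INF_less_iff by blast
  then have "dist a y < h" by (simp add: ennreal_less_iff)
  moreover have "infdist x B \<le> dist x y" using y(1) by (rule infdist_le)
  ultimately show ?thesis using dist_triangle[of x y a] a(2) by linarith
qed

lemma hausdorff_dist_commute: "hausdorff_dist A B = hausdorff_dist B A"
  unfolding hausdorff_dist_def by (subst max.commute) (simp only: dist_commute)

lemma iso_restrict_to_subset:
  assumes J: "J \<in> iso G H" and P: "P \<subseteq> carrier G" "Q \<subseteq> carrier H"
    and PQ: "\<And>C. C \<in> carrier G \<Longrightarrow> J C \<in> Q \<longleftrightarrow> C \<in> P"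
  shows "J \<in> iso (G\<lparr>carrier := P\<rparr>) (H\<lparr>carrier := Q\<rparr>)"
proof -
  have hom: "J \<in> hom G H" and bij: "bij_betw J (carrier G) (carrier H)" using J by (auto simp: iso_def)
  have "J ` P = Q"
  proof
    show "J ` P \<subseteq> Q" using P PQ by blast
    show "Q \<subseteq> J ` P"
    proof
      fix D assume "D \<in> Q"
      then obtain C where "C \<in> carrier G" "D = J C" using P(2) bij unfolding bij_betw_def by blast
      then show "D \<in> J ` P" using PQ \<open>D \<in> Q\<close> by blast
    qed
  qed
  moreover have "inj_on J P" using bij P unfolding bij_betw_def by (meson inj_on_subset)
  ultimately have "bij_betw J P Q" by (simp add: bij_betw_def)
  moreover have "J \<in> hom (G\<lparr>carrier := P\<rparr>) (H\<lparr>carrier := Q\<rparr>)"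
    using hom \<open>J ` P = Q\<close> by (auto simp: hom_def dest: subsetD[OF P(1)])
  ultimately show ?thesis by (simp add: iso_def)
qed

text \<open>Every loop in \<open>- M\<^sub>1\<close> can be lifted to \<open>{d\<^sub>1 > 3 * h} \<subseteq> U\<close>. A loop in \<open>U\<close> that is null in
  \<open>- M\<^sub>1\<close> is null in \<open>{d\<^sub>1 > h} \<subseteq> - M\<^sub>2\<close>, hence in \<open>U\<close>. A loop in \<open>U\<close> that is peripheral for
  \<open>M\<^sub>1\<close> is homotopic in \<open>{d\<^sub>1 > h}\<close> to a loop with \<open>d\<^sub>1 \<le> h + e\<close>, so \<open>d\<^sub>2 \<le> 2 * h + e\<close>; one that is
  peripheral for \<open>M\<^sub>2\<close> is homotopic in \<open>U\<close> to a loop with \<open>d\<^sub>2 \<le> 2 * h + e\<close>, so \<open>d\<^sub>1 \<le> 3 * h + e\<close>.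
  The heights of \<open>b\<close> exclude peaks of \<open>M\<^sub>1\<close> and \<open>M\<^sub>2\<close> below these levels.\<close>

lemma peripheral_iso_via_common_subset:
  fixes M\<^sub>1 M\<^sub>2 :: "'a::euclidean_space set"
  assumes 1: "small_distortion_complement M\<^sub>1 r\<^sub>1" and 2: "small_distortion_complement M\<^sub>2 r\<^sub>2"
    and h: "h > 0" "4 * h < r\<^sub>1" "4 * h < r\<^sub>2"
    and close: "\<And>x. infdist x M\<^sub>2 \<le> infdist x M\<^sub>1 + h" "\<And>x. infdist x M\<^sub>1 \<le> infdist x M\<^sub>2 + h"
    and b: "3 * h < infdist b M\<^sub>1" "2 * h < infdist b M\<^sub>2"
  shows "\<exists>J \<in> iso (fundamental_group (- M\<^sub>1) b) (fundamental_group (- M\<^sub>2) b).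
    \<forall>C \<in> carrier (fundamental_group (- M\<^sub>1) b). J C \<in> peripheral_subgroup M\<^sub>2 b \<longleftrightarrow> C \<in> peripheral_subgroup M\<^sub>1 b"
proof -
  interpret M1: small_distortion_complement M\<^sub>1 r\<^sub>1 by (rule 1)
  interpret M2: small_distortion_complement M\<^sub>2 r\<^sub>2 by (rule 2)
  let ?U = "M2.above (2 * h)"
  have sub: "M1.above (3 * h) \<subseteq> ?U" "?U \<subseteq> M1.above h" "M1.above h \<subseteq> - M\<^sub>2" "?U \<subseteq> - M\<^sub>1" "?U \<subseteq> - M\<^sub>2"
  proof -
    have "2 * h < infdist x M\<^sub>2" if "3 * h < infdist x M\<^sub>1" for x using that close(2)[of x] by linarith
    then show "M1.above (3 * h) \<subseteq> ?U" by (auto simp: M1.above_def M2.above_def)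
    have "h < infdist x M\<^sub>1" if "2 * h < infdist x M\<^sub>2" for x using that close(1)[of x] by linarith
    then show 3: "?U \<subseteq> M1.above h" by (auto simp: M1.above_def M2.above_def)
    have "0 < infdist x M\<^sub>2" if "h < infdist x M\<^sub>1" for x using that close(2)[of x] by linarith
    then show "M1.above h \<subseteq> - M\<^sub>2" unfolding M1.above_def M2.compl_iff subset_iff by blast
    show "?U \<subseteq> - M\<^sub>1" using 3 M1.above_subset[of h] h(1) by auto
    show "?U \<subseteq> - M\<^sub>2" using M2.above_subset[of "2 * h"] h(1) by auto
  qed
  have bU: "b \<in> ?U" using b by (simp add: M2.above_def)
  have t1: "0 < h" "h < r\<^sub>1" "h < infdist b M\<^sub>1" and t3: "0 < 3 * h" "3 * h < r\<^sub>1" "3 * h < infdist b M\<^sub>1"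
    and t2: "0 < 2 * h" "2 * h < r\<^sub>2" "2 * h < infdist b M\<^sub>2"
    using h b by linarith+
  have null2: "\<exists>z. homotopic_loops ?U p (linepath z z)"
    if "path_image p \<subseteq> ?U" "\<exists>z. homotopic_loops (- M\<^sub>2) p (linepath z z)" for p
    by (rule M2.null_homotopic_in_above[OF t2 that])
  have null1: "\<exists>z. homotopic_loops ?U p (linepath z z)"
    if p: "path_image p \<subseteq> ?U" "\<exists>z. homotopic_loops (- M\<^sub>1) p (linepath z z)" for p
  proof (rule null2[OF p(1)])
    have "\<exists>z. homotopic_loops (M1.above h) p (linepath z z)"
      using p sub(2) by (intro M1.null_homotopic_in_above[OF t1]) auto
    then show "\<exists>z. homotopic_loops (- M\<^sub>2) p (linepath z z)" using sub(3) homotopic_loops_subset by blast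
  qed
  have inj: "homotopic_paths ?U p (linepath b b)"
    if p: "loop_at ?U b p" "homotopic_paths (- M) p (linepath b b)" and "?U \<subseteq> - M"
      and null: "\<And>p. path_image p \<subseteq> ?U \<Longrightarrow> \<exists>z. homotopic_loops (- M) p (linepath z z) \<Longrightarrow> \<exists>z. homotopic_loops ?U p (linepath z z)" for M p
  proof -
    have "loop_at (- M) b p" using p(1) \<open>?U \<subseteq> - M\<close> by (auto simp: loop_at_def)
    then have "\<exists>z. homotopic_loops (- M) p (linepath z z)" using p(2) null_homotopic_loop_iff by blast
    then have "\<exists>z. homotopic_loops ?U p (linepath z z)" using null p(1) by (simp add: loop_at_def)
    then show ?thesis using null_homotopic_loop_iff[OF p(1)] by blast
  qed
  have surj1: "\<exists>p. loop_at ?U b p \<and> homotopic_paths (- M\<^sub>1) p q" if q: "loop_at (- M\<^sub>1) b q" for q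
  proof -
    obtain p where p: "loop_at (M1.above (3 * h)) b p" "homotopic_paths (- M\<^sub>1) p q"
      using M1.loop_deforms_into_above[OF t3 q] by blast
    have "loop_at ?U b p" using p(1) sub(1) unfolding loop_at_def by blast
    then show ?thesis using p(2) by blast
  qed
  have surj2: "\<exists>p. loop_at ?U b p \<and> homotopic_paths (- M\<^sub>2) p q" if "loop_at (- M\<^sub>2) b q" for q
    using M2.loop_deforms_into_above[OF t2 that] .
  let ?G = "fundamental_group ?U b" and ?G1 = "fundamental_group (- M\<^sub>1) b" and ?G2 = "fundamental_group (- M\<^sub>2) b"
  obtain i1 where i1: "i1 \<in> iso ?G ?G1"
    "\<And>p. loop_at ?U b p \<Longrightarrow> i1 (Collect (homotopic_paths ?U p)) = Collect (homotopic_paths (- M\<^sub>1) p)"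
    using iso_inclusion[OF sub(4) bU surj1 inj[OF _ _ sub(4) null1]] by blast
  obtain i2 where i2: "i2 \<in> iso ?G ?G2"
    "\<And>p. loop_at ?U b p \<Longrightarrow> i2 (Collect (homotopic_paths ?U p)) = Collect (homotopic_paths (- M\<^sub>2) p)"
    using iso_inclusion[OF sub(5) bU surj2 inj[OF _ _ sub(5) null2]] by blast
  interpret G: group ?G by (rule group_fundamental_group[OF bU])
  define J where "J = i2 \<circ> inv_into (carrier ?G) i1"
  have J: "J \<in> iso ?G1 ?G2" unfolding J_def by (rule iso_set_trans[OF G.iso_set_sym[OF i1(1)] i2(1)])
  \<comment> \<open>the slack left by the strict inequalities, so that pushing down may start slightly above the levels\<close>
  obtain e where e: "e > 0" "2 * h + e < r\<^sub>2" "2 * h + e < infdist b M\<^sub>2" "3 * h + e < r\<^sub>1" "3 * h + e < infdist b M\<^sub>1"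
  proof -
    obtain e where "0 < e" "e < Min {r\<^sub>2 - 2 * h, infdist b M\<^sub>2 - 2 * h, r\<^sub>1 - 3 * h, infdist b M\<^sub>1 - 3 * h}"
      using dense[of 0 "Min {r\<^sub>2 - 2 * h, infdist b M\<^sub>2 - 2 * h, r\<^sub>1 - 3 * h, infdist b M\<^sub>1 - 3 * h}"] t2 t3 by auto
    then show ?thesis by (intro that[of e]) auto
  qed
  have periph: "freely_peripheral M\<^sub>1 u \<longleftrightarrow> freely_peripheral M\<^sub>2 u" if u: "loop_at ?U b u" for u
  proof
    assume u1: "freely_peripheral M\<^sub>1 u"
    have "path_image u \<subseteq> M1.above h" using u sub(2) by (auto simp: loop_at_def)
    then obtain c where c: "homotopic_loops (M1.above h) u c" "\<And>x. x \<in> path_image c \<Longrightarrow> infdist x M\<^sub>1 \<le> h + e"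
      using M1.freely_peripheral_representative[OF t1 e(1) _ u1] by blast
    have hom: "homotopic_loops (- M\<^sub>2) u c" using c(1) sub(3) by (rule homotopic_loops_subset)
    have "freely_peripheral M\<^sub>2 c"
    proof (rule M2.freely_peripheral_if_near[of "2 * h + e" b])
      show "path c" "pathfinish c = pathstart c"
        using homotopic_loops_imp_path[OF hom] homotopic_loops_imp_loop[OF hom] by auto
      show "path_image c \<subseteq> M2.above 0"
        using homotopic_loops_imp_subset[OF hom] M2.compl_iff by (auto simp: M2.above_def)
      show "infdist x M\<^sub>2 \<le> 2 * h + e" if "x \<in> path_image c" for x
        using close(1)[of x] c(2)[OF that] by linarith
    qed (use e h in auto)
    then show "freely_peripheral M\<^sub>2 u" using freely_peripheral_homotopic_loops[OF hom] by blast
  next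
    assume u2: "freely_peripheral M\<^sub>2 u"
    have "path_image u \<subseteq> ?U" using u by (auto simp: loop_at_def)
    then obtain c where c: "homotopic_loops ?U u c" "\<And>x. x \<in> path_image c \<Longrightarrow> infdist x M\<^sub>2 \<le> 2 * h + e"
      using M2.freely_peripheral_representative[OF t2 e(1) _ u2] by blast
    have hom: "homotopic_loops (- M\<^sub>1) u c" using c(1) sub(4) by (rule homotopic_loops_subset)
    have "freely_peripheral M\<^sub>1 c"
    proof (rule M1.freely_peripheral_if_near[of "3 * h + e" b])
      show "path c" "pathfinish c = pathstart c"
        using homotopic_loops_imp_path[OF hom] homotopic_loops_imp_loop[OF hom] by auto
      show "path_image c \<subseteq> M1.above 0"
        using homotopic_loops_imp_subset[OF hom] M1.compl_iff by (auto simp: M1.above_def)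
      show "infdist x M\<^sub>1 \<le> 3 * h + e" if "x \<in> path_image c" for x
        using close(2)[of x] c(2)[OF that] by linarith
    qed (use e h in auto)
    then show "freely_peripheral M\<^sub>1 u" using freely_peripheral_homotopic_loops[OF hom] by blast
  qed
  have "J C \<in> peripheral_subgroup M\<^sub>2 b \<longleftrightarrow> C \<in> peripheral_subgroup M\<^sub>1 b" if C: "C \<in> carrier ?G1" for C
  proof -
    have bij: "bij_betw i1 (carrier ?G) (carrier ?G1)" using i1(1) by (simp add: iso_def)
    then obtain D where D: "D \<in> carrier ?G" "C = i1 D" using C unfolding bij_betw_def by blast
    have JC: "J C = i2 D" using D bij by (simp add: J_def bij_betw_def)
    obtain u where u: "loop_at ?U b u" "D = Collect (homotopic_paths ?U u)"
      using D(1) unfolding carrier_fundamental_group_loop_at by blast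
    have "loop_at (- M\<^sub>1) b u" "loop_at (- M\<^sub>2) b u" using u(1) sub(4,5) by (auto simp: loop_at_def)
    moreover have "J C = Collect (homotopic_paths (- M\<^sub>2) u)" using JC u(2) i2(2)[OF u(1)] by simp
    moreover have "C = Collect (homotopic_paths (- M\<^sub>1) u)" using D(2) u(2) i1(2)[OF u(1)] by simp
    ultimately show ?thesis using peripheral_subgroup_iff periph[OF u(1)] by metis
  qed
  then show ?thesis using J by blast
qed

text \<open>If \<open>d\<^sub>1 x > 4 * h\<close> or \<open>d\<^sub>2 x > 4 * h\<close> at some \<open>x\<close>, then the other distance exceeds \<open>3 * h\<close> there,
  so \<open>x\<close> can serve as the common base point. Otherwise both distances stay below the scales.\<close>

theorem theorem1p2:
  fixes M\<^sub>1 M\<^sub>2 :: "(real ^ 'n) set"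
    and r\<^sub>1 r\<^sub>2 :: real
    and a\<^sub>1 a\<^sub>2 :: "real ^ 'n"
  assumes "CARD('n) \<ge> 3"
    and "M\<^sub>1 \<noteq> {}" and "closed M\<^sub>1" and "path_connected M\<^sub>1" and "path_connected (- M\<^sub>1)"
    and "M\<^sub>2 \<noteq> {}" and "closed M\<^sub>2" and "path_connected M\<^sub>2" and "path_connected (- M\<^sub>2)"
    and "r\<^sub>1 > 0" and "local_distortion M\<^sub>1 r\<^sub>1 < ennreal (distortion_bound CARD('n))"
    and "r\<^sub>2 > 0" and "local_distortion M\<^sub>2 r\<^sub>2 < ennreal (distortion_bound CARD('n))"
    and "hausdorff_dist M\<^sub>1 M\<^sub>2 < ennreal (1 / 4 * min r\<^sub>1 r\<^sub>2)"
    and "a\<^sub>1 \<in> - M\<^sub>1" and "a\<^sub>2 \<in> - M\<^sub>2"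
  shows "\<exists>J. J \<in> iso (fundamental_group (- M\<^sub>1) a\<^sub>1) (fundamental_group (- M\<^sub>2) a\<^sub>2) \<and>
             J \<in> iso (fundamental_group (- M\<^sub>1) a\<^sub>1 \<lparr>carrier := peripheral_subgroup M\<^sub>1 a\<^sub>1\<rparr>)
                     (fundamental_group (- M\<^sub>2) a\<^sub>2 \<lparr>carrier := peripheral_subgroup M\<^sub>2 a\<^sub>2\<rparr>)"
proof -
  interpret M1: small_distortion_complement M\<^sub>1 r\<^sub>1 by unfold_locales (use assms in simp_all)
  interpret M2: small_distortion_complement M\<^sub>2 r\<^sub>2 by unfold_locales (use assms in simp_all)
  let ?G1 = "fundamental_group (- M\<^sub>1) a\<^sub>1" and ?G2 = "fundamental_group (- M\<^sub>2) a\<^sub>2"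
  obtain h where h: "h > 0" "4 * h < r\<^sub>1" "4 * h < r\<^sub>2" "hausdorff_dist M\<^sub>1 M\<^sub>2 < ennreal h"
  proof -
    obtain z where z: "hausdorff_dist M\<^sub>1 M\<^sub>2 < z" "z < ennreal (1 / 4 * min r\<^sub>1 r\<^sub>2)"
      using dense[OF assms(14)] by blast
    obtain h where h: "z = ennreal h" "h \<ge> 0" using z(2) by (cases z) auto
    then have "h < 1 / 4 * min r\<^sub>1 r\<^sub>2" using z(2) by (simp add: ennreal_less_iff)
    moreover have "h > 0" using z(1) h by (metis ennreal_0 not_less_zero order_le_less)
    ultimately show ?thesis using that[of h] z(1) h(1) by (simp add: min_def split: if_splits)
  qed
  have close: "infdist x M\<^sub>2 \<le> infdist x M\<^sub>1 + h" "infdist x M\<^sub>1 \<le> infdist x M\<^sub>2 + h" for x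
    using hausdorff_dist_less_imp_infdist_close[of M\<^sub>1 M\<^sub>2 h x] hausdorff_dist_less_imp_infdist_close[of M\<^sub>2 M\<^sub>1 h x]
      h hausdorff_dist_commute[of M\<^sub>1 M\<^sub>2] assms by auto
  have "\<exists>J \<in> iso ?G1 ?G2. \<forall>C \<in> carrier ?G1. J C \<in> peripheral_subgroup M\<^sub>2 a\<^sub>2 \<longleftrightarrow> C \<in> peripheral_subgroup M\<^sub>1 a\<^sub>1"
  proof (cases "\<exists>b. 3 * h < infdist b M\<^sub>1 \<and> 2 * h < infdist b M\<^sub>2")
    case True
    then obtain b where b: "3 * h < infdist b M\<^sub>1" "2 * h < infdist b M\<^sub>2" by blast
    then have bM: "b \<in> - M\<^sub>1" "b \<in> - M\<^sub>2" using h by (auto simp: M1.compl_iff M2.compl_iff)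
    let ?H1 = "fundamental_group (- M\<^sub>1) b" and ?H2 = "fundamental_group (- M\<^sub>2) b"
    obtain j where j: "j \<in> iso ?G1 ?H1"
      "\<And>C. C \<in> carrier ?G1 \<Longrightarrow> j C \<in> peripheral_subgroup M\<^sub>1 b \<longleftrightarrow> C \<in> peripheral_subgroup M\<^sub>1 a\<^sub>1"
      using M1.peripheral_iso_change_of_base_point[OF assms(15) bM(1)] by blast
    obtain k where k: "k \<in> iso ?H1 ?H2"
      "\<And>C. C \<in> carrier ?H1 \<Longrightarrow> k C \<in> peripheral_subgroup M\<^sub>2 b \<longleftrightarrow> C \<in> peripheral_subgroup M\<^sub>1 b"
      using peripheral_iso_via_common_subset[OF M1.small_distortion_complement_axioms
          M2.small_distortion_complement_axioms h(1-3) close b] by blast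
    obtain l where l: "l \<in> iso ?H2 ?G2"
      "\<And>C. C \<in> carrier ?H2 \<Longrightarrow> l C \<in> peripheral_subgroup M\<^sub>2 a\<^sub>2 \<longleftrightarrow> C \<in> peripheral_subgroup M\<^sub>2 b"
      using M2.peripheral_iso_change_of_base_point[OF bM(2) assms(16)] by blast
    have "l \<circ> (k \<circ> j) \<in> iso ?G1 ?G2" by (rule iso_set_trans[OF iso_set_trans[OF j(1) k(1)] l(1)])
    moreover have "j C \<in> carrier ?H1" "k (j C) \<in> carrier ?H2" if "C \<in> carrier ?G1" for C
      using that j(1) k(1) by (auto simp: iso_def hom_def)
    ultimately show ?thesis using j(2) k(2) l(2) by (intro bexI[of _ "l \<circ> (k \<circ> j)"]) auto
  next
    case False
    have bd: "infdist x M\<^sub>1 \<le> 4 * h" "infdist x M\<^sub>2 \<le> 4 * h" for x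
      using False close[of x] h(1) by (smt (verit))+
    note triv1 = M1.trivial_if_infdist_bounded[OF h(2) bd(1) assms(15)]
    note triv2 = M2.trivial_if_infdist_bounded[OF h(3) bd(2) assms(16)]
    interpret G2: group ?G2 by (rule group_fundamental_group) fact
    interpret G1: group ?G1 by (rule group_fundamental_group) fact
    have "(\<lambda>_. \<one>\<^bsub>?G2\<^esub>) \<in> iso ?G1 ?G2"
      unfolding iso_def hom_def bij_betw_def triv1(1) triv2(1) by auto
    then show ?thesis using triv1 triv2 by (intro bexI[of _ "\<lambda>_. \<one>\<^bsub>?G2\<^esub>"]) auto
  qed
  then obtain J where J: "J \<in> iso ?G1 ?G2"
    "\<And>C. C \<in> carrier ?G1 \<Longrightarrow> J C \<in> peripheral_subgroup M\<^sub>2 a\<^sub>2 \<longleftrightarrow> C \<in> peripheral_subgroup M\<^sub>1 a\<^sub>1"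
    by blast
  have "peripheral_subgroup M\<^sub>1 a\<^sub>1 \<subseteq> carrier ?G1" "peripheral_subgroup M\<^sub>2 a\<^sub>2 \<subseteq> carrier ?G2"
    by (auto simp: peripheral_subgroup_def)
  then have "J \<in> iso (?G1\<lparr>carrier := peripheral_subgroup M\<^sub>1 a\<^sub>1\<rparr>) (?G2\<lparr>carrier := peripheral_subgroup M\<^sub>2 a\<^sub>2\<rparr>)"
    using J by (intro iso_restrict_to_subset) auto
  then show ?thesis using J(1) by blast
qed

end
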